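(* Let $0<\alpha<2$ and let $p_\alpha(x,n)=\mathbb{P}(S^\alpha_n=x)$ be the transition function of the subordinate simple random walk $S^\alpha$ on $\mathbb{Z}^d$. Then as $n$ and $\|x\|_2$ tend to infinity we have: (1) if $n\|x\|_2^{-\alpha}$ tends to zero then $$\frac{1}{2d}\sum_{j=1}^d\big(p_\alpha(x+e_j,n)+2p_\alpha(x,n)+p_\alpha(x-e_j,n)\big)\sim C_{d,\alpha}\,n\,\|x\|_2^{-d-\alpha};$$ (2) if $n\|x\|_2^{-\alpha}$ tends to infinity then $$p_\alpha(x,n)\sim p_\alpha(0,n)\sim D_{d,\alpha}\,n^{-d/\alpha}.$$ The constants are given explicitly by $$C_{d,\alpha}=\alpha 2^{\alpha/2}\pi^{-d/2-1}d^{-\alpha/2}\,\Gamma\Big(\frac{\alpha}{2}\Big)\Gamma\Big(\frac{d+\alpha}{2}\Big)\sin\Big(\frac{\pi\alpha}{2}\Big),\qquad D_{d,\alpha}=(2\pi)^{d/2}\,\frac{\Gamma(1+d/\alpha)}{\Gamma(1+d/2)}.$$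
   Context: $\{e_1,\dots,e_d\}$ is the standard basis of $\mathbb{R}^d$ and $\|\cdot\|_2$ is the Euclidean norm; $n\in\mathbb{N}$ and $x\in\mathbb{Z}^d$. $f\sim g$ in a limiting regime means that $f/g\to1$ in that regime. $S$ is the simple random walk on $\mathbb{Z}^d$ started at $0$, with transition operator $P$. The subordinate random walk $S^\alpha$ is the random walk whose transition operator $P_\alpha$ satisfies $I-P_\alpha=(I-P)^{\alpha/2}$, where $I$ is the identity operator. Equivalently, $S^\alpha$ coincides in distribution with $S_{\tau^\alpha}$, where the discrete subordinator $\tau^\alpha=(\tau^\alpha_n)$ is a random walk with i.i.d. positive integer valued increments, independent of $S$, determined by $\mathbb{E}(e^{-\lambda\tau^\alpha_n})=\big(1-(1-e^{-\lambda})^{\alpha/2}\big)^n$ for $\lambda\ge0$.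
   Formalization: In (2) the constant is D_{d,α} = (d/(2π))^{d/2} Γ(1+d/α)/Γ(1+d/2) instead of the printed (2π)^{d/2} Γ(1+d/α)/Γ(1+d/2), which is wrong for every d (for d = α = 1 the true limit is √2/π, the printed value is 2√2). *)

theory Defs
  imports "HOL-Probability.Probability" "HOL-Library.Landau_Symbols"
begin

text \<open>
  The lattice \<open>\<int>\<^sup>d\<close> is the type \<^typ>\<open>int ^ 'd\<close> with \<open>d = CARD('d)\<close>; the basis vector
  \<open>e\<^sub>j\<close> is \<^term>\<open>axis j 1\<close>.
\<close>

definition lattice_norm :: "int ^ 'd \<Rightarrow> real" where
  "lattice_norm x = norm (\<chi> i. real_of_int (x $ i))"

text \<open>
  Random walk started at \<open>0\<close>. The definition is also used for \<^typ>\<open>nat\<close>-valued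
  walks, where subtraction truncates; this is harmless in \<open>discrete_subordinator\<close> below, since
  there the (truncated) increments are required to be positive.
\<close>

definition random_walk :: "'w measure \<Rightarrow> (nat \<Rightarrow> 'w \<Rightarrow> 'a :: {zero, minus}) \<Rightarrow> bool" where
  "random_walk M S \<longleftrightarrow>
     prob_space M \<and>
     (\<forall>n. S n \<in> measurable M (count_space UNIV)) \<and>
     (AE \<omega> in M. S 0 \<omega> = 0) \<and>
     prob_space.indep_vars M (\<lambda>_. count_space UNIV) (\<lambda>n \<omega>. S (Suc n) \<omega> - S n \<omega>) UNIV \<and>
     (\<forall>n. distr M (count_space UNIV) (\<lambda>\<omega>. S (Suc n) \<omega> - S n \<omega>) =
          distr M (count_space UNIV) (\<lambda>\<omega>. S 1 \<omega> - S 0 \<omega>))"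

definition simple_random_walk :: "'w measure \<Rightarrow> (nat \<Rightarrow> 'w \<Rightarrow> int ^ 'd) \<Rightarrow> bool" where
  "simple_random_walk M S \<longleftrightarrow>
     random_walk M S \<and>
     distr M (count_space UNIV) (\<lambda>\<omega>. S 1 \<omega> - S 0 \<omega>) =
       measure_pmf (pmf_of_set {axis j s | j s. s = 1 \<or> s = -1})"

definition discrete_subordinator :: "real \<Rightarrow> 'w measure \<Rightarrow> (nat \<Rightarrow> 'w \<Rightarrow> nat) \<Rightarrow> bool" where
  "discrete_subordinator \<alpha> M \<tau> \<longleftrightarrow>
     random_walk M \<tau> \<and>
     (\<forall>n. AE \<omega> in M. \<tau> (Suc n) \<omega> - \<tau> n \<omega> > 0) \<and>
     (\<forall>n. \<forall>u\<ge>0. prob_space.expectation M (\<lambda>\<omega>. exp (- u * real (\<tau> n \<omega>))) =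
            (1 - (1 - exp (- u)) powr (\<alpha> / 2)) ^ n)"

definition indep_processes ::
    "'w measure \<Rightarrow> (nat \<Rightarrow> 'w \<Rightarrow> 'a) \<Rightarrow> (nat \<Rightarrow> 'w \<Rightarrow> 'b) \<Rightarrow> bool" where
  "indep_processes M X Y \<longleftrightarrow>
     prob_space.indep_set M
       (sets (vimage_algebra (space M) (\<lambda>\<omega> n. X n \<omega>) (\<Pi>\<^sub>M n\<in>UNIV. count_space UNIV)))
       (sets (vimage_algebra (space M) (\<lambda>\<omega> n. Y n \<omega>) (\<Pi>\<^sub>M n\<in>UNIV. count_space UNIV)))"

definition subordinate :: "(nat \<Rightarrow> 'w \<Rightarrow> 'a) \<Rightarrow> (nat \<Rightarrow> 'w \<Rightarrow> nat) \<Rightarrow> nat \<Rightarrow> 'w \<Rightarrow> 'a" where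
  "subordinate S \<tau> n \<omega> = S (\<tau> n \<omega>) \<omega>"

definition transition_fun :: "'w measure \<Rightarrow> (nat \<Rightarrow> 'w \<Rightarrow> 'a) \<Rightarrow> 'a \<Rightarrow> nat \<Rightarrow> real" where
  "transition_fun M X x n = measure M {\<omega> \<in> space M. X n \<omega> = x}"

definition C_const :: "nat \<Rightarrow> real \<Rightarrow> real" where
  "C_const d \<alpha> =
     \<alpha> * 2 powr (\<alpha> / 2) * pi powr (- real d / 2 - 1) * real d powr (- \<alpha> / 2) *
     Gamma (\<alpha> / 2) * Gamma ((real d + \<alpha>) / 2) * sin (pi * \<alpha> / 2)"

text \<open>
  The source prints the first factor of this constant as \<open>(2\<pi>)\<^bsup>d/2\<^esup>\<close>, a misprint. As the
  characteristic function of \<open>S\<^sup>\<alpha>\<^sub>1\<close> is \<open>1 - (\<bar>\<theta>\<bar>\<^sup>2/(2d))\<^bsup>\<alpha>/2\<^esup> (1 + o(1))\<close> at \<open>0\<close>, the constant is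
  \<open>(2\<pi>)\<^bsup>-d\<^esup> \<integral> exp (- (\<bar>\<theta>\<bar>\<^sup>2/(2d))\<^bsup>\<alpha>/2\<^esup>) d\<theta>\<close> over \<open>\<real>\<^sup>d\<close>, and this evaluates to the value below.
  (For \<open>d = \<alpha> = 1\<close> it is \<open>\<surd>2/\<pi>\<close>.)
\<close>

definition D_const :: "nat \<Rightarrow> real \<Rightarrow> real" where
  "D_const d \<alpha> =
     (real d / (2 * pi)) powr (real d / 2) * Gamma (1 + real d / \<alpha>) / Gamma (1 + real d / 2)"

end

theory Submission
  imports Defs "HOL-Complex_Analysis.Cauchy_Integral_Formula"
begin

text \<open>
  Write \<open>b = \<alpha>/2\<close>, \<open>p\<^sub>k(x) = P(S\<^sub>k = x)\<close> and \<open>q\<^sub>n(k) = P(\<tau>\<^sub>n = k)\<close>, so that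
  \<open>p\<^sub>\<alpha>(x,n) = \<Sum>\<^sub>k q\<^sub>n(k) p\<^sub>k(x)\<close> and \<open>q\<^sub>n(k)\<close> is the \<open>k\<close>-th coefficient of \<open>(1 - (1 - z)\<^sup>b)\<^sup>n\<close>.

  If \<open>n \<parallel>x\<parallel>\<^bsup>-\<alpha>\<^esup> \<rightarrow> \<infinity>\<close>, then \<open>p\<^sub>\<alpha>(x,n)\<close> is the Fourier integral of \<open>(1 - (1 - \<phi>)\<^sup>b)\<^sup>n\<close>, with \<open>\<phi>\<close> the
  symbol of the simple walk. After rescaling by \<open>n\<^bsup>1/\<alpha>\<^esup>\<close> the integrand converges to
  \<open>exp (- (\<bar>t\<bar>\<^sup>2/2d)\<^sup>b)\<close>, whose integral is a Gamma value times the volume of the unit ball.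

  If \<open>n \<parallel>x\<parallel>\<^bsup>-\<alpha>\<^esup> \<rightarrow> 0\<close>, expanding the \<open>n\<close>-th power binomially gives
  \<open>q\<^sub>n(k) \<sim> n b / \<Gamma>(1 - b) k\<^bsup>-1-b\<^esup>\<close> as long as \<open>n k\<^bsup>-b\<^esup>\<close> is small, that is for all \<open>k\<close> of order
  \<open>\<parallel>x\<parallel>\<^sup>2\<close>. For those \<open>k\<close> the local central limit theorem replaces \<open>p\<^sub>k(x) + p\<^bsub>k+1\<^esub>(x)\<close> by twice a
  Gaussian; smaller \<open>k\<close> are negligible because \<open>p\<^sub>k(x)\<close> decays fast for \<open>\<parallel>x\<parallel>\<^sup>2\<close> much larger than \<open>k\<close>.
  The sum over \<open>k\<close> then becomes the integral of \<open>s\<^bsup>-1-b-d/2\<^esup> exp (- d/2s)\<close>.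
\<close>

section \<open>Integration over Euclidean space\<close>

text \<open>The main obstacle is parity. The symbol \<phi> of the simple walk has modulus 1 at the
  origin and also at the corners of the torus (all coordinates pi or -pi), where it is -1. In the
  diagonal regime this is harmless: there 1 - (1 - \<phi>)^b equals 1 - 2^b, of modulus below 1
  because 0 < b < 1. In the off-diagonal regime p_k(x) vanishes for every other k. Averaging over
  the neighbours of x amounts to one more step of S, and p_k + p_(k+1) has the integrand \<phi>^k (1
  + \<phi>), whose second factor vanishes at the corners.

  The expansion of q_n breaks down at k of order n^(1/b) = o(|x|^2). Below that only the total mass
  1 of q_n enters, against a polynomial bound on p_k(x) of high degree that comes from the Fourier
  integral at a complex frequency. Nonnegativity and total mass of the coefficients, invisible in
  their alternating formula, are inherited from the law of the subordinator.

  The claim is about an arbitrary filter, dominated convergence about sequences; one real quantity,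
  whose divergence describes the regime, mediates between them.\<close>

lemma jordan_inequality:
  fixes x :: real
  assumes "0 \<le> x" "x \<le> pi / 2"
  shows "2 / pi * x \<le> sin x"
proof -
  have "convex_on {0..pi/2} (\<lambda>x. - sin x)"
  proof (rule f''_ge0_imp_convex)
    show "((\<lambda>x. - sin x) has_real_derivative - cos x) (at x)" for x :: real
      by (auto intro!: derivative_eq_intros)
    show "((\<lambda>x. - cos x) has_real_derivative sin x) (at x)" for x :: real
      by (auto intro!: derivative_eq_intros)
    show "0 \<le> sin x" if "x \<in> {0..pi/2}" for x :: real
      using that by (intro sin_ge_zero) auto
  qed auto
  then have "- sin ((1 - 2 / pi * x) *\<^sub>R 0 + (2 / pi * x) *\<^sub>R (pi / 2))
      \<le> (1 - 2 / pi * x) * - sin 0 + (2 / pi * x) * - sin (pi / 2)"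
    using assms by (intro convex_onD) (auto simp: field_simps)
  then show ?thesis by simp
qed

text \<open>Half-angle form of Jordan's inequality. It holds on the whole period and not only near
  0, so the majorants built from it are valid on all of the torus.\<close>

lemma one_minus_cos_ge:
  fixes x :: real
  assumes "\<bar>x\<bar> \<le> pi"
  shows "2 / pi\<^sup>2 * x\<^sup>2 \<le> 1 - cos x"
proof -
  have "2 / pi * (\<bar>x\<bar> / 2) \<le> sin (\<bar>x\<bar> / 2)"
    using assms by (intro jordan_inequality) auto
  then have "(2 / pi * (\<bar>x\<bar> / 2))\<^sup>2 \<le> (sin (\<bar>x\<bar> / 2))\<^sup>2"
    by (intro power_mono) auto
  also have "\<dots> = (1 - cos x) / 2"
    using cos_double_sin[of "\<bar>x\<bar> / 2"] by simp
  finally show ?thesis by (simp add: power_divide field_simps)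
qed

text \<open>Lebesgue measure on a Euclidean space is an image of the product measure indexed by
  \<open>Basis\<close>; the bijection sending \<open>i\<close> to \<open>axis i 1\<close> carries
  the product formula over to coordinates.\<close>

lemma lborel_vec_prod:
  fixes f :: "'d::finite \<Rightarrow> real \<Rightarrow> 'b::{real_normed_field,banach,second_countable_topology}"
  assumes f: "\<And>i. integrable lborel (f i)"
  shows "integrable lborel (\<lambda>t::real^'d. \<Prod>i\<in>UNIV. f i (t $ i))"
    and "(\<integral>t. (\<Prod>i\<in>UNIV. f i (t $ i)) \<partial>(lborel :: (real^'d) measure)) =
      (\<Prod>i\<in>UNIV. integral\<^sup>L lborel (f i))"
proof -
  interpret P: product_sigma_finite "\<lambda>b::real^'d. lborel :: real measure" ..
  define g where "g b = f (axis_index b)" for b :: "real^'d"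
  have m [measurable]: "f i \<in> borel_measurable borel" for i
    using f[of i] by auto
  have ig: "integrable lborel (g b)" for b using f by (simp add: g_def)
  have B: "(Basis :: (real^'d) set) = (\<lambda>i. axis i 1) ` UNIV"
    by (auto simp: Basis_vec_def)
  have inj: "inj (\<lambda>i. axis i (1::real))"
    by (auto simp: inj_on_def axis_eq_axis)
  have ai: "axis_index (axis i (1::real)) = i" for i :: 'd
    by (simp add: axis_index_axis)
  have eq: "(\<Prod>b\<in>Basis. g b (y b)) = (\<Prod>i\<in>UNIV. f i ((\<Sum>b\<in>Basis. y b *\<^sub>R b) $ i))"
    for y :: "real^'d \<Rightarrow> real"
  proof -
    have "(\<Sum>b\<in>Basis. y b *\<^sub>R b) $ i = y (axis i 1)" for i
    proof -
      have "(\<Sum>b\<in>Basis. y b *\<^sub>R b) $ i = (\<Sum>b\<in>Basis. y b *\<^sub>R b) \<bullet> axis i 1"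
        by (simp add: inner_axis)
      also have "\<dots> = y (axis i 1)"
        by (rule inner_sum_left_Basis) (simp add: axis_in_Basis_iff)
      finally show ?thesis .
    qed
    then show ?thesis
      unfolding B by (subst prod.reindex[OF inj]) (simp add: g_def ai)
  qed
  have int: "integrable (Pi\<^sub>M Basis (\<lambda>_. lborel)) (\<lambda>y. \<Prod>b\<in>Basis. g b (y b))"
    using ig by (intro P.product_integrable_prod) auto
  show "integrable lborel (\<lambda>t::real^'d. \<Prod>i\<in>UNIV. f i (t $ i))"
    using int unfolding eq by (subst lborel_eq, subst integrable_distr_eq) auto
  have "(\<integral>t. (\<Prod>i\<in>UNIV. f i (t $ i)) \<partial>(lborel :: (real^'d) measure)) =
    (\<integral>y. (\<Prod>b\<in>Basis. g b (y b)) \<partial>(Pi\<^sub>M Basis (\<lambda>_. lborel)))"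
    unfolding eq by (subst lborel_eq, subst integral_distr) auto
  also have "\<dots> = (\<Prod>b\<in>Basis. integral\<^sup>L lborel (g b))"
    using ig by (intro P.product_integral_prod) auto
  also have "\<dots> = (\<Prod>i\<in>UNIV. integral\<^sup>L lborel (f i))"
    unfolding B by (subst prod.reindex[OF inj]) (simp add: g_def ai)
  finally show "(\<integral>t. (\<Prod>i\<in>UNIV. f i (t $ i)) \<partial>(lborel :: (real^'d) measure)) =
      (\<Prod>i\<in>UNIV. integral\<^sup>L lborel (f i))" .
qed

lemma lborel_integral_scale:
  fixes f :: "'a::euclidean_space \<Rightarrow> 'b::{banach,second_countable_topology}"
  assumes "c > 0"
  shows "integrable lborel f \<longleftrightarrow> integrable lborel (\<lambda>t. f (c *\<^sub>R t))"
    and "integral\<^sup>L lborel f = c ^ DIM('a) *\<^sub>R integral\<^sup>L lborel (\<lambda>t. f (c *\<^sub>R t))"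
proof -
  have *: "lborel = density (distr lborel borel (\<lambda>t::'a. c *\<^sub>R t)) (\<lambda>_. ennreal (c ^ DIM('a)))"
    using lborel_affine[of c "0::'a"] assms by simp
  have meas: "f \<in> borel_measurable borel \<longleftrightarrow> (\<lambda>t. f (c *\<^sub>R t)) \<in> borel_measurable borel"
  proof
    assume [measurable]: "(\<lambda>t. f (c *\<^sub>R t)) \<in> borel_measurable borel"
    have "(\<lambda>t. (\<lambda>t. f (c *\<^sub>R t)) ((1 / c) *\<^sub>R t)) \<in> borel_measurable borel"
      by (rule measurable_compose[OF _ \<open>(\<lambda>t. f (c *\<^sub>R t)) \<in> borel_measurable borel\<close>]) simp
    then show "f \<in> borel_measurable borel" using assms by simp
  qed simp
  show i: "integrable lborel f \<longleftrightarrow> integrable lborel (\<lambda>t. f (c *\<^sub>R t))"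
  proof (cases "f \<in> borel_measurable borel")
    case [measurable]: True
    show ?thesis using assms
      using integrable_scaleR_right[of "1 / c ^ DIM('a)" lborel "\<lambda>t. c ^ DIM('a) *\<^sub>R f (c *\<^sub>R t)"]
      by (subst *) (auto simp: integrable_density integrable_distr_eq)
  next
    case False
    then show ?thesis using meas by auto
  qed
  show "integral\<^sup>L lborel f = c ^ DIM('a) *\<^sub>R integral\<^sup>L lborel (\<lambda>t. f (c *\<^sub>R t))"
  proof (cases "f \<in> borel_measurable borel")
    case [measurable]: True
    show ?thesis using assms
      by (subst *) (simp add: integral_density integral_distr)
  next
    case False
    \<comment> \<open>If \<open>f\<close> is not measurable, then neither is its rescaling, and both
      Bochner integrals take the default value 0.\<close>
    then show ?thesis using meas i by (auto simp: not_integrable_integral_eq)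
  qed
qed

text \<open>Read from right to left, this spreads exp (- u) over the levels s >= u. Together with
  Fubini it takes the place of polar coordinates in \<open>radial_exp_integral\<close> and of a
  substitution in \<open>inverse_gamma_integral\<close>.\<close>

lemma nn_integral_exp_tail:
  "(\<integral>\<^sup>+s. ennreal (exp (- s)) * indicator {u..} s \<partial>lborel) = ennreal (exp (- u))" for u :: real
proof -
  have "(\<integral>\<^sup>+s. ennreal (exp (- s)) * indicator {u..} s \<partial>lborel) = ennreal (0 - - exp (- u))"
  proof (rule nn_integral_FTC_atLeast)
    show "((\<lambda>s :: real. - exp (- s)) \<longlongrightarrow> 0) at_top"
      using tendsto_minus[OF filterlim_compose[OF exp_at_bot filterlim_uminus_at_bot_at_top]] by simp
  qed (auto intro!: derivative_eq_intros)
  then show ?thesis by simp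
qed

section \<open>Fourier representation of the simple random walk\<close>

abbreviation rvec :: "int ^ 'd \<Rightarrow> real ^ 'd" where
  "rvec x \<equiv> (\<chi> i. real_of_int (x $ i))"

text \<open>Law of the simple walk at time \<open>k\<close> as a pure recursion, without a
  probability space; \<open>simple_random_walk_srw\<close> makes the connection.\<close>

primrec srw :: "nat \<Rightarrow> int ^ 'd \<Rightarrow> real" where
  "srw 0 x = (if x = 0 then 1 else 0)"
| "srw (Suc k) x =
    (\<Sum>j\<in>UNIV. srw k (x + axis j 1) + srw k (x - axis j 1)) / (2 * real CARD('d))"

lemma srw_nonneg: "0 \<le> srw k x"
  by (induction k arbitrary: x) (auto intro!: divide_nonneg_nonneg sum_nonneg add_nonneg_nonneg)

definition torus :: "(real ^ 'd) set" where
  "torus = {t. \<forall>j. \<bar>t $ j\<bar> \<le> pi}"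

lemma torus_eq_cbox: "torus = cbox (\<chi> i. - pi) (\<chi> i. pi)"
  by (auto simp: torus_def mem_box_cart abs_le_iff minus_le_iff)

lemma torus_sets [measurable]: "torus \<in> sets borel"
  by (simp add: torus_eq_cbox)

lemma compact_torus: "compact torus"
  by (simp add: torus_eq_cbox)

lemma indicator_torus: "indicator torus t = (\<Prod>j\<in>UNIV. indicator {-pi..pi} (t $ j) :: 'b::{comm_semiring_1})"
proof (cases "t \<in> torus")
  case True
  then show ?thesis by (auto simp: torus_def indicator_def abs_le_iff minus_le_iff)
next
  case False
  then obtain j where "\<not> \<bar>t $ j\<bar> \<le> pi" by (auto simp: torus_def)
  then have "t $ j \<notin> {-pi..pi}" by auto
  then have "(\<Prod>j\<in>UNIV. indicator {-pi..pi} (t $ j) :: 'b) = 0"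
    by (intro prod_zero bexI[of _ j]) auto
  then show ?thesis using False by simp
qed

lemma torus_integrable:
  fixes f :: "real ^ 'd \<Rightarrow> 'b::{euclidean_space}"
  assumes "continuous_on torus f"
  shows "integrable lborel (\<lambda>t. indicator torus t *\<^sub>R f t)"
  using assms compact_torus by (rule borel_integrable_compact[rotated])

lemma integral_cis_period:
  fixes m :: int
  shows "integrable lborel (\<lambda>t. indicator {-pi..pi} t * cis (- (of_int m * t)))"
    and "(\<integral>t. indicator {-pi..pi} t * cis (- (of_int m * t)) \<partial>lborel) = (if m = 0 then 2 * pi else 0)"
proof -
  have ind: "indicator {-pi..pi} t * cis (- (of_int m * t)) = indicator {-pi..pi} t *\<^sub>R cis (- (of_int m * t))" for t :: real
    by (simp add: indicator_def)
  show "integrable lborel (\<lambda>t. indicator {-pi..pi} t * cis (- (of_int m * t)))"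
    unfolding ind by (intro borel_integrable_compact continuous_intros) auto
  show "(\<integral>t. indicator {-pi..pi} t * cis (- (of_int m * t)) \<partial>lborel) = (if m = 0 then 2 * pi else 0)"
  proof (cases "m = 0")
    case True
    then show ?thesis unfolding ind by (simp add: scaleR_conv_of_real)
  next
    case False
    define c where "c = - \<i> * of_int m"
    have c: "c \<noteq> 0" using False by (simp add: c_def)
    have cis_c: "cis (- (of_int m * t)) = exp (c * of_real t)" for t
      by (simp add: cis_conv_exp c_def mult_ac)
    define F where "F t = exp (c * of_real t) / c" for t :: real
    have "(\<integral>t. indicator {-pi..pi} t *\<^sub>R cis (- (of_int m * t)) \<partial>lborel) = F pi - F (- pi)"
    proof (rule integral_FTC_Icc)
      show "(F has_vector_derivative cis (- (of_int m * t))) (at t within {-pi..pi})" for t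
        unfolding F_def[abs_def] cis_c using c
        by (intro has_vector_derivative_real_field) (auto intro!: derivative_eq_intros)
    qed (auto intro!: continuous_intros)
    also have "cis (- (of_int m * pi)) = cis (of_int m * pi)"
      using sin_npi_int[of m] by (simp add: complex_eq_iff mult.commute)
    then have "F pi - F (- pi) = 0"
      by (simp only: F_def flip: cis_c) simp
    finally show ?thesis using False unfolding ind by simp
  qed
qed

text \<open>
  The symbol of the walk at the complex frequency \<open>t - \<i> l\<close>. A real tilt \<open>l\<close> yields the off-diagonal
  decay of \<open>srw\<close> directly from the Fourier integral.
\<close>

definition tilt_symbol :: "real ^ 'd \<Rightarrow> real ^ 'd \<Rightarrow> complex" where
  "tilt_symbol l t = (\<Sum>j\<in>UNIV. cosh (Complex (l $ j) (t $ j))) / of_nat CARD('d)"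

lemma continuous_on_tilt_symbol [continuous_intros]: "continuous_on A (tilt_symbol l)"
  unfolding tilt_symbol_def Complex_eq cosh_def by (intro continuous_intros) auto

text \<open>With the weight exp (l . x), moving to x + e_j or x - e_j multiplies the integrand by
  exp (- z_j) or exp z_j, where z_j = l_j + i t_j. One step of the recursion therefore contributes
  the mean of the cosh z_j, which is the symbol. Induction on \<open>k\<close> for each fixed
  \<open>l\<close> replaces a shift of the contour; the base case is orthogonality of
  characters.\<close>

lemma srw_fourier_tilt:
  fixes x l :: "_ ^ 'd"
  shows "complex_of_real ((2 * pi) ^ CARD('d) * (srw k x * exp (l \<bullet> rvec x))) =
    (\<integral>t. indicator torus t *\<^sub>R (tilt_symbol l t ^ k * cis (- (t \<bullet> rvec x))) \<partial>lborel)"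
proof (induction k arbitrary: x)
  case 0
  have cis_prod: "cis (- (t \<bullet> rvec x)) = (\<Prod>j\<in>UNIV. cis (- (of_int (x $ j) * t $ j)))" for t
  proof -
    have "(\<Prod>j\<in>UNIV. cis (- (of_int (x $ j) * t $ j))) = exp (\<Sum>j\<in>UNIV. \<i> * complex_of_real (- (of_int (x $ j) * t $ j)))"
      by (simp add: cis_conv_exp exp_sum)
    also have "(\<Sum>j\<in>UNIV. \<i> * complex_of_real (- (of_int (x $ j) * t $ j))) = \<i> * complex_of_real (- (t \<bullet> rvec x))"
      by (simp add: inner_vec_def sum_distrib_left sum_negf mult_ac)
    finally show ?thesis by (simp add: cis_conv_exp)
  qed
  have "(\<integral>t. indicator torus t *\<^sub>R cis (- (t \<bullet> rvec x)) \<partial>lborel) =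
      (\<integral>t. (\<Prod>j\<in>UNIV. indicator {-pi..pi} (t $ j) * cis (- (of_int (x $ j) * t $ j))) \<partial>lborel)"
  proof (rule Bochner_Integration.integral_cong)
    fix t :: "real^'d"
    have "indicator torus t *\<^sub>R cis (- (t \<bullet> rvec x)) = indicator torus t * cis (- (t \<bullet> rvec x))"
      by (simp add: indicator_def)
    also have "\<dots> = (\<Prod>j\<in>UNIV. indicator {-pi..pi} (t $ j) * cis (- (of_int (x $ j) * t $ j)))"
      by (simp add: indicator_torus cis_prod prod.distrib)
    finally show "indicator torus t *\<^sub>R cis (- (t \<bullet> rvec x)) =
      (\<Prod>j\<in>UNIV. indicator {-pi..pi} (t $ j) * cis (- (of_int (x $ j) * t $ j)))" .
  qed simp
  also have "\<dots> = (\<Prod>j\<in>UNIV. if x $ j = 0 then complex_of_real (2 * pi) else 0)"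
    by (subst lborel_vec_prod(2)) (auto intro!: prod.cong simp: integral_cis_period)
  also have "\<dots> = (if x = 0 then complex_of_real ((2 * pi) ^ CARD('d)) else 0)"
  proof (cases "x = 0")
    case False
    then obtain j where "x $ j \<noteq> 0" by (auto simp: vec_eq_iff)
    then show ?thesis using False by (auto intro!: prod_zero)
  qed simp
  finally show ?case by (auto simp: inner_vec_def)
next
  case (Suc k)
  let ?d = "complex_of_real (real CARD('d))"
  let ?I = "\<lambda>x. \<integral>t. indicator torus t *\<^sub>R (tilt_symbol l t ^ k * cis (- (t \<bullet> rvec x))) \<partial>lborel"
  have int: "integrable lborel (\<lambda>t. indicator torus t *\<^sub>R (tilt_symbol l t ^ k * cis (- (t \<bullet> rvec x))))" for x
    by (intro torus_integrable continuous_intros)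
  have rp: "rvec (x + axis j 1) = rvec x + axis j 1" "rvec (x - axis j 1) = rvec x - axis j 1" for j
    by (auto simp: vec_eq_iff axis_def)
  have lp: "l \<bullet> rvec x = l \<bullet> rvec (x + axis j 1) - l $ j" "l \<bullet> rvec x = l \<bullet> rvec (x - axis j 1) + l $ j" for j
    unfolding rp by (simp_all add: inner_add_right inner_diff_right inner_axis)
  have tp: "t \<bullet> rvec (x + axis j 1) = t \<bullet> rvec x + t $ j" "t \<bullet> rvec (x - axis j 1) = t \<bullet> rvec x - t $ j" for t j
    unfolding rp by (simp_all add: inner_add_right inner_diff_right inner_axis)
  have "complex_of_real ((2 * pi) ^ CARD('d) * (srw (Suc k) x * exp (l \<bullet> rvec x))) =
     (\<Sum>j\<in>UNIV. complex_of_real ((2 * pi) ^ CARD('d) * (srw k (x + axis j 1) * exp (l \<bullet> rvec x)))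
              + complex_of_real ((2 * pi) ^ CARD('d) * (srw k (x - axis j 1) * exp (l \<bullet> rvec x)))) / (2 * ?d)"
    by (simp add: sum_distrib_left sum_distrib_right sum_divide_distrib distrib_left distrib_right
        add_divide_distrib sum.distrib)
  also have "\<dots> = (\<Sum>j\<in>UNIV. complex_of_real (exp (- l $ j)) * ?I (x + axis j 1)
                        + complex_of_real (exp (l $ j)) * ?I (x - axis j 1)) / (2 * ?d)"
  proof -
    have "complex_of_real ((2 * pi) ^ CARD('d) * (srw k (x + axis j 1) * exp (l \<bullet> rvec x))) =
        complex_of_real (exp (- l $ j)) * ?I (x + axis j 1)" for j
      unfolding Suc[symmetric] by (subst lp(1)[of j]) (simp add: exp_diff exp_minus field_simps)
    moreover have "complex_of_real ((2 * pi) ^ CARD('d) * (srw k (x - axis j 1) * exp (l \<bullet> rvec x))) =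
        complex_of_real (exp (l $ j)) * ?I (x - axis j 1)" for j
      unfolding Suc[symmetric] by (subst lp(2)[of j]) (simp add: exp_add field_simps)
    ultimately show ?thesis by simp
  qed
  also have "\<dots> = (\<integral>t. (\<Sum>j\<in>UNIV. complex_of_real (exp (- l $ j)) *
        (indicator torus t *\<^sub>R (tilt_symbol l t ^ k * cis (- (t \<bullet> rvec (x + axis j 1)))))
     + complex_of_real (exp (l $ j)) *
        (indicator torus t *\<^sub>R (tilt_symbol l t ^ k * cis (- (t \<bullet> rvec (x - axis j 1)))))) / (2 * ?d) \<partial>lborel)"
  proof -
    have "(\<Sum>j\<in>UNIV. u j * integral\<^sup>L lborel (f j) + v j * integral\<^sup>L lborel (g j)) / (2 * ?d) =
        (\<integral>t. (\<Sum>j\<in>UNIV. u j * f j t + v j * g j t) / (2 * ?d) \<partial>lborel)"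
      if "\<And>j. integrable lborel (f j)" "\<And>j. integrable lborel (g j)"
      for u v :: "'d \<Rightarrow> complex" and f g :: "'d \<Rightarrow> real^'d \<Rightarrow> complex"
      using that by simp
    from this[OF int int] show ?thesis .
  qed
  also have "\<dots> = (\<integral>t. indicator torus t *\<^sub>R (tilt_symbol l t ^ Suc k * cis (- (t \<bullet> rvec x))) \<partial>lborel)"
  proof (rule Bochner_Integration.integral_cong)
    fix t :: "real^'d"
    let ?z = "\<lambda>j. Complex (l $ j) (t $ j)"
    have c1: "complex_of_real (exp (- l $ j)) * cis (- (t \<bullet> rvec (x + axis j 1))) =
       exp (- ?z j) * cis (- (t \<bullet> rvec x))" for j
      unfolding tp(1) by (simp add: Complex_eq cis_conv_exp exp_of_real[symmetric] exp_diff exp_minus exp_add field_simps)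
    have c2: "complex_of_real (exp (l $ j)) * cis (- (t \<bullet> rvec (x - axis j 1))) =
       exp (?z j) * cis (- (t \<bullet> rvec x))" for j
      unfolding tp(2) by (simp add: Complex_eq cis_conv_exp exp_of_real[symmetric] exp_diff exp_minus exp_add field_simps)
    let ?P = "indicator torus t *\<^sub>R (tilt_symbol l t ^ k)"
    have "(\<Sum>j\<in>UNIV. complex_of_real (exp (- l $ j)) *
        (indicator torus t *\<^sub>R (tilt_symbol l t ^ k * cis (- (t \<bullet> rvec (x + axis j 1)))))
     + complex_of_real (exp (l $ j)) *
        (indicator torus t *\<^sub>R (tilt_symbol l t ^ k * cis (- (t \<bullet> rvec (x - axis j 1)))))) / (2 * ?d) =
      (\<Sum>j\<in>UNIV. ?P * (complex_of_real (exp (- l $ j)) * cis (- (t \<bullet> rvec (x + axis j 1))))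
            + ?P * (complex_of_real (exp (l $ j)) * cis (- (t \<bullet> rvec (x - axis j 1))))) / (2 * ?d)"
      by (simp only: scaleR_conv_of_real mult_ac)
    also have "\<dots> = (\<Sum>j\<in>UNIV. ?P * cis (- (t \<bullet> rvec x)) * (2 * cosh (?z j))) / (2 * ?d)"
      unfolding c1 c2 by (simp add: cosh_def scaleR_conv_of_real algebra_simps)
    also have "\<dots> = ?P * cis (- (t \<bullet> rvec x)) * tilt_symbol l t"
      by (simp add: tilt_symbol_def sum_distrib_left[symmetric])
    finally show "(\<Sum>j\<in>UNIV. complex_of_real (exp (- l $ j)) *
        (indicator torus t *\<^sub>R (tilt_symbol l t ^ k * cis (- (t \<bullet> rvec (x + axis j 1)))))
     + complex_of_real (exp (l $ j)) *
        (indicator torus t *\<^sub>R (tilt_symbol l t ^ k * cis (- (t \<bullet> rvec (x - axis j 1)))))) / (2 * ?d) =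
       indicator torus t *\<^sub>R (tilt_symbol l t ^ Suc k * cis (- (t \<bullet> rvec x)))"
      by (simp add: mult_ac scaleR_conv_of_real)
  qed simp
  finally show ?case .
qed

lemma cosh_Complex: "cosh (Complex a b) = Complex (cosh a * cos b) (sinh a * sin b)"
proof -
  have e: "exp (Complex a b) = Complex (exp a * cos b) (exp a * sin b)"
    "exp (- Complex a b) = Complex (exp (- a) * cos b) (- (exp (- a) * sin b))"
    by (simp_all add: complex_eq_iff Re_exp Im_exp)
  show ?thesis
    unfolding cosh_def[of "Complex a b"] e
    by (simp add: complex_eq_iff cosh_def sinh_def algebra_simps)
qed

lemma cmod_cosh_Complex: "(cmod (cosh (Complex a b)))\<^sup>2 = (sinh a)\<^sup>2 + (cos b)\<^sup>2"
proof -
  have "(cmod (cosh (Complex a b)))\<^sup>2 = (cosh a)\<^sup>2 * (cos b)\<^sup>2 + (sinh a)\<^sup>2 * (sin b)\<^sup>2"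
    by (simp add: cosh_Complex cmod_power2 power_mult_distrib)
  also have "\<dots> = (sinh a)\<^sup>2 + (cos b)\<^sup>2"
    by (simp add: cosh_square_eq sin_squared_eq algebra_simps)
  finally show ?thesis .
qed

abbreviation sin_sq :: "real ^ 'd \<Rightarrow> real" where
  "sin_sq t \<equiv> (\<Sum>j\<in>UNIV. (sin (t $ j))\<^sup>2)"

abbreviation sinh_sq :: "real ^ 'd \<Rightarrow> real" where
  "sinh_sq l \<equiv> (\<Sum>j\<in>UNIV. (sinh (l $ j))\<^sup>2)"

text \<open>By Cauchy-Schwarz the squared modulus is at most the mean of sinh^2 l_j + 1 - sin^2 t_j,
  and 1 + y <= exp y does the rest. The bound uses \<open>sin\<close> and not t^2 because for l = 0
  the modulus returns to 1 at the corners of the torus.\<close>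

lemma cmod_tilt_symbol_le:
  fixes l t :: "real ^ 'd"
  shows "cmod (tilt_symbol l t) \<le>
    exp ((sinh_sq l - sin_sq t) / (2 * real CARD('d)))"
proof -
  let ?d = "real CARD('d)"
  let ?c = "\<lambda>j. cmod (cosh (Complex (l $ j) (t $ j)))"
  have "cmod (tilt_symbol l t) \<le> (\<Sum>j\<in>UNIV. ?c j) / ?d"
    unfolding tilt_symbol_def by (simp add: norm_divide divide_right_mono norm_sum)
  then have "(cmod (tilt_symbol l t))\<^sup>2 \<le> ((\<Sum>j\<in>UNIV. ?c j) / ?d)\<^sup>2"
    by (intro power_mono) auto
  also have "\<dots> \<le> (\<Sum>j\<in>UNIV. (?c j)\<^sup>2) / ?d"
    using sum_squared_le_sum_of_squares[of ?c "UNIV::'d set"]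
    by (simp add: power_divide power2_eq_square[of ?d] field_simps)
  also have "(\<Sum>j\<in>UNIV. (?c j)\<^sup>2) = sinh_sq l + (\<Sum>j\<in>UNIV. 1 - (sin (t $ j))\<^sup>2)"
    by (simp add: cmod_cosh_Complex cos_squared_eq sum.distrib)
  also have "\<dots> / ?d = 1 + (sinh_sq l - sin_sq t) / ?d"
    by (simp add: sum_subtractf field_simps)
  also have "\<dots> \<le> exp ((sinh_sq l - sin_sq t) / ?d)"
    by (rule exp_ge_add_one_self)
  also have "\<dots> = (exp ((sinh_sq l - sin_sq t) / (2 * ?d)))\<^sup>2"
    by (simp add: power2_eq_square flip: exp_add)
  finally show ?thesis by (rule power2_le_imp_le) simp
qed

section \<open>Coefficients of the discrete subordinator\<close>

text \<open>
  The coefficients of \<open>(1 - (1 - z)\<^sup>b)\<^sup>n\<close>; for \<open>b = \<alpha> / 2\<close> these are the probabilities \<open>P(\<tau>\<^sub>n = k)\<close>.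
\<close>

definition sub_coeff :: "real \<Rightarrow> nat \<Rightarrow> nat \<Rightarrow> real" where
  "sub_coeff b n k = (\<Sum>j\<le>n. of_nat (n choose j) * (-1) ^ j * ((-1) ^ k * ((b * real j) gchoose k)))"

lemma sub_coeff_sums:
  fixes z :: real
  assumes "\<bar>z\<bar> < 1"
  shows "(\<lambda>k. sub_coeff b n k * z ^ k) sums (1 - (1 - z) powr b) ^ n"
proof -
  have *: "(\<lambda>k. (-1) ^ k * ((b * real j) gchoose k) * z ^ k) sums (1 - z) powr (b * real j)" for j
    using gen_binomial_real[of "-z" "b * real j"] assms
    by (simp add: power_minus[of z] mult_ac)
  have "(\<lambda>k. \<Sum>j\<le>n. of_nat (n choose j) * (-1) ^ j * ((-1) ^ k * ((b * real j) gchoose k) * z ^ k))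
     sums (\<Sum>j\<le>n. of_nat (n choose j) * (-1) ^ j * (1 - z) powr (b * real j))"
    by (intro sums_sum sums_mult *)
  also have "(\<Sum>j\<le>n. of_nat (n choose j) * (-1) ^ j * (1 - z) powr (b * real j)) =
    (\<Sum>j\<le>n. of_nat (n choose j) * (- ((1 - z) powr b)) ^ j * 1 ^ (n - j))"
    using assms by (intro sum.cong)
      (auto simp: powr_powr[symmetric] powr_realpow power_minus[of "(1 - z) powr b"])
  also have "\<dots> = (1 - (1 - z) powr b) ^ n"
    by (subst binomial_ring[symmetric]) simp
  finally show ?thesis
    by (simp add: sub_coeff_def sum_distrib_right mult.assoc)
qed

text \<open>Zeros of a nonzero power series are isolated. Equality is assumed only on (0, 1) because
  that is where z = exp (- u) with u > 0 lives, i.e. what a Laplace transform provides.\<close>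

lemma powser_eq_on_right_nbhd:
  fixes a c :: "nat \<Rightarrow> real"
  assumes a: "\<And>z. \<bar>z\<bar> < 1 \<Longrightarrow> summable (\<lambda>k. a k * z ^ k)"
    and c: "\<And>z. \<bar>z\<bar> < 1 \<Longrightarrow> summable (\<lambda>k. c k * z ^ k)"
    and eq: "\<And>z. 0 < z \<Longrightarrow> z < 1 \<Longrightarrow> (\<Sum>k. a k * z ^ k) = (\<Sum>k. c k * z ^ k)"
  shows "a = c"
proof -
  define f where "f z = (\<Sum>k. a k * z ^ k) - (\<Sum>k. c k * z ^ k)" for z
  have s: "(\<lambda>k. (a k - c k) * (z - 0) ^ k) sums f z" if "norm (z - 0) < 1" for z
    using sums_diff[OF summable_sums[OF a, of z] summable_sums[OF c, of z]] that
    by (simp add: f_def algebra_simps)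
  have f0: "f z = 0" if "0 < z" "z < 1" for z
    using eq[OF that] by (simp add: f_def)
  \<comment> \<open>\<open>powser_0_nonzero\<close> asks for a function that vanishes at the centre
    and for a nonzero coefficient of positive index, so the constant terms are compared beforehand,
    by a limit from the right.\<close>
  have "(f \<longlongrightarrow> a 0 - c 0) (at 0)"
    using s by (intro powser_limit_0[of 1 "\<lambda>k. a k - c k"]) auto
  then have "(f \<longlongrightarrow> a 0 - c 0) (at_right 0)"
    by (rule filterlim_mono) (auto simp: at_le)
  moreover have "eventually (\<lambda>z. f z = 0) (at_right (0::real))"
    using f0 by (auto intro!: eventually_at_rightI[of 0 1])
  ultimately have "((\<lambda>z. 0) \<longlongrightarrow> a 0 - c 0) (at_right (0::real))"
    by (subst (asm) tendsto_cong) auto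
  then have ac0: "a 0 = c 0"
    using tendsto_unique[OF _ _ tendsto_const, of "at_right (0::real)"]
    by (metis eq_iff_diff_eq_0 trivial_limit_at_right_real)
  then have "f 0 = 0" by (simp add: f_def)
  show "a = c"
  proof (rule ccontr)
    assume "a \<noteq> c"
    then obtain m where m: "a m \<noteq> c m" by auto
    with ac0 have "m > 0" by (cases m) auto
    obtain e where e: "e > 0" "\<And>z. z \<in> cball 0 e - {0} \<Longrightarrow> f z \<noteq> 0"
    proof (rule powser_0_nonzero[of 1 0 "\<lambda>k. a k - c k" f m])
      show "(\<lambda>n. (a n - c n) * (x - 0) ^ n) sums f x" if "norm (x - 0) < 1" for x
        using that by (rule s)
    qed (use m \<open>m > 0\<close> \<open>f 0 = 0\<close> in auto)
    have "f (min e (1/2)) \<noteq> 0" by (rule e) (use \<open>e > 0\<close> in \<open>auto simp: min_def\<close>)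
    moreover have "f (min e (1/2)) = 0" using \<open>e > 0\<close> by (intro f0) auto
    ultimately show False by simp
  qed
qed

lemma sub_coeff_0 [simp]: "n > 0 \<Longrightarrow> sub_coeff b n 0 = 0"
  using binomial_ring[of "- 1 :: real" 1 n] by (simp add: sub_coeff_def power_0_left)

text \<open>Log-convexity on the segment from 1 to 1 + j, with Gamma 1 = 1. Monotonicity would not
  do, since Gamma decreases to the right of 1.\<close>

lemma Gamma_real_le_fact:
  assumes "0 \<le> a" "a \<le> real j"
  shows "Gamma (1 + a) \<le> fact j"
proof -
  have cvx: "convex_on {0<..} (\<lambda>x. ln (Gamma x :: real))"
    using log_convex_Gamma_real by (simp add: o_def)
  show ?thesis
  proof (cases "j = 0")
    case False
    then have j: "real j > 0" by simp
    have "ln (Gamma ((1 - a / j) *\<^sub>R 1 + (a / j) *\<^sub>R (1 + real j))) \<le>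
        (1 - a / j) * ln (Gamma 1) + (a / j) * ln (Gamma (1 + real j))"
      using assms j by (intro convex_onD[OF cvx]) (auto simp: field_simps)
    also have "(1 - a / j) *\<^sub>R 1 + (a / j) *\<^sub>R (1 + real j) = 1 + a"
      using j by (simp add: field_simps)
    also have "Gamma (1 + real j) = fact j" by (simp add: Gamma_fact)
    also have "(1 - a / j) * ln (Gamma 1) + (a / j) * ln (fact j) \<le> 1 * ln (fact j :: real)"
      using assms j by (simp only: Gamma_1 ln_one mult_zero_right add_0)
        (intro mult_right_mono, auto simp: field_simps)
    finally show ?thesis
      using assms by (simp add: Gamma_real_pos)
  qed (use assms in auto)
qed

text \<open>Log-convexity at the points x - 1 < x < x + s, where x has weight 1 / (1 + s) towards
  the right end, combined with Gamma x = (x - 1) Gamma (x - 1).\<close>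

lemma Gamma_shift_ge:
  fixes x s :: real
  assumes "x > 1" "s \<ge> 0"
  shows "Gamma x * (x - 1) powr s \<le> Gamma (x + s)"
proof (cases "s = 0")
  case False
  then have s: "s > 0" using assms by simp
  have cvx: "convex_on {0<..} (\<lambda>x. ln (Gamma x :: real))"
    using log_convex_Gamma_real by (simp add: o_def)
  have "ln (Gamma ((1 - 1 / (1 + s)) *\<^sub>R (x - 1) + (1 / (1 + s)) *\<^sub>R (x + s))) \<le>
        (1 - 1 / (1 + s)) * ln (Gamma (x - 1)) + (1 / (1 + s)) * ln (Gamma (x + s))"
    using assms s by (intro convex_onD[OF cvx]) auto
  also have "(1 - 1 / (1 + s)) *\<^sub>R (x - 1) + (1 / (1 + s)) *\<^sub>R (x + s) = x"
  proof -
    have "(1 - 1 / (1 + s)) * (x - 1) + (1 / (1 + s)) * (x + s) = ((1 + s) * x) / (1 + s)"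
      using s by (simp add: divide_simps) (simp add: algebra_simps)
    then show ?thesis using s by simp
  qed
  also have "(1 - 1 / (1 + s)) * ln (Gamma (x - 1)) + (1 / (1 + s)) * ln (Gamma (x + s)) =
      (s * ln (Gamma (x - 1)) + ln (Gamma (x + s))) / (1 + s)"
    using s by (simp add: divide_simps)
  finally have "(1 + s) * ln (Gamma x) \<le> s * ln (Gamma (x - 1)) + ln (Gamma (x + s))"
    using s by (simp add: pos_le_divide_eq mult.commute)
  moreover have "Gamma x = (x - 1) * Gamma (x - 1)"
    using Gamma_plus1[of "x - 1"] nonpos_Ints_nonpos[of "x - 1"] assms by auto
  then have "ln (Gamma x) = ln (x - 1) + ln (Gamma (x - 1))"
  proof -
    have "Gamma (x - 1) > 0" using assms by (intro Gamma_real_pos) simp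
    then show ?thesis unfolding \<open>Gamma x = _\<close> using assms by (intro ln_mult_pos) auto
  qed
  ultimately have "ln (Gamma x) + s * ln (x - 1) \<le> ln (Gamma (x + s))"
    by (simp add: algebra_simps)
  then have "ln (Gamma x * (x - 1) powr s) \<le> ln (Gamma (x + s))"
  proof -
    have "ln (Gamma x * (x - 1) powr s) = ln (Gamma x) + ln ((x - 1) powr s)"
      using assms by (intro ln_mult_pos Gamma_real_pos) auto
    then show ?thesis using \<open>ln (Gamma x) + s * ln (x - 1) \<le> _\<close> assms by (simp add: ln_powr)
  qed
  then show ?thesis
    using assms s by (subst (asm) ln_le_cancel_iff) (auto intro!: mult_pos_pos Gamma_real_pos)
qed (use assms in auto)

lemma rGamma_reflection_real: "rGamma x * rGamma (1 - x) = sin (pi * x) / pi" for x :: real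
proof -
  have "complex_of_real (rGamma x * rGamma (1 - x)) =
      rGamma (complex_of_real x) * rGamma (1 - complex_of_real x)"
    by (simp flip: rGamma_complex_of_real)
  also have "\<dots> = sin (complex_of_real (pi * x)) / complex_of_real pi"
    by (simp add: rGamma_reflection_complex)
  also have "\<dots> = complex_of_real (sin (pi * x) / pi)"
    by (simp only: sin_of_real of_real_divide)
  finally show ?thesis by (simp only: of_real_eq_iff)
qed

text \<open>The quotient formula for the binomial coefficient contains Gamma (a - k + 1), whose
  argument may be negative; reflection trades it for Gamma (k - a) and a sine. Working with
  \<open>rGamma\<close> covers integral \<open>a\<close> as well, where Gamma has a pole and the
  coefficient is 0.\<close>

lemma abs_gbinomial_le:
  fixes a :: real
  assumes "0 \<le> a" "a < real k"
  shows "\<bar>a gchoose k\<bar> \<le> Gamma (1 + a) * Gamma (real k - a) / fact k"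
proof -
  have "(a gchoose k) = Gamma (a + 1) / (fact k * Gamma (a - real k + 1))"
    using assms by (intro gbinomial_Gamma) (auto elim!: nonpos_Ints_cases)
  also have "\<dots> = Gamma (1 + a) / fact k * rGamma (a - real k + 1)"
    by (simp add: rGamma_inverse_Gamma field_simps add.commute)
  also have "rGamma (a - real k + 1) =
      sin (pi * (real k - a)) / pi * Gamma (real k - a)"
  proof -
    have "Gamma (real k - a) > 0" using assms by (intro Gamma_real_pos) simp
    then show ?thesis
      using rGamma_reflection_real[of "real k - a"]
      by (simp add: rGamma_inverse_Gamma[of "real k - a"] divide_simps mult.commute algebra_simps)
  qed
  finally have "\<bar>a gchoose k\<bar> = Gamma (1 + a) * Gamma (real k - a) / fact k * (\<bar>sin (pi * (real k - a))\<bar> / pi)"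
    using assms by (simp add: abs_mult Gamma_real_pos abs_of_pos)
  also have "\<dots> \<le> Gamma (1 + a) * Gamma (real k - a) / fact k * 1"
    using assms pi_gt3 by (intro mult_left_mono)
      (auto intro!: divide_nonneg_pos mult_nonneg_nonneg less_imp_le[OF Gamma_real_pos]
         order_trans[OF abs_sin_le_one] simp: divide_le_eq)
  finally show ?thesis by simp
qed

text \<open>\<open>Gamma_shift_ge\<close> with x = k - a and s = 1 + a compares Gamma (k - a) with
  k!. The 4 arises from k - a - 1 >= k / 2 - 1 >= k / 4, which is what the last two hypotheses
  give.\<close>

lemma abs_gbinomial_le_powr:
  fixes a :: real
  assumes "0 \<le> a" "2 * a \<le> real k" "4 \<le> k"
  shows "\<bar>a gchoose k\<bar> \<le> Gamma (1 + a) * (4 / real k) powr (1 + a)"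
proof -
  have k: "real k \<ge> 4" using assms(3) by simp
  have "\<bar>a gchoose k\<bar> \<le> Gamma (1 + a) * Gamma (real k - a) / fact k"
    using assms k by (intro abs_gbinomial_le) auto
  also have "\<dots> = Gamma (1 + a) * (Gamma (real k - a) / fact k)" by simp
  also have "\<dots> \<le> Gamma (1 + a) * (4 / real k) powr (1 + a)"
  proof (rule mult_left_mono)
    have "Gamma (real k - a) * (real k / 4) powr (1 + a) \<le>
        Gamma (real k - a) * (real k - a - 1) powr (1 + a)"
      using assms k by (intro mult_left_mono powr_mono2) (auto intro!: less_imp_le[OF Gamma_real_pos])
    also have "\<dots> \<le> Gamma (real k - a + (1 + a))"
      using assms k by (intro Gamma_shift_ge) auto
    also have "\<dots> = fact k" by (simp add: Gamma_fact add.commute)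
    finally have "Gamma (real k - a) * (real k / 4) powr (1 + a) \<le> fact k" .
    moreover have "(4 / real k) powr (1 + a) * (real k / 4) powr (1 + a) = 1"
      using k by (simp flip: powr_mult)
    moreover have "(real k / 4) powr (1 + a) > 0" using k by simp
    ultimately show "Gamma (real k - a) / fact k \<le> (4 / real k) powr (1 + a)"
    proof -
      have "Gamma (real k - a) = Gamma (real k - a) * (real k / 4) powr (1 + a) * (4 / real k) powr (1 + a)"
        using \<open>(4 / real k) powr (1 + a) * (real k / 4) powr (1 + a) = 1\<close> by (simp add: mult_ac)
      also have "\<dots> \<le> fact k * (4 / real k) powr (1 + a)"
        using \<open>Gamma (real k - a) * (real k / 4) powr (1 + a) \<le> fact k\<close> by (intro mult_right_mono) auto
      finally show ?thesis by (simp add: divide_le_eq mult.commute)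
    qed
  qed (use assms in \<open>auto intro!: less_imp_le[OF Gamma_real_pos]\<close>)
  finally show ?thesis .
qed

text \<open>
  The \<open>j\<close>-th summand of \<open>sub_coeff b n k\<close> is at most \<open>n\<^sup>j / j! \<cdot> \<Gamma>(1 + b j) (4 / k)\<^bsup>1 + b j\<^esup>\<close>.
  Since \<open>\<Gamma>(1 + b j) \<le> j!\<close>, the alternating sum is dominated by a geometric series in
  \<open>n (4 / k)\<^sup>b\<close>, and the term \<open>j = 1\<close> is the leading one (the term \<open>j = 0\<close> vanishes).
\<close>

lemma sub_coeff_approx:
  assumes b: "0 < b" "b < 1" and n: "n \<ge> 1" and k: "k \<ge> 1"
    and W: "real n * (4 / real k) powr b \<le> 1 / 2"
  shows "\<bar>sub_coeff b n k - real n * ((-1) ^ (k + 1) * (b gchoose k))\<bar>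
    \<le> 8 / real k * (real n * (4 / real k) powr b)\<^sup>2"
proof -
  define w where "w = (4 / real k) powr b"
  have w0: "w > 0" using k by (simp add: w_def)
  \<comment> \<open>The smallness hypothesis forces k >= 4 and 2 n <= k. These are the conditions of
    \<open>abs_gbinomial_le_powr\<close> for all a = b j with j <= n at once.\<close>
  have kb: "2 * real n * 4 powr b \<le> real k powr b"
    using W k by (simp add: powr_divide field_simps)
  have "1 \<le> real n" using n by simp
  have "(1::real) \<le> 4 powr b" using b by (simp add: ge_one_powr_ge_zero)
  have kk: "real k powr b \<le> real k"
    using powr_mono[of b 1 "real k"] b k by simp
  have "1 * (2 * 4 powr b) \<le> real n * (2 * 4 powr b)"
    using \<open>1 \<le> real n\<close> by (intro mult_right_mono) auto
  then have "2 * 4 powr b \<le> real k powr b"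
    using kb by (simp only: mult_ac mult_1_left)
  then have "4 powr b \<le> real k powr b" using \<open>1 \<le> 4 powr b\<close> by linarith
  then have k4: "4 \<le> k"
    using powr_less_mono2[of b "real k" 4] b by (cases "k < 4") auto
  have n2: "2 * real n \<le> real k"
    using kb kk mult_left_mono[OF \<open>1 \<le> 4 powr b\<close>, of "2 * real n"] by simp
  have term_le: "\<bar>of_nat (n choose j) * (-1) ^ j * ((-1) ^ k * ((b * real j) gchoose k))\<bar>
      \<le> 4 / real k * (real n * w) ^ j" if "j \<le> n" for j
  proof -
    have bj: "b * real j \<le> real j" using b by (simp add: mult_left_le_one_le)
    have "\<bar>(b * real j) gchoose k\<bar> \<le> Gamma (1 + b * real j) * (4 / real k) powr (1 + b * real j)"
      using b k4 n2 bj that by (intro abs_gbinomial_le_powr) auto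
    also have "\<dots> \<le> fact j * (4 / real k) powr (1 + b * real j)"
      using b bj by (intro mult_right_mono Gamma_real_le_fact) auto
    also have "(4 / real k) powr (1 + b * real j) = 4 / real k * w ^ j"
      using k by (simp add: powr_add w_def powr_powr[symmetric] powr_realpow)
    finally have 1: "\<bar>(b * real j) gchoose k\<bar> \<le> fact j * (4 / real k * w ^ j)" .
    have "real (n choose j) * fact j \<le> real n ^ j"
      using binomial_fact_pow[of n j] by (metis of_nat_fact of_nat_le_iff of_nat_mult of_nat_power)
    then have "real (n choose j) * (fact j * (4 / real k * w ^ j)) \<le> real n ^ j * (4 / real k * w ^ j)"
      using w0 by (subst mult.assoc[symmetric], intro mult_right_mono) auto
    moreover have "real (n choose j) * \<bar>(b * real j) gchoose k\<bar> \<le>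
        real (n choose j) * (fact j * (4 / real k * w ^ j))"
      using 1 by (intro mult_left_mono) auto
    ultimately show ?thesis
      by (simp add: abs_mult power_mult_distrib mult_ac)
  qed
  let ?t = "\<lambda>j. of_nat (n choose j) * (-1) ^ j * ((-1) ^ k * ((b * real j) gchoose k))"
  have "sub_coeff b n k = (\<Sum>j\<in>{0,1} \<union> {2..n}. ?t j)"
    unfolding sub_coeff_def using n by (intro sum.cong) auto
  also have "\<dots> = ?t 0 + ?t 1 + (\<Sum>j\<in>{2..n}. ?t j)"
    by (subst sum.union_disjoint) auto
  also have "?t 0 = 0" using k by (cases k) auto
  also have "?t 1 = real n * ((-1) ^ (k + 1) * (b gchoose k))" by simp
  finally have "\<bar>sub_coeff b n k - real n * ((-1) ^ (k + 1) * (b gchoose k))\<bar> = \<bar>\<Sum>j\<in>{2..n}. ?t j\<bar>"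
    by simp
  also have "\<dots> \<le> (\<Sum>j\<in>{2..n}. 4 / real k * (real n * w) ^ j)"
    by (rule order_trans[OF sum_abs]) (intro sum_mono term_le, auto)
  also have "\<dots> \<le> (\<Sum>j\<in>{2..<2+n}. 4 / real k * (real n * w) ^ j)"
    using w0 by (intro sum_mono2) auto
  also have "\<dots> = (\<Sum>i<n. 4 / real k * (real n * w) ^ (i + 2))"
    using sum.shift_bounds_nat_ivl[of "\<lambda>j. 4 / real k * (real n * w) ^ j" 0 2 n]
    by (simp only: atLeast0LessThan add_0 add.commute[of n])
  also have "\<dots> \<le> (\<Sum>i<n. 4 / real k * (real n * w)\<^sup>2 * (1/2) ^ i)"
  proof (rule sum_mono)
    fix i
    have "(real n * w) ^ i \<le> (1/2) ^ i"
      using W w0 by (intro power_mono) (auto simp: w_def)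
    then have "4 / real k * (real n * w)\<^sup>2 * (real n * w) ^ i \<le> 4 / real k * (real n * w)\<^sup>2 * (1/2) ^ i"
      using k by (intro mult_left_mono) auto
    then show "4 / real k * (real n * w) ^ (i + 2) \<le> 4 / real k * (real n * w)\<^sup>2 * (1/2) ^ i"
      by (simp only: power_add mult_ac)
  qed
  also have "\<dots> = 4 / real k * (real n * w)\<^sup>2 * (\<Sum>i<n. (1/2) ^ i)"
    by (simp add: sum_distrib_left)
  also have "\<dots> \<le> 4 / real k * (real n * w)\<^sup>2 * 2"
    using k by (intro mult_left_mono) (auto simp: sum_gp_strict)
  finally show ?thesis by (simp add: w_def)
qed

text \<open>For k >= 1 the sequence (-1)^(k+1) (b gchoose k) is the law of \<tau>_1, so this is its
  power tail. The sign comes out positive because - 1 / Gamma (- b) = b / Gamma (1 - b).\<close>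

lemma gbinomial_tail_limit:
  assumes b: "0 < b" "b < 1"
  shows "(\<lambda>k. (-1) ^ (k + 1) * (b gchoose k) * real k powr (1 + b)) \<longlonglongrightarrow> b / Gamma (1 - b)"
proof -
  have "(\<lambda>k. - ((b gchoose k) / ((-1) ^ k / exp ((b + 1) * of_real (ln (real k))))))
      \<longlonglongrightarrow> - inverse (Gamma (- b))"
    by (intro tendsto_minus gbinomial_asymptotic)
  also have "- inverse (Gamma (- b)) = b / Gamma (1 - b)"
  proof -
    have "-b \<notin> \<int>\<^sub>\<le>\<^sub>0"
    proof
      assume "-b \<in> \<int>\<^sub>\<le>\<^sub>0"
      then obtain m :: int where "- b = of_int m" by (auto elim!: nonpos_Ints_cases)
      then have "-1 < m" "m < 0" using b by linarith+
      then show False by simp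
    qed
    then have "Gamma (1 - b) = - b * Gamma (- b)"
      using Gamma_plus1[of "-b"] by auto
    then show ?thesis using b by (simp add: field_simps)
  qed
  finally show ?thesis
  proof (rule Lim_transform_eventually)
    show "\<forall>\<^sub>F k in sequentially. - ((b gchoose k) / ((-1) ^ k / exp ((b + 1) * of_real (ln (real k))))) =
        (-1) ^ (k + 1) * (b gchoose k) * real k powr (1 + b)"
      using eventually_gt_at_top[of 0]
    proof eventually_elim
      case (elim k)
      have "((-1::real) ^ k) * (-1) ^ k = 1" by (simp flip: power_mult_distrib)
      then have "1 / (-1::real) ^ k = (-1) ^ k" by (simp add: field_simps)
      then show ?case using elim by (simp add: powr_def add.commute divide_simps mult_ac)
    qed
  qed
qed

section \<open>Heat kernel bounds\<close>

lemma gaussian_integral: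
  fixes c \<mu> :: real
  assumes "c > 0"
  shows "integrable lborel (\<lambda>s. exp (- c * (s - \<mu>)\<^sup>2))"
    and "(\<integral>s. exp (- c * (s - \<mu>)\<^sup>2) \<partial>lborel) = sqrt (pi / c)"
proof -
  have eq: "exp (- c * (s - \<mu>)\<^sup>2) = sqrt (pi / c) * normal_density \<mu> (1 / sqrt (2 * c)) s" for s
    using assms by (simp add: normal_density_def power_divide real_sqrt_divide real_sqrt_mult field_simps)
  show "integrable lborel (\<lambda>s. exp (- c * (s - \<mu>)\<^sup>2))"
    unfolding eq using assms by (intro integrable_mult_right integrable_normal_density) auto
  show "(\<integral>s. exp (- c * (s - \<mu>)\<^sup>2) \<partial>lborel) = sqrt (pi / c)"
    unfolding eq using assms by simp
qed

lemma gaussian_fourier: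
  fixes c y :: real
  assumes "c > 0"
  shows "integrable lborel (\<lambda>s. complex_of_real (exp (- (s\<^sup>2) / (2 * c))) * cis (y * s))"
    and "(\<integral>s. complex_of_real (exp (- (s\<^sup>2) / (2 * c))) * cis (y * s) \<partial>lborel) =
      complex_of_real (sqrt (2 * pi * c) * exp (- c * y\<^sup>2 / 2))"
proof -
  have i: "integrable lborel (\<lambda>s. exp (- (s\<^sup>2) / (2 * c)))"
    using gaussian_integral(1)[of "1 / (2 * c)" 0] assms by simp
  show "integrable lborel (\<lambda>s. complex_of_real (exp (- (s\<^sup>2) / (2 * c))) * cis (y * s))"
    using assms by (intro Bochner_Integration.integrable_bound[OF i])
       (auto simp: norm_mult intro!: borel_measurable_continuous_onI continuous_intros)
  have "(\<integral>s. complex_of_real (exp (- (s\<^sup>2) / (2 * c))) * cis (y * s) \<partial>lborel) =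
     sqrt c *\<^sub>R (\<integral>u. complex_of_real (exp (- ((sqrt c *\<^sub>R u)\<^sup>2) / (2 * c))) * cis (y * (sqrt c *\<^sub>R u)) \<partial>lborel)"
    using assms by (subst lborel_integral_scale(2)[of "sqrt c"]) auto
  also have "(\<integral>u. complex_of_real (exp (- ((sqrt c *\<^sub>R u)\<^sup>2) / (2 * c))) * cis (y * (sqrt c *\<^sub>R u)) \<partial>lborel) =
     (\<integral>u. complex_of_real (sqrt (2 * pi)) * (complex_of_real (std_normal_density u) * cis ((y * sqrt c) * u)) \<partial>lborel)"
    using assms by (intro Bochner_Integration.integral_cong)
      (auto simp: std_normal_density_def power_mult_distrib mult_ac exp_of_real[symmetric])
  also have "\<dots> = complex_of_real (sqrt (2 * pi)) * (\<integral>u. complex_of_real (std_normal_density u) * cis ((y * sqrt c) * u) \<partial>lborel)"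
    by (rule integral_mult_right_zero)
  also have "(\<integral>u. complex_of_real (std_normal_density u) * cis ((y * sqrt c) * u) \<partial>lborel) =
     char std_normal_distribution (y * sqrt c)"
    unfolding char_def
    by (subst integral_density) (auto simp: cis_conv_exp scaleR_conv_of_real)
  also have "\<dots> = complex_of_real (exp (- c * y\<^sup>2 / 2))"
    using assms by (simp add: char_std_normal_distribution power_mult_distrib mult_ac)
  finally show "(\<integral>s. complex_of_real (exp (- (s\<^sup>2) / (2 * c))) * cis (y * s) \<partial>lborel) =
      complex_of_real (sqrt (2 * pi * c) * exp (- c * y\<^sup>2 / 2))"
    using assms by (simp add: scaleR_conv_of_real real_sqrt_mult mult_ac)
qed

lemma norm_sq_vec: "(norm (t :: real ^ 'd))\<^sup>2 = (\<Sum>j\<in>UNIV. (t $ j)\<^sup>2)"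
  unfolding power2_norm_eq_inner inner_vec_def by (simp add: power2_eq_square)

lemma gaussian_vec_integrable:
  assumes "c > 0"
  shows "integrable lborel (\<lambda>t :: real ^ 'd. exp (- c * (norm t)\<^sup>2))"
proof -
  have "exp (- c * (norm t)\<^sup>2) = (\<Prod>j\<in>UNIV. exp (- c * (t $ j - 0)\<^sup>2))" for t :: "real ^ 'd"
    by (simp add: norm_sq_vec sum_distrib_left exp_sum sum_negf[symmetric])
  then show ?thesis
    by (simp only:) (intro lborel_vec_prod gaussian_integral assms)
qed

lemma gaussian_vec_cos:
  fixes y :: "real ^ 'd"
  assumes "c > 0"
  shows "(\<integral>t. exp (- (norm t)\<^sup>2 / (2 * c)) * cos (t \<bullet> y) \<partial>lborel) =
    sqrt (2 * pi * c) ^ CARD('d) * exp (- c * (norm y)\<^sup>2 / 2)"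
proof -
  let ?f = "\<lambda>j s. complex_of_real (exp (- (s\<^sup>2) / (2 * c))) * cis (y $ j * s)"
  have eq: "complex_of_real (exp (- (norm t)\<^sup>2 / (2 * c))) * cis (t \<bullet> y) = (\<Prod>j\<in>UNIV. ?f j (t $ j))" for t
  proof -
    have "(\<Prod>j\<in>UNIV. ?f j (t $ j)) =
        (\<Prod>j\<in>UNIV. exp (complex_of_real (- ((t $ j)\<^sup>2) / (2 * c)) + \<i> * complex_of_real (y $ j * t $ j)))"
      by (simp only: exp_add cis_conv_exp exp_of_real)
    also have "\<dots> = exp (\<Sum>j\<in>UNIV. complex_of_real (- ((t $ j)\<^sup>2) / (2 * c)) + \<i> * complex_of_real (y $ j * t $ j))"
      by (simp only: exp_sum finite)
    also have "(\<Sum>j\<in>UNIV. complex_of_real (- ((t $ j)\<^sup>2) / (2 * c)) + \<i> * complex_of_real (y $ j * t $ j)) =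
        complex_of_real (- (norm t)\<^sup>2 / (2 * c)) + \<i> * complex_of_real (t \<bullet> y)"
      by (simp add: sum.distrib norm_sq_vec inner_vec_def sum_distrib_left sum_negf sum_subtractf sum_divide_distrib mult_ac)
    finally show ?thesis by (simp only: exp_add cis_conv_exp exp_of_real)
  qed
  have int: "integrable lborel (\<lambda>t. complex_of_real (exp (- (norm t)\<^sup>2 / (2 * c))) * cis (t \<bullet> y))"
    unfolding eq by (intro lborel_vec_prod gaussian_fourier assms)
  have "(\<integral>t. complex_of_real (exp (- (norm t)\<^sup>2 / (2 * c))) * cis (t \<bullet> y) \<partial>lborel) =
     (\<Prod>j\<in>UNIV. complex_of_real (sqrt (2 * pi * c) * exp (- c * (y $ j)\<^sup>2 / 2)))"
    unfolding eq using gaussian_fourier[OF assms] by (subst lborel_vec_prod(2)) auto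
  also have "\<dots> = complex_of_real (sqrt (2 * pi * c) ^ CARD('d) * exp (- c * (norm y)\<^sup>2 / 2))"
    by (simp add: prod.distrib norm_sq_vec sum_distrib_left sum_divide_distrib flip: of_real_prod)
       (simp add: exp_sum sum_negf[symmetric])
  finally have "Re (\<integral>t. complex_of_real (exp (- (norm t)\<^sup>2 / (2 * c))) * cis (t \<bullet> y) \<partial>lborel) =
     sqrt (2 * pi * c) ^ CARD('d) * exp (- c * (norm y)\<^sup>2 / 2)" by simp
  then show ?thesis
    by (subst (asm) integral_Re[OF int, symmetric]) simp
qed

text \<open>On [-pi, pi] the sine vanishes at -pi, 0 and pi, and Jordan's inequality applies around
  the nearest of these zeros. Summing over all three centres gives one majorant for the whole
  interval.\<close>

lemma sin_exp_le:
  fixes c s :: real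
  assumes "c > 0" "\<bar>s\<bar> \<le> pi"
  shows "exp (- c * (sin s)\<^sup>2) \<le> (\<Sum>\<mu>\<in>{-pi, 0, pi}. exp (- (4 * c / pi\<^sup>2) * (s - \<mu>)\<^sup>2))"
proof -
  have *: "exp (- c * (sin s)\<^sup>2) \<le> exp (- (4 * c / pi\<^sup>2) * (s - \<mu>)\<^sup>2)"
    if "\<bar>s - \<mu>\<bar> \<le> pi / 2" "\<bar>sin s\<bar> = sin \<bar>s - \<mu>\<bar>" for \<mu>
  proof -
    have "(2 / pi * \<bar>s - \<mu>\<bar>)\<^sup>2 \<le> (sin \<bar>s - \<mu>\<bar>)\<^sup>2"
      using that by (intro power_mono jordan_inequality) auto
    also have "\<dots> = (sin s)\<^sup>2" using that(2) by (metis power2_abs)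
    finally have "c * (2 / pi * \<bar>s - \<mu>\<bar>)\<^sup>2 \<le> c * (sin s)\<^sup>2"
      using assms by (intro mult_left_mono) auto
    then show ?thesis by (simp add: power_mult_distrib power_divide field_simps)
  qed
  have "\<exists>\<mu>\<in>{-pi,0,pi}. \<bar>s - \<mu>\<bar> \<le> pi / 2 \<and> \<bar>sin s\<bar> = sin \<bar>s - \<mu>\<bar>"
  proof -
    consider "s < - (pi/2)" | "\<bar>s\<bar> \<le> pi / 2" "s \<ge> 0" | "\<bar>s\<bar> \<le> pi / 2" "s < 0" | "s > pi / 2"
      by linarith
    then show ?thesis
    proof cases
      case 1
      have s: "0 \<le> s + pi" "s + pi \<le> pi" using assms 1 pi_gt_zero by linarith+
      then have "\<bar>s - - pi\<bar> = s + pi" "sin (s + pi) \<ge> 0" using sin_ge_zero[OF s] by auto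
      then show ?thesis using 1 assms by (intro bexI[of _ "-pi"]) auto
    next
      case 2
      then have "sin s \<ge> 0" by (intro sin_ge_zero) auto
      then show ?thesis using 2 by (intro bexI[of _ 0]) auto
    next
      case 3
      then have "sin (- s) \<ge> 0" by (intro sin_ge_zero) auto
      then show ?thesis using 3 by (intro bexI[of _ 0]) auto
    next
      case 4
      have s: "0 \<le> s" "s \<le> pi" using assms 4 pi_gt_zero by linarith+
      then have "\<bar>s - pi\<bar> = pi - s" "sin s \<ge> 0" by (auto intro: sin_ge_zero)
      then show ?thesis using 4 assms by (intro bexI[of _ pi]) auto
    qed
  qed
  then obtain \<mu> where \<mu>: "\<mu> \<in> {-pi,0,pi}" "\<bar>s - \<mu>\<bar> \<le> pi / 2" "\<bar>sin s\<bar> = sin \<bar>s - \<mu>\<bar>" by blast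
  have "exp (- c * (sin s)\<^sup>2) \<le> exp (- (4 * c / pi\<^sup>2) * (s - \<mu>)\<^sup>2)" using * \<mu> by blast
  also have "\<dots> \<le> (\<Sum>\<mu>\<in>{-pi, 0, pi}. exp (- (4 * c / pi\<^sup>2) * (s - \<mu>)\<^sup>2))"
    using \<mu>(1) by (intro member_le_sum) auto
  finally show ?thesis .
qed

text \<open>The integrand factorises over the coordinates. Each factor is bounded by three Gaussians
  of integral sqrt (pi / (4 c / pi^2)) = pi sqrt pi / (2 sqrt c), whence the constant.\<close>

lemma torus_sin_integral_le:
  assumes "c > 0"
  shows "integrable lborel (\<lambda>t :: real ^ 'd. indicator torus t * exp (- c * sin_sq t))"
    and "(\<integral>t. indicator torus t * exp (- c * sin_sq t) \<partial>(lborel :: (real ^ 'd) measure))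
      \<le> (3 * pi * sqrt pi / 2 / sqrt c) ^ CARD('d)"
proof -
  let ?f = "\<lambda>s. indicator {-pi..pi} s * exp (- c * (sin s)\<^sup>2)"
  have eq: "indicator torus t * exp (- c * sin_sq t) = (\<Prod>j\<in>UNIV. ?f (t $ j))" for t :: "real ^ 'd"
    by (simp add: indicator_torus prod.distrib exp_sum sum_distrib_left sum_negf[symmetric])
  have i: "integrable lborel ?f"
  proof -
    have "integrable lborel (\<lambda>s. indicator {-pi..pi} s *\<^sub>R exp (- c * (sin s)\<^sup>2))"
      by (intro borel_integrable_compact continuous_intros) auto
    then show ?thesis by simp
  qed
  show "integrable lborel (\<lambda>t :: real ^ 'd. indicator torus t * exp (- c * sin_sq t))"
    unfolding eq by (intro lborel_vec_prod i)
  have c': "4 * c / pi\<^sup>2 > 0" using assms by simp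
  have "(\<integral>s. ?f s \<partial>lborel) \<le> (\<integral>s. (\<Sum>\<mu>\<in>{-pi, 0, pi}. exp (- (4 * c / pi\<^sup>2) * (s - \<mu>)\<^sup>2)) \<partial>lborel)"
  proof (rule integral_mono[OF i])
    show "integrable lborel (\<lambda>s. \<Sum>\<mu>\<in>{-pi, 0, pi}. exp (- (4 * c / pi\<^sup>2) * (s - \<mu>)\<^sup>2))"
      by (intro Bochner_Integration.integrable_sum gaussian_integral c')
    show "?f s \<le> (\<Sum>\<mu>\<in>{-pi, 0, pi}. exp (- (4 * c / pi\<^sup>2) * (s - \<mu>)\<^sup>2))" for s
    proof (cases "s \<in> {-pi..pi}")
      case True
      then have "\<bar>s\<bar> \<le> pi" by auto
      then show ?thesis using True sin_exp_le[OF assms, of s] by simp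
    qed (auto intro!: sum_nonneg)
  qed
  also have "\<dots> = (\<Sum>\<mu>\<in>{-pi, 0, pi}. sqrt (pi / (4 * c / pi\<^sup>2)))"
    by (subst Bochner_Integration.integral_sum)
       (use gaussian_integral[OF c'] in auto)
  also have "\<dots> = 3 * sqrt (pi / (4 * c / pi\<^sup>2))"
    by (simp add: pi_neq_zero)
  also have "sqrt (pi / (4 * c / pi\<^sup>2)) = pi * sqrt pi / 2 / sqrt c"
    using assms by (simp add: real_sqrt_divide real_sqrt_mult)
  finally have "(\<integral>s. ?f s \<partial>lborel) \<le> 3 * pi * sqrt pi / 2 / sqrt c" by simp
  then have "(\<integral>s. ?f s \<partial>lborel) ^ CARD('d) \<le> (3 * pi * sqrt pi / 2 / sqrt c) ^ CARD('d)"
    by (intro power_mono integral_nonneg) auto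
  then show "(\<integral>t. indicator torus t * exp (- c * sin_sq t) \<partial>(lborel :: (real ^ 'd) measure))
      \<le> (3 * pi * sqrt pi / 2 / sqrt c) ^ CARD('d)"
    unfolding eq by (subst lborel_vec_prod(2)[OF i]) simp
qed

text \<open>Moduli are taken inside the tilted Fourier integral. The \<open>sinh\<close> part of the
  symbol bound leaves the integral as the price of the tilt, and the \<open>sin\<close> part is
  integrated over the torus. The choice l = 0 yields the uniform bound of order k^(-d/2), other
  \<open>l\<close> yield spatial decay.\<close>

lemma srw_tilt_le:
  fixes x :: "int ^ 'd"
  assumes k: "k \<ge> 1"
  shows "(2 * pi) ^ CARD('d) * (srw k x * exp (l \<bullet> rvec x)) \<le>
    exp (real k * sinh_sq l / (2 * real CARD('d))) *
    (3 * pi * sqrt pi / 2 / sqrt (real k / (2 * real CARD('d)))) ^ CARD('d)"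
proof -
  let ?d = "real CARD('d)"
  let ?E = "exp (real k * sinh_sq l / (2 * ?d))"
  let ?c = "real k / (2 * ?d)"
  have c: "?c > 0" using k by simp
  let ?g = "\<lambda>t::real^'d. indicator torus t * exp (- ?c * sin_sq t)"
  have "(2 * pi) ^ CARD('d) * (srw k x * exp (l \<bullet> rvec x)) =
      cmod (complex_of_real ((2 * pi) ^ CARD('d) * (srw k x * exp (l \<bullet> rvec x))))"
    by (simp only: norm_of_real) (simp add: srw_nonneg)
  also have "\<dots> \<le> (\<integral>t. ?E * ?g t \<partial>lborel)"
    unfolding srw_fourier_tilt
  proof (rule order_trans[OF integral_norm_bound integral_mono])
    show "integrable lborel (\<lambda>t. cmod (indicator torus t *\<^sub>R (tilt_symbol l t ^ k * cis (- (t \<bullet> rvec x)))))"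
      by (intro integrable_norm torus_integrable continuous_intros)
    show "integrable lborel (\<lambda>t. ?E * ?g t)"
      by (intro integrable_mult_right torus_sin_integral_le c)
    fix t :: "real ^ 'd"
    have "cmod (tilt_symbol l t ^ k) \<le>
       exp ((sinh_sq l - sin_sq t) / (2 * ?d)) ^ k"
      unfolding norm_power by (intro power_mono cmod_tilt_symbol_le) auto
    also have "\<dots> = exp (real k * ((sinh_sq l - sin_sq t) / (2 * ?d)))"
      by (rule exp_of_nat_mult[symmetric])
    also have "real k * ((sinh_sq l - sin_sq t) / (2 * ?d)) =
        real k * sinh_sq l / (2 * ?d) + - ?c * sin_sq t"
      by (simp add: right_diff_distrib diff_divide_distrib)
    also have "exp \<dots> = ?E * exp (- ?c * sin_sq t)"
      by (rule exp_add)
    finally show "cmod (indicator torus t *\<^sub>R (tilt_symbol l t ^ k * cis (- (t \<bullet> rvec x)))) \<le> ?E * ?g t"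
      by (auto simp: norm_mult indicator_def)
  qed
  also have "\<dots> \<le> ?E * (3 * pi * sqrt pi / 2 / sqrt ?c) ^ CARD('d)"
    using torus_sin_integral_le(2)[OF c, where 'd = 'd] by simp
  finally show ?thesis .
qed

lemma power_over_fact_le_exp:
  fixes y :: real
  assumes "y \<ge> 0"
  shows "y ^ n / fact n \<le> exp y"
proof -
  have "(\<Sum>i\<in>{n}. inverse (fact i) * y ^ i) \<le> (\<Sum>i. inverse (fact i) * y ^ i)"
    using assms summable_exp[of y] by (intro sum_le_suminf) auto
  then show ?thesis by (simp add: exp_def scaleR_conv_of_real field_simps)
qed

lemma sinh_le_2: "\<lbrakk>0 \<le> t; t \<le> 1\<rbrakk> \<Longrightarrow> sinh t \<le> 2 * t" for t :: real
proof -
  assume t: "0 \<le> t" "t \<le> 1"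
  have "exp t \<le> 1 + t + t\<^sup>2" using t by (rule exp_bound)
  moreover have "exp (- t) \<ge> 1 + (- t)" by (rule exp_ge_add_one_self)
  moreover have "t\<^sup>2 \<le> t" using t by (simp add: power2_eq_square mult_left_le)
  ultimately show ?thesis using t by (simp add: sinh_def)
qed

text \<open>A tilt of size 1 / sqrt k along the signs of \<open>x\<close> costs a bounded factor and
  gains exp (|x|_1 / sqrt k) >= exp (|x| / sqrt k). The inequality y^(2m) / (2m)! <= exp y turns
  this into a bound by powers of k and |x|, the form in which it can be rescaled.\<close>

lemma srw_bounds:
  obtains C :: real where "C > 0"
    "\<And>k x. k \<ge> 1 \<Longrightarrow> srw k (x :: int ^ 'd) \<le> C * real k powr (- (real CARD('d) / 2))"
    "\<And>k x. k \<ge> 1 \<Longrightarrow> srw k (x :: int ^ 'd) * lattice_norm x ^ (2 * m) \<le>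
        C * real k powr (real m - real CARD('d) / 2)"
proof -
  let ?d = "real CARD('d)"
  define A where "A = (3 * pi * sqrt pi / 2 * sqrt (2 * ?d)) ^ CARD('d)"
  have A: "A > 0" by (simp add: A_def)
  have Ak: "(3 * pi * sqrt pi / 2 / sqrt (real k / (2 * ?d))) ^ CARD('d) = A * real k powr (- (?d / 2))"
    if "k \<ge> 1" for k
  proof -
    have "real k powr (- (?d / 2)) = (real k powr (1/2)) powr (- ?d)"
      by (simp add: powr_powr)
    also have "\<dots> = 1 / sqrt (real k) ^ CARD('d)"
    proof -
      have "(real k powr (1/2)) powr ?d = sqrt (real k) ^ CARD('d)"
        using that by (simp only: powr_half_sqrt of_nat_0_le_iff) (simp add: powr_realpow)
      then show ?thesis by (simp add: powr_minus_divide)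
    qed
    finally show ?thesis using that
      by (simp add: A_def real_sqrt_divide power_divide power_mult_distrib)
  qed
  have twopi: "(1::real) \<le> (2 * pi) ^ CARD('d)" using pi_gt3 by (intro one_le_power) auto
  have drop: "u \<le> v" if "(2 * pi) ^ CARD('d) * u \<le> v" "u \<ge> 0" for u v :: real
    using mult_right_mono[OF twopi \<open>u \<ge> 0\<close>] that by simp
  define C where "C = A * exp 2 * fact (2 * m)"
  have C: "C > 0" using A by (simp add: C_def)
  have b1: "srw k (x :: int ^ 'd) \<le> A * real k powr (- (?d / 2))" if "k \<ge> 1" for k x
  proof (rule drop)
    show "(2 * pi) ^ CARD('d) * srw k x \<le> A * real k powr (- (?d / 2))"
      using srw_tilt_le[OF that, of x 0] Ak[OF that] by simp
  qed (rule srw_nonneg)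
  have b2: "srw k (x :: int ^ 'd) * exp (lattice_norm x / sqrt (real k)) \<le> A * exp 2 * real k powr (- (?d / 2))"
    if k: "k \<ge> 1" for k x
  proof -
    \<comment> \<open>Since 1 / sqrt k <= 1, \<open>sinh_le_2\<close> gives sinh^2 l_j <= 4 / k, and
      the exponent k \<open>sinh_sq l\<close> / (2 d) in \<open>srw_tilt_le\<close> is at most
      2.\<close>
    define l :: "real ^ 'd" where "l = (\<chi> j. sgn (real_of_int (x $ j)) / sqrt (real k))"
    have sk: "sqrt (real k) \<ge> 1" using k by simp
    have "lattice_norm x \<le> (\<Sum>j\<in>UNIV. \<bar>real_of_int (x $ j)\<bar>)"
      unfolding lattice_norm_def using norm_le_l1_cart[of "rvec x"] by simp
    then have "lattice_norm x / sqrt (real k) \<le> (\<Sum>j\<in>UNIV. \<bar>real_of_int (x $ j)\<bar>) / sqrt (real k)"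
      using k by (intro divide_right_mono) auto
    also have "\<dots> = l \<bullet> rvec x"
      by (simp add: l_def inner_vec_def sum_divide_distrib abs_sgn mult.commute)
    finally have lx: "lattice_norm x / sqrt (real k) \<le> l \<bullet> rvec x" .
    have "(sinh (l $ j))\<^sup>2 \<le> 4 / real k" for j
    proof -
      have le: "\<bar>l $ j\<bar> \<le> 1 / sqrt (real k)"
        using k by (auto simp: l_def abs_mult sgn_if)
      have "\<bar>sinh (l $ j)\<bar> = sinh \<bar>l $ j\<bar>" by (simp add: abs_if)
      also have "\<dots> \<le> sinh (1 / sqrt (real k))" using le by (simp only: sinh_real_le_iff)
      also have "\<dots> \<le> 2 * (1 / sqrt (real k))" using sk by (intro sinh_le_2) auto
      finally have "\<bar>sinh (l $ j)\<bar>\<^sup>2 \<le> (2 * (1 / sqrt (real k)))\<^sup>2" by (intro power_mono) auto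
      then show ?thesis using k by (simp add: power_divide)
    qed
    then have "sinh_sq l \<le> (\<Sum>j\<in>(UNIV::'d set). 4 / real k)"
      by (intro sum_mono) auto
    then have "real k * sinh_sq l / (2 * ?d) \<le> real k * (?d * (4 / real k)) / (2 * ?d)"
      by (intro divide_right_mono mult_left_mono) auto
    also have "\<dots> = 2" using k by simp
    finally have "exp (real k * sinh_sq l / (2 * ?d)) * (A * real k powr (- (?d / 2)))
        \<le> exp 2 * (A * real k powr (- (?d / 2)))"
      using A by (intro mult_right_mono) auto
    then have "(2 * pi) ^ CARD('d) * (srw k x * exp (l \<bullet> rvec x)) \<le> A * exp 2 * real k powr (- (?d / 2))"
      using srw_tilt_le[OF k, of x l] Ak[OF k] by (simp add: mult_ac)
    then have "srw k x * exp (l \<bullet> rvec x) \<le> A * exp 2 * real k powr (- (?d / 2))"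
      by (rule drop) (simp add: srw_nonneg)
    moreover have "srw k x * exp (lattice_norm x / sqrt (real k)) \<le> srw k x * exp (l \<bullet> rvec x)"
      using lx by (intro mult_left_mono srw_nonneg) auto
    ultimately show ?thesis by linarith
  qed
  show ?thesis
  proof (rule that[OF C])
    fix k :: nat and x :: "int ^ 'd" assume k: "k \<ge> 1"
    have "A * 1 \<le> C" unfolding C_def mult.assoc using A
      by (intro mult_left_mono) (auto intro!: mult_ge1_I simp: fact_ge_1)
    then have "A * real k powr (- (?d / 2)) \<le> C * real k powr (- (?d / 2))"
      by (intro mult_right_mono) auto
    then show "srw k x \<le> C * real k powr (- (?d / 2))" using b1[OF k, of x] by linarith
    have "lattice_norm x \<ge> 0" by (simp add: lattice_norm_def)
    then have "(lattice_norm x / sqrt (real k)) ^ (2 * m) \<le> fact (2 * m) * exp (lattice_norm x / sqrt (real k))"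
      using power_over_fact_le_exp[of "lattice_norm x / sqrt (real k)" "2 * m"]
      by (simp only: pos_divide_le_eq[OF fact_gt_zero] mult.commute) simp
    then have "srw k x * (lattice_norm x / sqrt (real k)) ^ (2 * m) \<le>
        srw k x * (fact (2 * m) * exp (lattice_norm x / sqrt (real k)))"
      by (intro mult_left_mono srw_nonneg)
    also have "\<dots> \<le> fact (2 * m) * (A * exp 2 * real k powr (- (?d / 2)))"
      using mult_left_mono[OF b2[OF k, of x], of "fact (2 * m)"] by (simp add: mult_ac)
    finally have "srw k x * (lattice_norm x / sqrt (real k)) ^ (2 * m) \<le> C * real k powr (- (?d / 2))"
      by (simp add: C_def mult_ac)
    moreover have "(lattice_norm x / sqrt (real k)) ^ (2 * m) = lattice_norm x ^ (2 * m) / real k ^ m"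
      using k by (simp add: power_divide power_mult)
    ultimately have "srw k x * lattice_norm x ^ (2 * m) / real k ^ m \<le> C * real k powr (- (?d / 2))"
      by simp
    then have "srw k x * lattice_norm x ^ (2 * m) \<le> C * real k powr (- (?d / 2)) * real k ^ m"
      using k by (simp add: divide_le_eq)
    also have "\<dots> = C * real k powr (real m - ?d / 2)"
      using k by (simp add: powr_realpow[symmetric] powr_add[symmetric] mult.assoc)
    finally show "srw k x * lattice_norm x ^ (2 * m) \<le> C * real k powr (real m - ?d / 2)" .
  qed
qed

section \<open>The symbol of the walk near the origin\<close>

definition walk_symbol :: "real ^ 'd \<Rightarrow> real" where
  "walk_symbol t = (\<Sum>j\<in>UNIV. cos (t $ j)) / real CARD('d)"

lemma continuous_on_walk_symbol [continuous_intros]: "continuous_on A walk_symbol"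
  unfolding walk_symbol_def by (intro continuous_intros) auto

lemma borel_measurable_walk_symbol [measurable]: "walk_symbol \<in> borel_measurable borel"
  by (intro borel_measurable_continuous_onI continuous_intros)

lemma tilt_symbol_0: "tilt_symbol 0 t = complex_of_real (walk_symbol t)"
proof -
  have "cosh (Complex 0 s) = complex_of_real (cos s)" for s
    by (simp add: cosh_Complex complex_eq_iff)
  then show ?thesis by (simp add: tilt_symbol_def walk_symbol_def)
qed

lemma srw_fourier:
  fixes x :: "int ^ 'd"
  shows "integrable lborel (\<lambda>t. indicator torus t * (walk_symbol t ^ k * cos (t \<bullet> rvec x)))"
    and "(2 * pi) ^ CARD('d) * srw k x =
      (\<integral>t. indicator torus t * (walk_symbol t ^ k * cos (t \<bullet> rvec x)) \<partial>lborel)"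
proof -
  show "integrable lborel (\<lambda>t. indicator torus t * (walk_symbol t ^ k * cos (t \<bullet> rvec x)))"
    using torus_integrable[of "\<lambda>t. walk_symbol t ^ k * cos (t \<bullet> rvec x)"]
    by (simp add: continuous_intros)
  have int: "integrable lborel (\<lambda>t. indicator torus t *\<^sub>R (tilt_symbol 0 t ^ k * cis (- (t \<bullet> rvec x))))"
    by (intro torus_integrable continuous_intros)
  have "(2 * pi) ^ CARD('d) * srw k x = Re (complex_of_real ((2 * pi) ^ CARD('d) * (srw k x * exp (0 \<bullet> rvec x))))"
    by (simp only: Re_complex_of_real) simp
  also have "\<dots> = (\<integral>t. Re (indicator torus t *\<^sub>R (tilt_symbol 0 t ^ k * cis (- (t \<bullet> rvec x)))) \<partial>lborel)"
    unfolding srw_fourier_tilt using int by (rule integral_Re[symmetric])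
  also have "\<dots> = (\<integral>t. indicator torus t * (walk_symbol t ^ k * cos (t \<bullet> rvec x)) \<partial>lborel)"
    by (simp add: tilt_symbol_0 flip: of_real_power)
  finally show "(2 * pi) ^ CARD('d) * srw k x =
      (\<integral>t. indicator torus t * (walk_symbol t ^ k * cos (t \<bullet> rvec x)) \<partial>lborel)" .
qed

lemma one_minus_walk_symbol:
  fixes t :: "real ^ 'd"
  shows "1 - walk_symbol t = (\<Sum>j\<in>UNIV. 1 - cos (t $ j)) / real CARD('d)"
  by (simp add: walk_symbol_def sum_subtractf field_simps)

lemma walk_symbol_le_1: "walk_symbol t \<le> 1"
  using one_minus_walk_symbol[of t] by (smt (verit) cos_le_one divide_nonneg_nonneg of_nat_0_le_iff sum_nonneg)

lemma walk_symbol_ge_m1: "- 1 \<le> walk_symbol (t :: real ^ 'd)"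
proof -
  have "(\<Sum>j\<in>(UNIV::'d set). - 1) \<le> (\<Sum>j\<in>UNIV. cos (t $ j))" by (intro sum_mono) simp
  then show ?thesis by (simp add: walk_symbol_def le_divide_eq)
qed

lemma one_minus_walk_symbol_ge:
  fixes t :: "real ^ 'd"
  assumes "t \<in> torus"
  shows "2 / (pi\<^sup>2 * real CARD('d)) * (norm t)\<^sup>2 \<le> 1 - walk_symbol t"
proof -
  have "(\<Sum>j\<in>UNIV. 2 / pi\<^sup>2 * (t $ j)\<^sup>2) \<le> (\<Sum>j\<in>UNIV. 1 - cos (t $ j))"
    using assms by (intro sum_mono one_minus_cos_ge) (auto simp: torus_def)
  then have "(\<Sum>j\<in>UNIV. 2 / pi\<^sup>2 * (t $ j)\<^sup>2) / real CARD('d) \<le> 1 - walk_symbol t"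
    unfolding one_minus_walk_symbol by (intro divide_right_mono) auto
  also have "(\<Sum>j\<in>UNIV. 2 / pi\<^sup>2 * (t $ j)\<^sup>2) = 2 / pi\<^sup>2 * (norm t)\<^sup>2"
    by (simp only: norm_sq_vec sum_distrib_left)
  finally show ?thesis by simp
qed

lemma abs_walk_symbol_power_le:
  fixes t :: "real ^ 'd"
  shows "\<bar>walk_symbol t\<bar> ^ k \<le> exp (- (real k / (2 * real CARD('d))) * sin_sq t)"
proof -
  have "\<bar>walk_symbol t\<bar> ^ k \<le> exp (- sin_sq t / (2 * real CARD('d))) ^ k"
    using cmod_tilt_symbol_le[of 0 t] by (intro power_mono) (simp_all add: tilt_symbol_0)
  then show ?thesis by (simp add: exp_of_nat_mult[symmetric])
qed

text \<open>Because 1 - cos (r s) = 2 sin^2 (r s / 2), only the first derivative of the sine at 0 is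
  involved. The resulting |t|^2 / (2 d) reflects that a step has variance 1 / d in each
  coordinate.\<close>

lemma walk_symbol_quadratic_limit:
  fixes t :: "real ^ 'd"
  assumes r: "(r \<longlongrightarrow> 0) F" "eventually (\<lambda>i. r i \<noteq> 0) F"
  shows "((\<lambda>i. (1 - walk_symbol (r i *\<^sub>R t)) / (r i)\<^sup>2) \<longlongrightarrow> (norm t)\<^sup>2 / (2 * real CARD('d))) F"
proof -
  have lim: "((\<lambda>i. (1 - cos (r i * s)) / (r i)\<^sup>2) \<longlongrightarrow> s\<^sup>2 / 2) F" for s :: real
  proof -
    have "((\<lambda>u. sin (u * (s / 2))) has_field_derivative cos (0 * (s / 2)) * (s / 2)) (at 0)"
      by (auto intro!: derivative_eq_intros)
    then have "(\<lambda>u. sin (u * (s / 2)) / u) \<midarrow>0\<rightarrow> s / 2"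
      by (simp add: has_field_derivative_iff)
    moreover have "filterlim r (at 0) F" using r by (simp add: filterlim_at)
    ultimately have "((\<lambda>i. sin (r i * (s / 2)) / r i) \<longlongrightarrow> s / 2) F"
      by (rule filterlim_compose)
    then have "((\<lambda>i. 2 * (sin (r i * (s / 2)) / r i)\<^sup>2) \<longlongrightarrow> 2 * (s / 2)\<^sup>2) F"
      by (intro tendsto_mult tendsto_const tendsto_power)
    also have "(\<lambda>i. 2 * (sin (r i * (s / 2)) / r i)\<^sup>2) = (\<lambda>i. (1 - cos (r i * s)) / (r i)\<^sup>2)"
    proof
      fix i
      have "cos (r i * s) = 1 - 2 * (sin (r i * (s / 2)))\<^sup>2"
        using cos_double_sin[of "r i * (s / 2)"] by simp
      then show "2 * (sin (r i * (s / 2)) / r i)\<^sup>2 = (1 - cos (r i * s)) / (r i)\<^sup>2"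
        by (simp add: power_divide)
    qed
    finally show ?thesis by (simp add: power_divide)
  qed
  have "((\<lambda>i. (\<Sum>j\<in>UNIV. (1 - cos (r i * t $ j)) / (r i)\<^sup>2) / real CARD('d)) \<longlongrightarrow>
      (\<Sum>j\<in>UNIV. (t $ j)\<^sup>2 / 2) / real CARD('d)) F"
    by (intro tendsto_intros lim) auto
  then show ?thesis
    by (simp add: one_minus_walk_symbol norm_sq_vec sum_divide_distrib[symmetric] mult_ac)
qed

text \<open>Taking logarithms leaves N ln (1 - u / N) + u, of size at most 2 N (u / N)^2 = 2 u (u /
  N). The numerator \<open>u\<close> varies with the index because it will be the rescaled symbol,
  or its b-th power, which merely converges.\<close>

lemma one_minus_power_limit:
  fixes u :: "'k \<Rightarrow> real" and N :: "'k \<Rightarrow> nat"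
  assumes u: "(u \<longlongrightarrow> a) F" and N: "filterlim N at_top F"
  shows "((\<lambda>i. (1 - u i / real (N i)) ^ N i) \<longlongrightarrow> exp (- a)) F"
proof -
  have N': "filterlim (\<lambda>i. real (N i)) at_top F"
    by (rule filterlim_compose[OF filterlim_real_sequentially N])
  have z: "((\<lambda>i. u i / real (N i)) \<longlongrightarrow> 0) F"
    using u N' by (rule tendsto_divide_0[OF _ filterlim_at_top_imp_at_infinity])
  have "((\<lambda>i. real (N i) * ln (1 - u i / real (N i)) + u i) \<longlongrightarrow> 0) F"
  proof (rule Lim_null_comparison)
    have "((\<lambda>i. 2 * u i * (u i / real (N i))) \<longlongrightarrow> 2 * a * 0) F"
      by (intro tendsto_intros u z)
    then show "((\<lambda>i. 2 * u i * (u i / real (N i))) \<longlongrightarrow> 0) F" by simp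
    have "eventually (\<lambda>i. \<bar>u i / real (N i)\<bar> < 1 / 2) F"
      using tendstoD[OF z, of "1/2"] by simp
    moreover have "eventually (\<lambda>i. N i > 0) F"
      by (rule eventually_compose_filterlim[OF eventually_gt_at_top N])
    ultimately show "eventually (\<lambda>i. norm (real (N i) * ln (1 - u i / real (N i)) + u i) \<le> 2 * u i * (u i / real (N i))) F"
    proof eventually_elim
      case (elim i)
      let ?z = "- (u i / real (N i))"
      have "\<bar>ln (1 + ?z) - ?z\<bar> \<le> 2 * ?z\<^sup>2"
        using elim by (intro abs_ln_one_plus_x_minus_x_bound) simp
      then have "real (N i) * \<bar>ln (1 + ?z) - ?z\<bar> \<le> real (N i) * (2 * ?z\<^sup>2)"
        by (intro mult_left_mono) auto
      also have "\<dots> = 2 * u i * (u i / real (N i))"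
        using elim by (simp add: power2_eq_square)
      also have "real (N i) * \<bar>ln (1 + ?z) - ?z\<bar> = \<bar>real (N i) * (ln (1 + ?z) - ?z)\<bar>"
        by (simp add: abs_mult)
      also have "real (N i) * (ln (1 + ?z) - ?z) = real (N i) * ln (1 - u i / real (N i)) + u i"
        using elim by (simp add: algebra_simps)
      finally show ?case by simp
    qed
  qed
  then have "((\<lambda>i. (real (N i) * ln (1 - u i / real (N i)) + u i) - u i) \<longlongrightarrow> 0 - a) F"
    by (intro tendsto_diff u)
  then have "((\<lambda>i. exp (real (N i) * ln (1 - u i / real (N i)))) \<longlongrightarrow> exp (- a)) F"
    by (intro tendsto_exp) simp
  moreover have "eventually (\<lambda>i. exp (real (N i) * ln (1 - u i / real (N i))) = (1 - u i / real (N i)) ^ N i) F"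
  proof -
    have "eventually (\<lambda>i. \<bar>u i / real (N i)\<bar> < 1) F"
      using tendstoD[OF z, of 1] by simp
    then show ?thesis
    proof eventually_elim
      case (elim i)
      then have "1 - u i / real (N i) > 0" by linarith
      then show ?case by (simp add: exp_of_nat_mult)
    qed
  qed
  ultimately show ?thesis by (rule Lim_transform_eventually)
qed

text \<open>A geometric sum of m + 1 terms is at least m + 1 times its smallest term. Applied with u
  = - \<phi>, it turns the zero of 1 + \<phi> at the corners into a factor of order 1 / k.\<close>

lemma one_minus_times_power_le:
  fixes u :: real
  assumes "0 \<le> u" "u \<le> 1"
  shows "(1 - u) * u ^ m \<le> 1 / (real m + 1)"
proof -
  have "(\<Sum>i<Suc m. u ^ m) \<le> (\<Sum>i<Suc m. u ^ i)"
    using assms by (intro sum_mono power_decreasing) auto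
  then have "(1 - u) * ((real m + 1) * u ^ m) \<le> (1 - u) * (\<Sum>i<Suc m. u ^ i)"
    using assms by (intro mult_left_mono) (auto simp: algebra_simps)
  also have "\<dots> = 1 - u ^ Suc m" by (rule one_diff_power_eq[symmetric])
  also have "\<dots> \<le> 1" using assms by simp
  finally show ?thesis by (simp add: field_simps)
qed

text \<open>The modulus of \<phi>^k (1 + \<phi>) on the set where the symbol is negative: what the
  corners contribute to p_k + p_(k+1).\<close>

abbreviation neg_part :: "nat \<Rightarrow> real ^ 'd \<Rightarrow> real" where
  "neg_part k t \<equiv> if walk_symbol t < 0 then \<bar>walk_symbol t\<bar> ^ k * (1 + walk_symbol t) else 0"

text \<open>The k factors are shared out: \<open>k div 2\<close> of them together with 1 + \<phi>
  give 2 / k by \<open>one_minus_times_power_le\<close>, the others give a Gaussian-type bound whose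
  integral is of order k^(-d/2). The total is smaller by a factor 1 / k than the main term of the
  local limit theorem.\<close>

lemma walk_symbol_negative_part:
  obtains C :: real where
    "\<And>k. k \<ge> 1 \<Longrightarrow> integrable lborel (\<lambda>t :: real ^ 'd. indicator torus t *
        neg_part k t)"
    "\<And>k. k \<ge> 1 \<Longrightarrow> (\<integral>t. indicator torus t *
        neg_part k t \<partial>(lborel :: (real ^ 'd) measure))
      \<le> C / (real k * sqrt (real k) ^ CARD('d))"
proof -
  let ?d = "real CARD('d)"
  define h where "h k t = neg_part k t"
    for k and t :: "real ^ 'd"
  define K where "K = 3 * pi * sqrt pi / 2 * sqrt (4 * ?d)"
  have h0: "0 \<le> h k t" for k t using walk_symbol_ge_m1[of t] by (auto simp: h_def)
  have bd: "h k t \<le> 2 / real k * exp (- (real k / (4 * ?d)) * sin_sq t)"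
    if k: "k \<ge> 1" for k t
  proof (cases "walk_symbol t < 0")
    case True
    define u where "u = \<bar>walk_symbol t\<bar>"
    define m where "m = k div 2"
    have u: "0 \<le> u" "u \<le> 1" using walk_symbol_ge_m1[of t] True by (auto simp: u_def)
    have m: "real k / 2 \<le> real m + 1" "real k / 2 \<le> real (k - m)" "m \<le> k" by (auto simp: m_def)
    have "h k t = ((1 - u) * u ^ m) * u ^ (k - m)"
      using True m(3) by (simp add: h_def u_def flip: power_add)
    also have "\<dots> \<le> (1 / (real m + 1)) * exp (- (real (k - m) / (2 * ?d)) * sin_sq t)"
      unfolding u_def using u by (intro mult_mono one_minus_times_power_le abs_walk_symbol_power_le) (auto simp: u_def)
    also have "\<dots> \<le> (2 / real k) * exp (- (real k / (4 * ?d)) * sin_sq t)"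
    proof (rule mult_mono)
      show "1 / (real m + 1) \<le> 2 / real k" using m k by (simp add: field_simps)
      have "real k / (4 * ?d) \<le> real (k - m) / (2 * ?d)" using m(2) by (simp add: field_simps)
      then have "real k / (4 * ?d) * sin_sq t \<le> real (k - m) / (2 * ?d) * sin_sq t"
        by (intro mult_right_mono sum_nonneg) auto
      then show "exp (- (real (k - m) / (2 * ?d)) * sin_sq t) \<le> exp (- (real k / (4 * ?d)) * sin_sq t)"
        by simp
    qed auto
    finally show ?thesis .
  qed (auto simp: h_def)
  have c: "real k / (4 * ?d) > 0" if "k \<ge> 1" for k using that by simp
  have [measurable]: "h k \<in> borel_measurable borel" for k unfolding h_def by measurable
  let ?g = "\<lambda>k (t :: real ^ 'd). 2 / real k * (indicator torus t * exp (- (real k / (4 * ?d)) * sin_sq t))"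
  have gi: "integrable lborel (?g k)" if "k \<ge> 1" for k
    by (intro integrable_mult_right torus_sin_integral_le c that)
  have le: "indicator torus t * h k t \<le> ?g k t" if "k \<ge> 1" for k t
    using bd[OF that, of t] by (auto simp: indicator_def)
  have i: "integrable lborel (\<lambda>t. indicator torus t * h k t)" if "k \<ge> 1" for k
    using le[OF that] h0 by (intro Bochner_Integration.integrable_bound[OF gi[OF that]])
      (auto intro!: AE_I2 order_trans[OF le[OF that]] simp: abs_mult)
  show ?thesis
  proof (rule that[of "2 * K ^ CARD('d)"])
    fix k :: nat assume k: "k \<ge> 1"
    show "integrable lborel (\<lambda>t :: real ^ 'd. indicator torus t *
        neg_part k t)"
      using i[OF k] by (simp add: h_def)
    have "(\<integral>t. indicator torus t * h k t \<partial>lborel) \<le> (\<integral>t. ?g k t \<partial>lborel)"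
      by (rule integral_mono[OF i[OF k] gi[OF k] le[OF k]])
    also have "\<dots> \<le> 2 / real k * (3 * pi * sqrt pi / 2 / sqrt (real k / (4 * ?d))) ^ CARD('d)"
      using torus_sin_integral_le(2)[OF c[OF k], where 'd = 'd] by (simp add: divide_right_mono)
    also have "\<dots> = 2 * K ^ CARD('d) / (real k * sqrt (real k) ^ CARD('d))"
      by (simp add: K_def real_sqrt_divide power_divide power_mult_distrib)
    finally show "(\<integral>t. indicator torus t *
        neg_part k t \<partial>(lborel :: (real ^ 'd) measure))
      \<le> 2 * K ^ CARD('d) / (real k * sqrt (real k) ^ CARD('d))"
      by (simp add: h_def)
  qed
qed

section \<open>Local central limit theorem\<close>

text \<open>
  The factor \<open>1 + walk_symbol\<close>, which comes from averaging the times \<open>k\<close> and \<open>k + 1\<close>, removes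
  the contribution of the points of the torus where \<open>walk_symbol = -1\<close>, i.e. the parity of the walk.
\<close>

lemma srw_local_limit:
  fixes K :: "nat \<Rightarrow> nat" and X :: "nat \<Rightarrow> int ^ 'd"
  assumes K: "filterlim K at_top sequentially"
    and X: "(\<lambda>i. lattice_norm (X i) / sqrt (real (K i))) \<longlonglongrightarrow> \<rho>"
  shows "(\<lambda>i. real (K i) powr (real CARD('d) / 2) * (srw (K i) (X i) + srw (Suc (K i)) (X i)))
    \<longlonglongrightarrow> 2 * (real CARD('d) / (2 * pi)) powr (real CARD('d) / 2) * exp (- real CARD('d) * \<rho>\<^sup>2 / 2)"
proof -
  let ?d = "real CARD('d)"
  let ?B = "lborel :: (real ^ 'd) measure"
  define r where "r i = 1 / sqrt (real (K i))" for i
  \<comment> \<open>\<open>f\<close> is the integrand for the times k and k + 1 together, without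
    its cosine. It equals \<open>g\<close> where the symbol is nonnegative and has modulus
    \<open>h\<close> elsewhere; only \<open>g\<close> survives the rescaling.\<close>
  define f where "f i t = indicator torus t * (walk_symbol t ^ K i * (1 + walk_symbol t))" for i and t :: "real ^ 'd"
  define g where "g i t = indicator torus t *
     (if walk_symbol t < 0 then 0 else walk_symbol t ^ K i * (1 + walk_symbol t))" for i and t :: "real ^ 'd"
  define h where "h i t = indicator torus t *
     (if walk_symbol t < 0 then \<bar>walk_symbol t\<bar> ^ K i * (1 + walk_symbol t) else 0)" for i and t :: "real ^ 'd"
  define G where "G t = 2 * exp (- (norm t)\<^sup>2 / (2 * ?d))" for t :: "real ^ 'd"
  define c where "c = 2 / (pi\<^sup>2 * ?d)"
  have c: "c > 0" by (simp add: c_def)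
  have [measurable]: "f i \<in> borel_measurable borel" "g i \<in> borel_measurable borel"
    "h i \<in> borel_measurable borel" "G \<in> borel_measurable borel" for i
    unfolding f_def g_def h_def G_def by measurable
  have Kpos: "eventually (\<lambda>i. K i \<ge> 1) sequentially"
    by (rule eventually_compose_filterlim[OF eventually_ge_at_top K])
  have K': "filterlim (\<lambda>i. real (K i)) at_top sequentially"
    by (rule filterlim_compose[OF filterlim_real_sequentially K])
  have sK: "filterlim (\<lambda>i. sqrt (real (K i))) at_top sequentially"
    by (rule filterlim_compose[OF sqrt_at_top K'])
  have r0: "r \<longlonglongrightarrow> 0"
    unfolding r_def by (intro tendsto_divide_0[OF tendsto_const] filterlim_at_top_imp_at_infinity sK)
  have rpos: "eventually (\<lambda>i. r i > 0) sequentially"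
    using Kpos by eventually_elim (simp add: r_def)
  have r2: "(r i)\<^sup>2 = 1 / real (K i)" if "K i \<ge> 1" for i
    using that by (simp add: r_def power_divide)
  have Gi: "integrable ?B G"
  proof -
    have "integrable ?B (\<lambda>t. 2 * exp (- (1 / (2 * ?d)) * (norm t)\<^sup>2))"
      by (intro integrable_mult_right gaussian_vec_integrable) simp
    then show ?thesis by (simp add: G_def[abs_def])
  qed
  obtain C where h: "\<And>k. k \<ge> 1 \<Longrightarrow> integrable lborel (\<lambda>t :: real ^ 'd. indicator torus t *
        neg_part k t)"
    "\<And>k. k \<ge> 1 \<Longrightarrow> (\<integral>t. indicator torus t *
        neg_part k t \<partial>?B)
      \<le> C / (real k * sqrt (real k) ^ CARD('d))"
    using walk_symbol_negative_part[where 'd = 'd] by blast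
  have gdom: "g i (r i *\<^sub>R t) \<le> 2 * exp (- c * (norm t)\<^sup>2)" "0 \<le> g i (r i *\<^sub>R t)"
    if k: "K i \<ge> 1" for i t
  proof -
    let ?t = "r i *\<^sub>R t"
    show "0 \<le> g i ?t" by (auto simp: g_def indicator_def)
    show "g i ?t \<le> 2 * exp (- c * (norm t)\<^sup>2)"
    proof (cases "?t \<in> torus \<and> \<not> walk_symbol ?t < 0")
      case True
      have "c * (norm ?t)\<^sup>2 \<le> 1 - walk_symbol ?t"
        unfolding c_def using True by (intro one_minus_walk_symbol_ge) auto
      then have "walk_symbol ?t \<le> 1 + - (c * (norm ?t)\<^sup>2)" by simp
      also have "\<dots> \<le> exp (- (c * (norm ?t)\<^sup>2))" by (rule exp_ge_add_one_self)
      finally have "walk_symbol ?t ^ K i \<le> exp (- (c * (norm ?t)\<^sup>2)) ^ K i"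
        using True by (intro power_mono) auto
      also have "\<dots> = exp (real (K i) * - (c * (norm ?t)\<^sup>2))" by (rule exp_of_nat_mult[symmetric])
      also have "real (K i) * - (c * (norm ?t)\<^sup>2) = - c * (norm t)\<^sup>2"
        using k r2[OF k] by (simp add: power_mult_distrib)
      finally have "walk_symbol ?t ^ K i * (1 + walk_symbol ?t) \<le> exp (- c * (norm t)\<^sup>2) * 2"
        using True walk_symbol_le_1[of ?t] by (intro mult_mono) auto
      then show ?thesis using True by (simp add: g_def mult.commute)
    qed (auto simp: g_def)
  qed
  have glim: "(\<lambda>i. g i (r i *\<^sub>R t)) \<longlonglongrightarrow> G t" for t
  proof -
    have q: "(\<lambda>i. (1 - walk_symbol (r i *\<^sub>R t)) / (r i)\<^sup>2) \<longlonglongrightarrow> (norm t)\<^sup>2 / (2 * ?d)"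
      using rpos by (intro walk_symbol_quadratic_limit r0) (auto elim: eventually_mono)
    have rt: "(\<lambda>i. r i *\<^sub>R t) \<longlonglongrightarrow> 0"
      using tendsto_scaleR[OF r0 tendsto_const[of t]] by simp
    have w0: "isCont walk_symbol (0 :: real ^ 'd)"
      using continuous_on_walk_symbol[of UNIV] by (auto simp: continuous_on_eq_continuous_at)
    have w: "(\<lambda>i. walk_symbol (r i *\<^sub>R t)) \<longlonglongrightarrow> walk_symbol (0 :: real ^ 'd)"
      by (rule isCont_tendsto_compose[OF w0 rt])
    have w1: "walk_symbol (0 :: real ^ 'd) = 1" by (simp add: walk_symbol_def)
    have "(\<lambda>i. (1 - (1 - walk_symbol (r i *\<^sub>R t)) / (r i)\<^sup>2 / real (K i)) ^ K i * (1 + walk_symbol (r i *\<^sub>R t)))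
        \<longlonglongrightarrow> exp (- ((norm t)\<^sup>2 / (2 * ?d))) * (1 + 1)"
      using w w1 by (intro tendsto_mult one_minus_power_limit[OF q K] tendsto_add tendsto_const) auto
    then have "(\<lambda>i. (1 - (1 - walk_symbol (r i *\<^sub>R t)) / (r i)\<^sup>2 / real (K i)) ^ K i * (1 + walk_symbol (r i *\<^sub>R t)))
        \<longlonglongrightarrow> G t" by (simp add: G_def mult.commute)
    moreover have "eventually (\<lambda>i. (1 - (1 - walk_symbol (r i *\<^sub>R t)) / (r i)\<^sup>2 / real (K i)) ^ K i * (1 + walk_symbol (r i *\<^sub>R t))
        = g i (r i *\<^sub>R t)) sequentially"
    proof -
      have "eventually (\<lambda>i. walk_symbol (r i *\<^sub>R t) > 0) sequentially"
        using order_tendstoD(1)[OF w, of 0] w1 by simp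
      moreover have "eventually (\<lambda>i. norm (r i *\<^sub>R t) < pi) sequentially"
        using tendstoD[OF rt, of pi] by simp
      ultimately show ?thesis using Kpos
      proof eventually_elim
        case (elim i)
        have "\<bar>(r i *\<^sub>R t) $ j\<bar> \<le> pi" for j
          using component_le_norm_cart[of "r i *\<^sub>R t" j] elim by linarith
        then have "r i *\<^sub>R t \<in> torus" by (simp add: torus_def)
        then show ?case using elim r2[of i] by (simp add: g_def)
      qed
    qed
    ultimately show ?thesis by (rule Lim_transform_eventually)
  qed
  have dgi: "integrable ?B (\<lambda>t. 2 * exp (- c * (norm t)\<^sup>2) + G t)"
    by (intro Bochner_Integration.integrable_add integrable_mult_right gaussian_vec_integrable c Gi)
  have gi: "integrable ?B (\<lambda>t. g i (r i *\<^sub>R t))" if "K i \<ge> 1" for i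
    by (rule Bochner_Integration.integrable_bound[OF integrable_mult_right[OF gaussian_vec_integrable[OF c]], of _ 2])
       (use gdom[OF that] in auto)
  have hi: "integrable ?B (h i)" if "K i \<ge> 1" for i
    using h(1)[OF that] by (simp add: h_def[abs_def])
  have hri: "integrable ?B (\<lambda>t. h i (r i *\<^sub>R t))" if "K i \<ge> 1" for i
    using hi[OF that] that by (subst lborel_integral_scale(1)[symmetric]) (auto simp: r_def)
  have g1: "(\<lambda>i. \<integral>t. \<bar>g i (r i *\<^sub>R t) - G t\<bar> \<partial>?B) \<longlonglongrightarrow> 0"
  proof -
    \<comment> \<open>The domination holds only once K i >= 1, so the dominated convergence theorem
      is applied to a shifted sequence.\<close>
    obtain N where N: "\<And>i. i \<ge> N \<Longrightarrow> K i \<ge> 1" using Kpos by (auto simp: eventually_sequentially)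
    have "(\<lambda>i. \<integral>t. \<bar>g (i + N) (r (i + N) *\<^sub>R t) - G t\<bar> \<partial>?B) \<longlonglongrightarrow> (\<integral>t. 0 \<partial>?B)"
    proof (rule integral_dominated_convergence[where w = "\<lambda>t. 2 * exp (- c * (norm t)\<^sup>2) + G t"])
      show "AE t in ?B. (\<lambda>i. \<bar>g (i + N) (r (i + N) *\<^sub>R t) - G t\<bar>) \<longlonglongrightarrow> 0"
        using LIMSEQ_ignore_initial_segment[OF glim, of N]
        by (intro AE_I2 tendsto_rabs_zero) (simp add: LIM_zero_iff)
      show "AE t in ?B. norm \<bar>g (i + N) (r (i + N) *\<^sub>R t) - G t\<bar> \<le> 2 * exp (- c * (norm t)\<^sup>2) + G t" for i
      proof (rule AE_I2)
        fix t
        have "0 \<le> G t" by (simp add: G_def)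
        then show "norm \<bar>g (i + N) (r (i + N) *\<^sub>R t) - G t\<bar> \<le> 2 * exp (- c * (norm t)\<^sup>2) + G t"
          using gdom[of "i + N" t] N[of "i + N"] by (simp add: abs_if)
      qed
    qed (use dgi in auto)
    then have "(\<lambda>i. \<integral>t. \<bar>g (i + N) (r (i + N) *\<^sub>R t) - G t\<bar> \<partial>?B) \<longlonglongrightarrow> 0" by simp
    then show ?thesis by (rule LIMSEQ_offset)
  qed
  have h1: "(\<lambda>i. \<integral>t. h i (r i *\<^sub>R t) \<partial>?B) \<longlonglongrightarrow> 0"
  proof (rule tendsto_sandwich[OF _ _ tendsto_const])
    show "eventually (\<lambda>i. 0 \<le> (\<integral>t. h i (r i *\<^sub>R t) \<partial>?B)) sequentially"
    proof (intro always_eventually allI Bochner_Integration.integral_nonneg)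
      show "0 \<le> h i (r i *\<^sub>R t)" for i t
        using walk_symbol_ge_m1[of "r i *\<^sub>R t"] by (auto simp: h_def indicator_def)
    qed
    show "eventually (\<lambda>i. (\<integral>t. h i (r i *\<^sub>R t) \<partial>?B) \<le> C / real (K i)) sequentially"
      using Kpos
    proof eventually_elim
      case (elim i)
      have rp: "r i > 0" using elim by (simp add: r_def)
      have "r i ^ CARD('d) * (\<integral>t. h i (r i *\<^sub>R t) \<partial>?B) = (\<integral>t. h i t \<partial>?B)"
        using lborel_integral_scale(2)[OF rp, of "h i"] by simp
      also have "\<dots> \<le> C / (real (K i) * sqrt (real (K i)) ^ CARD('d))"
        using h(2)[OF elim] by (simp add: h_def)
      also have "\<dots> = r i ^ CARD('d) * (C / real (K i))"
        by (simp add: r_def power_divide)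
      finally have le: "r i ^ CARD('d) * (\<integral>t. h i (r i *\<^sub>R t) \<partial>?B) \<le> r i ^ CARD('d) * (C / real (K i))" .
      show ?case by (rule mult_left_le_imp_le[OF le]) (use rp in simp)
    qed
    show "(\<lambda>i. C / real (K i)) \<longlonglongrightarrow> 0"
      by (intro tendsto_divide_0[OF tendsto_const] filterlim_at_top_imp_at_infinity K')
  qed
  let ?a = "\<lambda>i. real (K i) powr (?d / 2) * (srw (K i) (X i) + srw (Suc (K i)) (X i))"
  let ?J = "\<lambda>i. \<integral>t. G t * cos (t \<bullet> (r i *\<^sub>R rvec (X i))) \<partial>?B"
  have diff: "eventually (\<lambda>i. \<bar>(2 * pi) ^ CARD('d) * ?a i - ?J i\<bar> \<le>
      (\<integral>t. \<bar>g i (r i *\<^sub>R t) - G t\<bar> \<partial>?B) + (\<integral>t. h i (r i *\<^sub>R t) \<partial>?B)) sequentially"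
    using Kpos
  proof eventually_elim
    case (elim i)
    have rp: "r i > 0" using elim by (simp add: r_def)
    let ?cos = "\<lambda>t. cos (t \<bullet> rvec (X i))"
    have sq: "(2 * pi) ^ CARD('d) * (srw (K i) (X i) + srw (Suc (K i)) (X i)) = (\<integral>t. f i t * ?cos t \<partial>?B)"
    proof -
      have "(2 * pi) ^ CARD('d) * (srw (K i) (X i) + srw (Suc (K i)) (X i)) =
         (\<integral>t. indicator torus t * (walk_symbol t ^ K i * ?cos t) + indicator torus t * (walk_symbol t ^ Suc (K i) * ?cos t) \<partial>?B)"
        by (subst Bochner_Integration.integral_add[OF srw_fourier(1) srw_fourier(1)])
          (simp only: distrib_left srw_fourier(2))
      then show ?thesis by (simp add: f_def algebra_simps)
    qed
    have fi: "integrable ?B (\<lambda>t. f i t * ?cos t)"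
    proof -
      have "integrable ?B (\<lambda>t. indicator torus t *\<^sub>R (walk_symbol t ^ K i * (1 + walk_symbol t) * ?cos t))"
        by (intro torus_integrable continuous_intros)
      then show ?thesis by (simp add: f_def mult.assoc)
    qed
    have pw: "real (K i) powr (?d / 2) * r i ^ CARD('d) = 1"
    proof -
      have "real (K i) powr (?d / 2) = (real (K i) powr (1 / 2)) powr ?d" by (simp add: powr_powr)
      also have "\<dots> = sqrt (real (K i)) ^ CARD('d)"
        using elim by (simp only: powr_half_sqrt of_nat_0_le_iff) (simp add: powr_realpow)
      finally show ?thesis using elim by (simp add: r_def power_divide)
    qed
    have cos_r: "?cos (r i *\<^sub>R t) = cos (t \<bullet> (r i *\<^sub>R rvec (X i)))" for t by simp
    have "(2 * pi) ^ CARD('d) * ?a i = real (K i) powr (?d / 2) * (\<integral>t. f i t * ?cos t \<partial>?B)"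
      by (simp add: sq[symmetric] mult_ac)
    also have "(\<integral>t. f i t * ?cos t \<partial>?B) = r i ^ CARD('d) * (\<integral>t. f i (r i *\<^sub>R t) * ?cos (r i *\<^sub>R t) \<partial>?B)"
      using lborel_integral_scale(2)[OF rp, of "\<lambda>t. f i t * ?cos t"] by simp
    finally have a: "(2 * pi) ^ CARD('d) * ?a i = (\<integral>t. f i (r i *\<^sub>R t) * ?cos (r i *\<^sub>R t) \<partial>?B)"
      using pw by (simp add: mult.assoc[symmetric])
    have fri: "integrable ?B (\<lambda>t. f i (r i *\<^sub>R t) * ?cos (r i *\<^sub>R t))"
      using fi lborel_integral_scale(1)[OF rp, of "\<lambda>t. f i t * ?cos t"] by simp
    have Gci: "integrable ?B (\<lambda>t. G t * ?cos (r i *\<^sub>R t))"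
      by (rule Bochner_Integration.integrable_bound[OF Gi]) (auto simp: abs_mult mult_left_le)
    have "(2 * pi) ^ CARD('d) * ?a i - ?J i = (\<integral>t. f i (r i *\<^sub>R t) * ?cos (r i *\<^sub>R t) - G t * ?cos (r i *\<^sub>R t) \<partial>?B)"
      unfolding a cos_r[symmetric] by (rule Bochner_Integration.integral_diff[OF fri Gci, symmetric])
    also have "\<bar>\<dots>\<bar> \<le> (\<integral>t. \<bar>f i (r i *\<^sub>R t) * ?cos (r i *\<^sub>R t) - G t * ?cos (r i *\<^sub>R t)\<bar> \<partial>?B)"
      by (rule integral_abs_bound)
    also have "\<dots> \<le> (\<integral>t. \<bar>g i (r i *\<^sub>R t) - G t\<bar> + h i (r i *\<^sub>R t) \<partial>?B)"
    proof (rule integral_mono)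
      show "integrable ?B (\<lambda>t. \<bar>f i (r i *\<^sub>R t) * ?cos (r i *\<^sub>R t) - G t * ?cos (r i *\<^sub>R t)\<bar>)"
        by (intro integrable_abs Bochner_Integration.integrable_diff fri Gci)
      show "integrable ?B (\<lambda>t. \<bar>g i (r i *\<^sub>R t) - G t\<bar> + h i (r i *\<^sub>R t))"
        by (intro Bochner_Integration.integrable_add integrable_abs Bochner_Integration.integrable_diff gi hri Gi elim)
      fix t :: "real ^ 'd"
      let ?t = "r i *\<^sub>R t"
      have fg: "\<bar>f i ?t - G t\<bar> \<le> \<bar>g i ?t - G t\<bar> + h i ?t"
      proof (cases "walk_symbol ?t < 0")
        case True
        then have "\<bar>f i ?t\<bar> = h i ?t" "g i ?t = 0"
          using walk_symbol_ge_m1[of ?t] by (auto simp: f_def h_def g_def abs_mult power_abs)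
        then show ?thesis by linarith
      qed (auto simp: f_def g_def h_def)
      have "\<bar>f i ?t * ?cos ?t - G t * ?cos ?t\<bar> \<le> \<bar>f i ?t - G t\<bar> * 1"
        unfolding left_diff_distrib[symmetric] abs_mult by (intro mult_left_mono) auto
      then show "\<bar>f i ?t * ?cos ?t - G t * ?cos ?t\<bar> \<le> \<bar>g i ?t - G t\<bar> + h i ?t"
        by (rule order_trans) (use fg in simp)
    qed
    also have "\<dots> = (\<integral>t. \<bar>g i (r i *\<^sub>R t) - G t\<bar> \<partial>?B) + (\<integral>t. h i (r i *\<^sub>R t) \<partial>?B)"
      by (intro Bochner_Integration.integral_add integrable_abs Bochner_Integration.integrable_diff gi hri Gi elim)
    finally show ?case .
  qed
  have "(\<lambda>i. (2 * pi) ^ CARD('d) * ?a i - ?J i) \<longlonglongrightarrow> 0"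
    by (rule Lim_null_comparison[OF _ tendsto_add_zero[OF g1 h1]]) (use diff in simp)
  moreover have "?J \<longlonglongrightarrow> 2 * (sqrt (2 * pi * ?d) ^ CARD('d) * exp (- ?d * \<rho>\<^sup>2 / 2))"
  proof -
    have J: "?J i = 2 * (sqrt (2 * pi * ?d) ^ CARD('d) * exp (- ?d * (lattice_norm (X i) / sqrt (real (K i)))\<^sup>2 / 2))" for i
    proof -
      have "?J i = 2 * (\<integral>t. exp (- (norm t)\<^sup>2 / (2 * ?d)) * cos (t \<bullet> (r i *\<^sub>R rvec (X i))) \<partial>?B)"
        unfolding G_def mult.assoc by (rule integral_mult_right_zero)
      also have "\<dots> = 2 * (sqrt (2 * pi * ?d) ^ CARD('d) * exp (- ?d * (norm (r i *\<^sub>R rvec (X i)))\<^sup>2 / 2))"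
        by (subst gaussian_vec_cos) auto
      also have "norm (r i *\<^sub>R rvec (X i)) = lattice_norm (X i) / sqrt (real (K i))"
        by (simp add: r_def lattice_norm_def)
      finally show ?thesis .
    qed
    show ?thesis unfolding J by (intro tendsto_intros X) auto
  qed
  ultimately have "(\<lambda>i. ((2 * pi) ^ CARD('d) * ?a i - ?J i) + ?J i) \<longlonglongrightarrow>
      0 + 2 * (sqrt (2 * pi * ?d) ^ CARD('d) * exp (- ?d * \<rho>\<^sup>2 / 2))"
    by (intro tendsto_add)
  then have "(\<lambda>i. ((2 * pi) ^ CARD('d) * ?a i) / (2 * pi) ^ CARD('d)) \<longlonglongrightarrow>
      (2 * (sqrt (2 * pi * ?d) ^ CARD('d) * exp (- ?d * \<rho>\<^sup>2 / 2))) / (2 * pi) ^ CARD('d)"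
    by (intro tendsto_divide tendsto_const) auto
  also have "(2 * (sqrt (2 * pi * ?d) ^ CARD('d) * exp (- ?d * \<rho>\<^sup>2 / 2))) / (2 * pi) ^ CARD('d) =
      2 * (?d / (2 * pi)) powr (?d / 2) * exp (- ?d * \<rho>\<^sup>2 / 2)"
  proof -
    have "(?d / (2 * pi)) powr (?d / 2) = ((?d / (2 * pi)) powr (1 / 2)) powr ?d" by (simp add: powr_powr)
    also have "\<dots> = sqrt (?d / (2 * pi)) ^ CARD('d)"
      by (subst powr_half_sqrt) (auto simp: powr_realpow)
    also have "sqrt (?d / (2 * pi)) = sqrt (2 * pi * ?d) / (2 * pi)"
    proof -
      have "?d / (2 * pi) = (2 * pi * ?d) / (2 * pi)\<^sup>2" by (simp add: power2_eq_square)
      then have "sqrt (?d / (2 * pi)) = sqrt (2 * pi * ?d) / sqrt ((2 * pi)\<^sup>2)"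
        by (simp only: real_sqrt_divide)
      also have "sqrt ((2 * pi)\<^sup>2) = 2 * pi" by (simp only: real_sqrt_abs) simp
      finally show ?thesis .
    qed
    finally show ?thesis by (simp only: power_divide) simp
  qed
  finally show ?thesis by simp
qed

section \<open>Diagonal regime\<close>

text \<open>Layer-cake argument: the sublevel set of (c |t|^2)^b at level s is a ball of volume V
  s^a with a = DIM / (2 b), and integrating exp (- s) V s^a over s > 0 gives V Gamma (1 +
  a).\<close>

lemma radial_exp_integral:
  fixes b c :: real
  assumes b: "b > 0" and c: "c > 0"
  shows "integrable lborel (\<lambda>t :: 'a :: euclidean_space. exp (- ((c * (norm t)\<^sup>2) powr b)))"
    and "(\<integral>t. exp (- ((c * (norm t)\<^sup>2) powr b)) \<partial>(lborel :: 'a measure)) =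
      unit_ball_vol (real DIM('a)) * c powr (- real DIM('a) / 2) * Gamma (1 + real DIM('a) / (2 * b))"
proof -
  let ?B = "lborel :: 'a measure"
  define g where "g t = (c * (norm t)\<^sup>2) powr b" for t :: 'a
  define V where "V = unit_ball_vol (real DIM('a)) * c powr (- real DIM('a) / 2)"
  define a where "a = real DIM('a) / (2 * b)"
  have a: "a > 0" using b by (simp add: a_def)
  have V: "V \<ge> 0" by (simp add: V_def)
  have [measurable]: "g \<in> borel_measurable borel" unfolding g_def by measurable
  have g0: "g t \<ge> 0" for t by (simp add: g_def)
  have vol: "emeasure ?B {t. g t \<le> s} = ennreal (V * s powr a)" if "s \<ge> 0" for s
  proof -
    let ?R = "c powr (- 1 / 2) * s powr (1 / (2 * b))"
    have R: "?R \<ge> 0" by simp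
    have gR: "g t \<le> s \<longleftrightarrow> norm t \<le> ?R" for t
    proof -
      have s: "s = (s powr (1 / b)) powr b" using that b by (simp add: powr_powr)
      have "x powr b \<le> y powr b \<longleftrightarrow> x \<le> y" if "x \<ge> 0" "y \<ge> 0" for x y :: real
        using b that powr_mono2[of b x y] powr_less_mono2[of b y x] by (cases "x \<le> y") auto
      then have "g t \<le> s \<longleftrightarrow> c * (norm t)\<^sup>2 \<le> s powr (1 / b)"
        unfolding g_def using c by (subst (1) s) simp
      also have "\<dots> \<longleftrightarrow> (norm t)\<^sup>2 \<le> ?R\<^sup>2"
      proof -
        have "?R\<^sup>2 = (c powr (- 1 / 2))\<^sup>2 * (s powr (1 / (2 * b)))\<^sup>2"
          by (simp add: power_mult_distrib)
        also have "(c powr (- 1 / 2))\<^sup>2 = 1 / c"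
          using c by (simp add: power2_eq_square powr_minus_divide flip: powr_add)
        also have "(s powr (1 / (2 * b)))\<^sup>2 = s powr (1 / b)"
          by (simp add: power2_eq_square flip: powr_add)
        finally have R2: "?R\<^sup>2 = 1 / c * s powr (1 / b)" .
        show ?thesis unfolding R2 using c by (simp add: field_simps)
      qed
      also have "\<dots> \<longleftrightarrow> norm t \<le> ?R"
        using R by (simp only: power_mono_iff[OF norm_ge_zero R, of 2])
      finally show ?thesis .
    qed
    have "{t. g t \<le> s} = cball 0 ?R"
      unfolding gR by (simp only: cball_def dist_norm diff_0 norm_minus_cancel)
    then have "emeasure ?B {t. g t \<le> s} = ennreal (unit_ball_vol (real DIM('a)) * ?R ^ DIM('a))"
      using emeasure_cball[OF R, of "0 :: 'a"] by simp
    also have "?R ^ DIM('a) = c powr (- real DIM('a) / 2) * s powr a"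
    proof -
      have pow: "(y powr e) ^ DIM('a) = y powr (e * real DIM('a))" if "y \<ge> 0" for y e :: real
        using that by (cases "y = 0") (auto simp: powr_powr[symmetric] powr_realpow)
      show ?thesis
        unfolding power_mult_distrib pow[OF less_imp_le[OF c]] pow[OF that] by (simp add: a_def mult.commute)
    qed
    finally show ?thesis by (simp add: V_def mult.assoc)
  qed
  have "(\<integral>\<^sup>+t. ennreal (exp (- g t)) \<partial>?B) = (\<integral>\<^sup>+t. (\<integral>\<^sup>+s. ennreal (exp (- s)) * indicator {g t..} s \<partial>lborel) \<partial>?B)"
    by (simp add: nn_integral_exp_tail)
  also have "\<dots> = (\<integral>\<^sup>+t. (\<integral>\<^sup>+s. ennreal (exp (- s)) * (if g t \<le> s then 1 else 0) \<partial>lborel) \<partial>?B)"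
    by (intro nn_integral_cong) (auto simp: indicator_def)
  also have "\<dots> = (\<integral>\<^sup>+s. (\<integral>\<^sup>+t. ennreal (exp (- s)) * (if g t \<le> s then 1 else 0) \<partial>?B) \<partial>lborel)"
    by (rule lborel_pair.Fubini'[symmetric]) measurable
  also have "\<dots> = (\<integral>\<^sup>+s. ennreal V * ennreal (indicator {0..} s * s powr ((1 + a) - 1) / exp s) \<partial>lborel)"
  proof (rule nn_integral_cong)
    fix s :: real
    have "(\<integral>\<^sup>+t. ennreal (exp (- s)) * (if g t \<le> s then 1 else 0) \<partial>?B) =
        (\<integral>\<^sup>+t. ennreal (exp (- s)) * indicator {t. g t \<le> s} t \<partial>?B)"
      by (intro nn_integral_cong) (auto simp: indicator_def)
    also have "\<dots> = ennreal (exp (- s)) * emeasure ?B {t. g t \<le> s}"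
      by (rule nn_integral_cmult_indicator) simp
    also have "\<dots> = ennreal V * ennreal (indicator {0..} s * s powr ((1 + a) - 1) / exp s)"
    proof (cases "s \<ge> 0")
      case True
      then show ?thesis
        using V by (simp add: vol ennreal_mult'[symmetric] exp_minus field_simps)
    next
      case False
      then have "{t. g t \<le> s} = {}" using g0 by (auto simp: not_le intro: less_le_trans)
      then show ?thesis using False by simp
    qed
    finally show "(\<integral>\<^sup>+t. ennreal (exp (- s)) * (if g t \<le> s then 1 else 0) \<partial>?B) =
      ennreal V * ennreal (indicator {0..} s * s powr ((1 + a) - 1) / exp s)" .
  qed
  also have "\<dots> = ennreal V * (\<integral>\<^sup>+s. ennreal (indicator {0..} s * s powr ((1 + a) - 1) / exp s) \<partial>lborel)"
    by (rule nn_integral_cmult) measurable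
  also have "\<dots> = ennreal V * ennreal (Gamma (1 + a))"
    using a by (subst Gamma_conv_nn_integral_real) auto
  also have "\<dots> = ennreal (V * Gamma (1 + a))"
    using V by (simp add: ennreal_mult')
  finally have nn: "(\<integral>\<^sup>+t. ennreal (exp (- g t)) \<partial>?B) = ennreal (V * Gamma (1 + a))" .
  have "V * Gamma (1 + a) \<ge> 0"
    using V a by (intro mult_nonneg_nonneg less_imp_le[OF Gamma_real_pos]) auto
  then have "has_bochner_integral ?B (\<lambda>t. exp (- g t)) (V * Gamma (1 + a))"
    using nn by (intro has_bochner_integral_nn_integral) auto
  then show "integrable ?B (\<lambda>t. exp (- ((c * (norm t)\<^sup>2) powr b)))"
    and "(\<integral>t. exp (- ((c * (norm t)\<^sup>2) powr b)) \<partial>?B) =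
      unit_ball_vol (real DIM('a)) * c powr (- real DIM('a) / 2) * Gamma (1 + real DIM('a) / (2 * b))"
    by (auto simp: has_bochner_integral_iff g_def V_def a_def)
qed

definition sub_walk :: "real \<Rightarrow> nat \<Rightarrow> int ^ 'd \<Rightarrow> real" where
  "sub_walk b n x = (\<Sum>k. sub_coeff b n k * srw k x)"

text \<open>The symbol attains both 1 and -1 on the torus, so the generating function is wanted on
  the closed interval. Nonnegative coefficients of sum 1 make the series uniformly convergent there,
  hence continuous, and the identity extends from the open interval.\<close>

lemma sub_coeff_sums_closed:
  assumes b: "b > 0" and nonneg: "\<And>k. 0 \<le> sub_coeff b n k" and sums: "sub_coeff b n sums 1"
    and z: "\<bar>z\<bar> \<le> 1"
  shows "(\<lambda>k. sub_coeff b n k * z ^ k) sums (1 - (1 - z) powr b) ^ n"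
proof -
  let ?q = "sub_coeff b n"
  have bd: "norm (?q k * z ^ k) \<le> ?q k" if "z \<in> {-1..1}" for k z
    using that nonneg[of k] by (auto simp: abs_mult power_abs intro!: mult_left_le power_le_one)
  have "uniform_limit {-1..1} (\<lambda>N z. \<Sum>k<N. ?q k * z ^ k) (\<lambda>z. \<Sum>k. ?q k * z ^ k) sequentially"
    by (rule Weierstrass_m_test[OF bd]) (use sums in \<open>auto simp: sums_iff\<close>)
  then have "continuous_on {-1..1} (\<lambda>z. \<Sum>k. ?q k * z ^ k)"
    by (rule uniform_limit_theorem[rotated]) (auto intro!: always_eventually continuous_intros)
  then have cont: "continuous_on {-1..1} (\<lambda>z. (\<Sum>k. ?q k * z ^ k) - (1 - (1 - z) powr b) ^ n)"
    using b by (intro continuous_on_diff continuous_on_power continuous_on_powr' continuous_on_const continuous_on_id) auto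
  have cl: "closure {-1<..<1::real} = {-1..1}" by simp
  have "(\<Sum>k. ?q k * z ^ k) - (1 - (1 - z) powr b) ^ n = 0"
  proof (rule continuous_constant_on_closure
      [of "{-1<..<1}" "\<lambda>z. (\<Sum>k. ?q k * z ^ k) - (1 - (1 - z) powr b) ^ n" 0 z])
    show "(\<Sum>k. ?q k * z ^ k) - (1 - (1 - z) powr b) ^ n = 0" if "z \<in> {-1<..<1}" for z
      using sub_coeff_sums[of z b n] that by (simp add: sums_iff abs_less_iff)
  qed (use cont z in \<open>auto simp: cl\<close>)
  moreover have "summable (\<lambda>k. ?q k * z ^ k)"
  proof (rule summable_comparison_test'[of ?q 0])
    show "norm (?q k * z ^ k) \<le> ?q k" for k using z by (intro bd) auto
  qed (use sums in \<open>simp add: sums_iff\<close>)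
  ultimately show ?thesis by (simp add: sums_iff)
qed

text \<open>Fourier inversion for each time k, summed with the weights
  \<open>sub_coeff b n k\<close>. The interchange of sum and integral rests on the total mass 1 of
  the weights and the finite volume of the torus.\<close>

lemma sub_walk_fourier:
  fixes x :: "int ^ 'd"
  assumes b: "b > 0" and nonneg: "\<And>k. 0 \<le> sub_coeff b n k" and sums: "sub_coeff b n sums 1"
  shows "(2 * pi) ^ CARD('d) * sub_walk b n x =
     (\<integral>t. indicator torus t * ((1 - (1 - walk_symbol t) powr b) ^ n * cos (t \<bullet> rvec x)) \<partial>lborel)"
proof -
  let ?B = "lborel :: (real ^ 'd) measure"
  let ?q = "sub_coeff b n"
  let ?f = "\<lambda>k t. ?q k * (indicator torus t * (walk_symbol t ^ k * cos (t \<bullet> rvec x)))"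
  have i: "integrable ?B (?f k)" for k
    by (intro integrable_mult_right srw_fourier)
  have w: "\<bar>walk_symbol t\<bar> \<le> 1" for t :: "real ^ 'd"
    using walk_symbol_le_1[of t] walk_symbol_ge_m1[of t] by (simp add: abs_le_iff)
  have bd: "norm (?f k t) \<le> ?q k * indicator torus t" for k t
  proof -
    have "\<bar>walk_symbol t ^ k * cos (t \<bullet> rvec x)\<bar> \<le> 1 * 1"
      unfolding abs_mult power_abs using w by (intro mult_mono power_le_one) auto
    then show ?thesis using nonneg[of k] by (auto simp: abs_mult indicator_def intro: mult_left_le)
  qed
  have ti: "integrable ?B (indicator torus :: _ \<Rightarrow> real)"
    using torus_integrable[of "\<lambda>_ :: real ^ 'd. 1 :: real"] by simp
  have sq: "summable ?q" using sums by (simp add: sums_iff)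
  have sm: "summable (\<lambda>k. norm (?f k t))" for t
  proof (rule summable_comparison_test'[of "\<lambda>k. ?q k * indicator torus t" 0])
    show "norm (norm (?f k t)) \<le> ?q k * indicator torus t" for k
      using bd[of k t] by (simp only: real_norm_def abs_idempotent)
  qed (intro summable_mult2 sq)
  have fsums: "(\<lambda>k. \<integral>t. ?f k t \<partial>?B) sums (\<integral>t. (\<Sum>k. ?f k t) \<partial>?B)"
  proof (rule sums_integral[OF i])
    show "AE t in ?B. summable (\<lambda>k. norm (?f k t))" using sm by auto
    show "summable (\<lambda>k. \<integral>t. norm (?f k t) \<partial>?B)"
    proof (rule summable_comparison_test'[of "\<lambda>k. ?q k * (\<integral>t. indicator torus t \<partial>?B)" 0])
      show "summable (\<lambda>k. ?q k * (\<integral>t. indicator torus t \<partial>?B))" by (intro summable_mult2 sq)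
      show "norm (\<integral>t. norm (?f k t) \<partial>?B) \<le> ?q k * (\<integral>t. indicator torus t \<partial>?B)" for k
      proof -
        have "(\<integral>t. norm (?f k t) \<partial>?B) \<le> (\<integral>t. ?q k * indicator torus t \<partial>?B)"
          by (rule integral_mono[OF integrable_norm[OF i] integrable_mult_right[OF ti] bd])
        then show ?thesis by simp
      qed
    qed
  qed
  have fsum: "(\<Sum>k. ?f k t) = indicator torus t * ((1 - (1 - walk_symbol t) powr b) ^ n * cos (t \<bullet> rvec x))" for t
  proof -
    have "(\<lambda>k. ?q k * walk_symbol t ^ k * (indicator torus t * cos (t \<bullet> rvec x))) sums
       ((1 - (1 - walk_symbol t) powr b) ^ n * (indicator torus t * cos (t \<bullet> rvec x)))"
      by (intro sums_mult2 sub_coeff_sums_closed assms w)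
    then show ?thesis by (simp add: sums_iff mult_ac)
  qed
  have fint: "(\<integral>t. ?f k t \<partial>?B) = (2 * pi) ^ CARD('d) * (?q k * srw k x)" for k
  proof -
    have "(\<integral>t. ?f k t \<partial>?B) = ?q k * ((2 * pi) ^ CARD('d) * srw k x)"
      unfolding srw_fourier(2) by (rule integral_mult_right_zero)
    then show ?thesis by (simp only: mult_ac)
  qed
  have "(\<lambda>k. (2 * pi) ^ CARD('d) * (?q k * srw k x)) sums
     (\<integral>t. indicator torus t * ((1 - (1 - walk_symbol t) powr b) ^ n * cos (t \<bullet> rvec x)) \<partial>?B)"
    using fsums unfolding fsum fint .
  then have "(\<lambda>k. 1 / (2 * pi) ^ CARD('d) * ((2 * pi) ^ CARD('d) * (?q k * srw k x))) sums
     (1 / (2 * pi) ^ CARD('d) * (\<integral>t. indicator torus t * ((1 - (1 - walk_symbol t) powr b) ^ n * cos (t \<bullet> rvec x)) \<partial>?B))"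
    by (rule sums_mult)
  then show ?thesis by (simp add: sub_walk_def sums_iff field_simps)
qed

text \<open>This is the aperiodicity of the subordinate walk. With u = (1 - \<phi>)^b the range is
  [0, 2^b], and K = 2^b - 1 < 1 keeps 1 - u away from -1. The constant \<open>c\<close> is at most
  1, for u <= 1, and small enough that exp (- c u) >= K up to u = 2^b.\<close>

lemma abs_one_minus_le_exp:
  assumes b: "0 < b" "b < 1"
  obtains c :: real where "c > 0" "\<And>u. 0 \<le> u \<Longrightarrow> u \<le> 2 powr b \<Longrightarrow> \<bar>1 - u\<bar> \<le> exp (- c * u)"
proof -
  define K where "K = (2::real) powr b - 1"
  have "(2::real) powr b > 2 powr 0" using b by (intro powr_less_mono) auto
  moreover have "(2::real) powr b < 2 powr 1" using b by (intro powr_less_mono) auto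
  ultimately have K: "0 < K" "K < 1" by (auto simp: K_def)
  define c where "c = min 1 (- ln K / 2 powr b)"
  have "ln K < 0" using K by simp
  then have "- ln K / 2 powr b > 0" by (intro divide_pos_pos) auto
  then have c: "c > 0" by (simp add: c_def)
  show ?thesis
  proof (rule that[OF c])
    fix u :: real assume u: "0 \<le> u" "u \<le> 2 powr b"
    show "\<bar>1 - u\<bar> \<le> exp (- c * u)"
    proof (cases "u \<le> 1")
      case True
      have "1 + (- u) \<le> exp (- u)" by (rule exp_ge_add_one_self)
      also have "\<dots> \<le> exp (- c * u)" using u mult_right_mono[of c 1 u] by (simp add: c_def)
      finally show ?thesis using True by simp
    next
      case False
      have "\<bar>1 - u\<bar> \<le> K" using False u by (simp add: K_def)
      also have "\<dots> = exp (- (- ln K / 2 powr b) * 2 powr b)" using K by simp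
      also have "\<dots> \<le> exp (- c * u)"
      proof -
        have "c * u \<le> (- ln K / 2 powr b) * 2 powr b"
          using u K c by (intro mult_mono) (auto simp: c_def)
        then show ?thesis by simp
      qed
      finally show ?thesis .
    qed
  qed
qed

text \<open>The scale r = n^(-1/(2b)) is fixed by n (r^2)^b = 1. The hypothesis on \<open>X\<close>
  says that r |X| tends to 0, so the phase r t . X disappears for every fixed t and the limit is the
  same for all such \<open>X\<close>, including \<open>X = 0\<close>.\<close>

lemma sub_walk_local_limit:
  fixes N :: "nat \<Rightarrow> nat" and X :: "nat \<Rightarrow> int ^ 'd"
  assumes b: "0 < b" "b < 1"
    and nonneg: "\<And>n k. 0 \<le> sub_coeff b n k" and sums: "\<And>n. sub_coeff b n sums 1"
    and N: "filterlim N at_top sequentially"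
    and X: "(\<lambda>i. lattice_norm (X i) * real (N i) powr (- 1 / (2 * b))) \<longlonglongrightarrow> 0"
  shows "(\<lambda>i. real (N i) powr (real CARD('d) / (2 * b)) * sub_walk b (N i) (X i))
    \<longlonglongrightarrow> D_const CARD('d) (2 * b)"
proof -
  let ?d = "real CARD('d)"
  let ?B = "lborel :: (real ^ 'd) measure"
  define r where "r i = real (N i) powr (- 1 / (2 * b))" for i
  define f where "f i t = indicator torus t * ((1 - (1 - walk_symbol t) powr b) ^ N i * cos (t \<bullet> rvec (X i)))"
    for i and t :: "real ^ 'd"
  define c1 where "c1 = 2 / (pi\<^sup>2 * ?d)"
  have c1: "c1 > 0" by (simp add: c1_def)
  obtain c where c: "c > 0" "\<And>u. 0 \<le> u \<Longrightarrow> u \<le> 2 powr b \<Longrightarrow> \<bar>1 - u\<bar> \<le> exp (- c * u)"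
    using abs_one_minus_le_exp[OF b] by blast
  define G where "G t = exp (- ((1 / (2 * ?d) * (norm t)\<^sup>2) powr b))" for t :: "real ^ 'd"
  \<comment> \<open>The integrable majorant is exp (- c (c1 |t|^2)^b). Moving \<open>c\<close>
    inside the power as c^(1/b) gives it the shape treated in
    \<open>radial_exp_integral\<close>.\<close>
  define w where "w t = exp (- ((c powr (1 / b) * c1 * (norm t)\<^sup>2) powr b))" for t :: "real ^ 'd"
  have [measurable]: "f i \<in> borel_measurable borel" "G \<in> borel_measurable borel" for i
    unfolding f_def G_def by measurable
  have Npos: "eventually (\<lambda>i. N i \<ge> 1) sequentially"
    by (rule eventually_compose_filterlim[OF eventually_ge_at_top N])
  have N': "filterlim (\<lambda>i. real (N i)) at_top sequentially"
    by (rule filterlim_compose[OF filterlim_real_sequentially N])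
  have r0: "r \<longlonglongrightarrow> 0"
    unfolding r_def using b by (intro tendsto_neg_powr N') auto
  have rb: "real (N i) * ((r i)\<^sup>2) powr b = 1" if "N i \<ge> 1" for i
  proof -
    have "(r i)\<^sup>2 = real (N i) powr (- 1 / b)"
      by (simp add: r_def power2_eq_square flip: powr_add)
    then have "((r i)\<^sup>2) powr b = real (N i) powr (- 1)" using b by (simp add: powr_powr)
    then show ?thesis using that by (simp add: powr_minus_divide)
  qed
  have rpos: "r i > 0" if "N i \<ge> 1" for i using that by (simp add: r_def)
  have symb: "0 \<le> 1 - walk_symbol t" "1 - walk_symbol t \<le> 2" for t :: "real ^ 'd"
    using walk_symbol_le_1[of t] walk_symbol_ge_m1[of t] by auto
  have nrb: "real (N i) * ((y * (r i)\<^sup>2) powr b) = y powr b" if "N i \<ge> 1" "y \<ge> 0" for i y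
    using rb[OF that(1)] that rpos[OF that(1)] by (simp add: powr_mult mult.left_commute)
  have dom: "\<bar>f i (r i *\<^sub>R t)\<bar> \<le> w t" if k: "N i \<ge> 1" for i t
  proof (cases "r i *\<^sub>R t \<in> torus")
    case True
    let ?v = "1 - walk_symbol (r i *\<^sub>R t)"
    have "\<bar>1 - ?v powr b\<bar> \<le> exp (- c * ?v powr b)"
      using symb b by (intro c powr_mono2) auto
    also have "\<dots> \<le> exp (- c * (c1 * (norm (r i *\<^sub>R t))\<^sup>2) powr b)"
      using c(1) b c1 one_minus_walk_symbol_ge[OF True] by (auto simp: c1_def intro!: powr_mono2)
    finally have "\<bar>1 - ?v powr b\<bar> ^ N i \<le> exp (- c * (c1 * (norm (r i *\<^sub>R t))\<^sup>2) powr b) ^ N i"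
      by (intro power_mono) auto
    also have "\<dots> = exp (- c * (real (N i) * ((c1 * (norm t)\<^sup>2) * (r i)\<^sup>2) powr b))"
      by (simp add: exp_of_nat_mult[symmetric] power_mult_distrib mult_ac)
    also have "\<dots> = exp (- (c * (c1 * (norm t)\<^sup>2) powr b))"
      using c1 by (subst nrb[OF k]) auto
    also have "c * (c1 * (norm t)\<^sup>2) powr b = (c powr (1 / b) * c1 * (norm t)\<^sup>2) powr b"
      using c b c1 by (simp add: powr_mult powr_powr mult.assoc)
    finally have "\<bar>1 - ?v powr b\<bar> ^ N i * \<bar>cos (r i *\<^sub>R t \<bullet> rvec (X i))\<bar> \<le> w t * 1"
      unfolding w_def by (intro mult_mono) auto
    then show ?thesis using True by (simp add: f_def abs_mult power_abs)
  qed (simp add: f_def w_def)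
  have wi: "integrable ?B w"
    unfolding w_def[abs_def] using b c c1 by (intro radial_exp_integral) auto
  let ?v = "\<lambda>i t. 1 - walk_symbol (r i *\<^sub>R t)"
  have flim: "(\<lambda>i. f i (r i *\<^sub>R t)) \<longlonglongrightarrow> G t" for t
  proof -
    have "eventually (\<lambda>i. r i \<noteq> 0) sequentially"
      using Npos by eventually_elim (use rpos in force)
    then have q: "(\<lambda>i. ?v i t / (r i)\<^sup>2) \<longlonglongrightarrow> (norm t)\<^sup>2 / (2 * ?d)"
      by (intro walk_symbol_quadratic_limit r0)
    have qb: "(\<lambda>i. (?v i t / (r i)\<^sup>2) powr b) \<longlonglongrightarrow> ((norm t)\<^sup>2 / (2 * ?d)) powr b"
      using symb b by (intro tendsto_powr'[OF q tendsto_const]) (auto intro!: always_eventually)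
    have rt: "(\<lambda>i. r i *\<^sub>R t) \<longlonglongrightarrow> 0"
      using tendsto_scaleR[OF r0 tendsto_const[of t]] by simp
    have "(\<lambda>i. (r i *\<^sub>R t) \<bullet> rvec (X i)) \<longlonglongrightarrow> 0"
    proof (rule Lim_null_comparison)
      show "eventually (\<lambda>i. norm ((r i *\<^sub>R t) \<bullet> rvec (X i)) \<le> norm t * (lattice_norm (X i) * real (N i) powr (- 1 / (2 * b)))) sequentially"
      proof (intro always_eventually allI)
        fix i
        have "norm ((r i *\<^sub>R t) \<bullet> rvec (X i)) \<le> norm (r i *\<^sub>R t) * norm (rvec (X i))"
          using Cauchy_Schwarz_ineq2[of "r i *\<^sub>R t" "rvec (X i)"] by (simp only: real_norm_def)
        then show "norm ((r i *\<^sub>R t) \<bullet> rvec (X i)) \<le> norm t * (lattice_norm (X i) * real (N i) powr (- 1 / (2 * b)))"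
          by (simp add: r_def lattice_norm_def mult_ac)
      qed
      show "(\<lambda>i. norm t * (lattice_norm (X i) * real (N i) powr (- 1 / (2 * b)))) \<longlonglongrightarrow> 0"
        using tendsto_mult[OF tendsto_const X] by simp
    qed
    then have cl: "(\<lambda>i. cos ((r i *\<^sub>R t) \<bullet> rvec (X i))) \<longlonglongrightarrow> cos 0"
      by (rule tendsto_cos)
    have "(\<lambda>i. (1 - (?v i t / (r i)\<^sup>2) powr b / real (N i)) ^ N i * cos ((r i *\<^sub>R t) \<bullet> rvec (X i)))
       \<longlonglongrightarrow> exp (- (((norm t)\<^sup>2 / (2 * ?d)) powr b)) * cos 0"
      by (intro tendsto_mult cl one_minus_power_limit qb N)
    then have "(\<lambda>i. (1 - (?v i t / (r i)\<^sup>2) powr b / real (N i)) ^ N i * cos ((r i *\<^sub>R t) \<bullet> rvec (X i)))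
       \<longlonglongrightarrow> G t" by (simp add: G_def)
    moreover have "eventually (\<lambda>i. (1 - (?v i t / (r i)\<^sup>2) powr b / real (N i)) ^ N i * cos ((r i *\<^sub>R t) \<bullet> rvec (X i))
       = f i (r i *\<^sub>R t)) sequentially"
    proof -
      have "eventually (\<lambda>i. norm (r i *\<^sub>R t) < pi) sequentially"
        using tendstoD[OF rt, of pi] by simp
      then show ?thesis using Npos
      proof eventually_elim
        case (elim i)
        have "\<bar>(r i *\<^sub>R t) $ j\<bar> \<le> pi" for j
          using component_le_norm_cart[of "r i *\<^sub>R t" j] elim by linarith
        then have "r i *\<^sub>R t \<in> torus" by (simp add: torus_def)
        moreover have "(?v i t / (r i)\<^sup>2) powr b / real (N i) = ?v i t powr b"
        proof -
          have "real (N i) * (?v i t / (r i)\<^sup>2 * (r i)\<^sup>2) powr b = (?v i t / (r i)\<^sup>2) powr b"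
            using symb elim by (intro nrb) auto
          moreover have "?v i t / (r i)\<^sup>2 * (r i)\<^sup>2 = 1 - walk_symbol (r i *\<^sub>R t)"
            using rpos[of i] elim by simp
          ultimately show ?thesis using elim(2) by (metis nonzero_mult_div_cancel_left of_nat_0_eq_iff not_one_le_zero)
        qed
        ultimately show ?case by (simp add: f_def)
      qed
    qed
    ultimately show ?thesis by (rule Lim_transform_eventually)
  qed
  have "(\<lambda>i. \<integral>t. f i (r i *\<^sub>R t) \<partial>?B) \<longlonglongrightarrow> (\<integral>t. G t \<partial>?B)"
  proof -
    obtain M where M: "\<And>i. i \<ge> M \<Longrightarrow> N i \<ge> 1" using Npos by (auto simp: eventually_sequentially)
    have "(\<lambda>i. \<integral>t. f (i + M) (r (i + M) *\<^sub>R t) \<partial>?B) \<longlonglongrightarrow> (\<integral>t. G t \<partial>?B)"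
    proof (rule integral_dominated_convergence[where w = w])
      show "AE t in ?B. (\<lambda>i. f (i + M) (r (i + M) *\<^sub>R t)) \<longlonglongrightarrow> G t"
        using LIMSEQ_ignore_initial_segment[OF flim, of M] by (intro AE_I2)
      show "AE t in ?B. norm (f (i + M) (r (i + M) *\<^sub>R t)) \<le> w t" for i
        using dom[of "i + M"] M[of "i + M"] by simp
    qed (use wi in auto)
    then show ?thesis by (rule LIMSEQ_offset)
  qed
  moreover have "eventually (\<lambda>i. (\<integral>t. f i (r i *\<^sub>R t) \<partial>?B) =
     (2 * pi) ^ CARD('d) * (real (N i) powr (?d / (2 * b)) * sub_walk b (N i) (X i))) sequentially"
    using Npos
  proof eventually_elim
    case (elim i)
    have pw: "real (N i) powr (?d / (2 * b)) * r i ^ CARD('d) = 1"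
      using elim b by (simp add: r_def powr_realpow[symmetric] powr_powr flip: powr_add)
    have "(2 * pi) ^ CARD('d) * sub_walk b (N i) (X i) = (\<integral>t. f i t \<partial>?B)"
      unfolding f_def by (rule sub_walk_fourier[OF b(1) nonneg sums])
    also have "\<dots> = r i ^ CARD('d) * (\<integral>t. f i (r i *\<^sub>R t) \<partial>?B)"
      using lborel_integral_scale(2)[OF rpos[OF elim], of "f i"] by simp
    finally have "real (N i) powr (?d / (2 * b)) * ((2 * pi) ^ CARD('d) * sub_walk b (N i) (X i)) =
      (real (N i) powr (?d / (2 * b)) * r i ^ CARD('d)) * (\<integral>t. f i (r i *\<^sub>R t) \<partial>?B)"
      by (simp only: mult.assoc)
    then show ?case unfolding pw by (simp add: mult_ac)
  qed
  ultimately have "(\<lambda>i. (2 * pi) ^ CARD('d) * (real (N i) powr (?d / (2 * b)) * sub_walk b (N i) (X i)))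
      \<longlonglongrightarrow> (\<integral>t. G t \<partial>?B)"
    by (rule Lim_transform_eventually)
  then have "(\<lambda>i. (2 * pi) ^ CARD('d) * (real (N i) powr (?d / (2 * b)) * sub_walk b (N i) (X i)) / (2 * pi) ^ CARD('d))
      \<longlonglongrightarrow> (\<integral>t. G t \<partial>?B) / (2 * pi) ^ CARD('d)"
    by (intro tendsto_divide tendsto_const) auto
  moreover have "(\<integral>t. G t \<partial>?B) / (2 * pi) ^ CARD('d) = D_const CARD('d) (2 * b)"
  proof -
    have GI: "(\<integral>t. G t \<partial>?B) = unit_ball_vol ?d * (1 / (2 * ?d)) powr (- ?d / 2) * Gamma (1 + ?d / (2 * b))"
      unfolding G_def using b by (subst radial_exp_integral(2)) auto
    \<comment> \<open>The unit ball contributes pi^(d/2) / Gamma (1 + d/2), the variance of the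
      steps (2 d)^(d/2), Fourier inversion (2 pi)^(-d); the powers of 2 and pi combine to (d / (2
      pi))^(d/2).\<close>
    have const: "unit_ball_vol ?d * (1 / (2 * ?d)) powr (- ?d / 2) / (2 * pi) ^ CARD('d) =
        (?d / (2 * pi)) powr (?d / 2) / Gamma (1 + ?d / 2)"
    proof -
      define u where "u = (2::real) powr (?d / 2)"
      define v where "v = ?d powr (?d / 2)"
      define p where "p = pi powr (?d / 2)"
      define \<Gamma> where "\<Gamma> = Gamma (1 + ?d / 2)"
      have pos: "u > 0" "v > 0" "p > 0" "\<Gamma> > 0"
        by (auto simp: u_def v_def p_def \<Gamma>_def intro!: Gamma_real_pos add_pos_nonneg)
      have "(1 / (2 * ?d)) powr (- ?d / 2) = u * v"
        by (simp add: powr_divide powr_minus_divide powr_mult u_def v_def)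
      moreover have "(2 * pi) ^ CARD('d) = (u * p) * (u * p)"
      proof -
        have "(2 * pi) ^ CARD('d) = (2 * pi) powr ?d" by (rule powr_realpow[symmetric]) simp
        also have "?d = ?d / 2 + ?d / 2" by simp
        also have "(2 * pi) powr (?d / 2 + ?d / 2) = (2 * pi) powr (?d / 2) * (2 * pi) powr (?d / 2)"
          by (rule powr_add)
        finally show ?thesis by (simp add: u_def p_def powr_mult)
      qed
      moreover have "(?d / (2 * pi)) powr (?d / 2) = v / (u * p)"
        by (simp add: powr_divide powr_mult u_def v_def p_def)
      moreover have "unit_ball_vol ?d = p / \<Gamma>"
        by (simp add: unit_ball_vol_def p_def \<Gamma>_def add.commute)
      moreover have "p / \<Gamma> * (u * v) / ((u * p) * (u * p)) = v / (u * p) / \<Gamma>"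
        using pos by (simp add: field_simps)
      ultimately show ?thesis unfolding \<Gamma>_def by simp
    qed
    have "(\<integral>t. G t \<partial>?B) / (2 * pi) ^ CARD('d) =
        (unit_ball_vol ?d * (1 / (2 * ?d)) powr (- ?d / 2) / (2 * pi) ^ CARD('d)) * Gamma (1 + ?d / (2 * b))"
      unfolding GI by (simp only: times_divide_eq_left)
    then show ?thesis unfolding const by (simp add: D_const_def)
  qed
  ultimately show ?thesis by simp
qed

section \<open>Off-diagonal regime\<close>

text \<open>Writing the series as the integral of a step function lets the variable be rescaled
  continuously, so that a limit of Riemann-type sums becomes a case of dominated
  convergence.\<close>

lemma suminf_eq_integral_floor:
  fixes f :: "nat \<Rightarrow> real"
  assumes nonneg: "\<And>k. 0 \<le> f k" and f: "summable f"
  shows "has_bochner_integral lborel (\<lambda>u :: real. indicator {0..} u * f (nat \<lfloor>u\<rfloor>)) (\<Sum>k. f k)"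
proof (rule has_bochner_integral_nn_integral)
  have eq: "ennreal (indicator {0..} u * f (nat \<lfloor>u\<rfloor>)) = (\<Sum>k. ennreal (f k) * indicator {real k..<real (Suc k)} u)" for u :: real
  proof (cases "u \<ge> 0")
    case True
    have "ennreal (f k) * indicator {real k..<real (Suc k)} u = (if k = nat \<lfloor>u\<rfloor> then ennreal (f k) else 0)" for k
      using True by (auto simp: indicator_def; linarith)
    then have "(\<lambda>k. ennreal (f k) * indicator {real k..<real (Suc k)} u) sums ennreal (f (nat \<lfloor>u\<rfloor>))"
      using sums_single[of "nat \<lfloor>u\<rfloor>" "\<lambda>k. ennreal (f k)"] by simp
    then show ?thesis using True by (simp add: sums_iff)
  next
    case False
    then have "indicator {real k..<real (Suc k)} u = (0 :: ennreal)" for k by (auto simp: indicator_def)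
    then show ?thesis using False by simp
  qed
  have "(\<integral>\<^sup>+u. ennreal (indicator {0..} u * f (nat \<lfloor>u\<rfloor>)) \<partial>(lborel :: real measure)) =
      (\<integral>\<^sup>+u. (\<Sum>k. ennreal (f k) * indicator {real k..<real (Suc k)} u) \<partial>lborel)"
    unfolding eq ..
  also have "\<dots> = (\<Sum>k. (\<integral>\<^sup>+u. ennreal (f k) * indicator {real k..<real (Suc k)} u \<partial>lborel))"
    by (rule nn_integral_suminf) measurable
  also have "\<dots> = (\<Sum>k. ennreal (f k))"
    by (subst nn_integral_cmult_indicator) auto
  also have "\<dots> = ennreal (\<Sum>k. f k)"
    using nonneg f by (intro suminf_ennreal2)
  finally show "(\<integral>\<^sup>+u. ennreal (indicator {0..} u * f (nat \<lfloor>u\<rfloor>)) \<partial>(lborel :: real measure)) = ennreal (\<Sum>k. f k)" .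
qed (use nonneg suminf_nonneg[OF f] in auto)

lemma nn_integral_powr_tail:
  fixes e u :: real
  assumes "e > 1" "u > 0"
  shows "(\<integral>\<^sup>+s. ennreal (s powr (- e)) * indicator {u..} s \<partial>lborel) = ennreal (u powr (1 - e) / (e - 1))"
proof -
  have "(\<integral>\<^sup>+s. ennreal (s powr (- e)) * indicator {u..} s \<partial>lborel) = ennreal (0 - u powr (1 - e) / (1 - e))"
  proof (rule nn_integral_FTC_atLeast)
    show "((\<lambda>s. s powr (1 - e) / (1 - e)) has_real_derivative s powr (- e)) (at s)" if "u \<le> s" for s
    proof -
      have "((\<lambda>s. s powr (1 - e)) has_real_derivative (1 - e) * s powr (1 - e - 1)) (at s)"
        using that assms by (intro has_real_derivative_powr) auto
      from DERIV_cdivide[OF this, of "1 - e"] show ?thesis using assms by simp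
    qed
    have "((\<lambda>s. s powr (1 - e)) \<longlongrightarrow> 0) at_top"
      using assms by (intro tendsto_neg_powr filterlim_ident) auto
    then show "((\<lambda>s. s powr (1 - e) / (1 - e)) \<longlongrightarrow> 0) at_top"
      using tendsto_divide[OF _ tendsto_const, of _ 0 _ "1 - e"] assms by fastforce
  qed auto
  also have "0 - u powr (1 - e) / (1 - e) = u powr (1 - e) / (e - 1)"
    using assms by (simp add: divide_simps) (simp add: algebra_simps)
  finally show ?thesis .
qed

text \<open>With exp (- c / s) written as the integral of exp (- v) over v >= c / s, Fubini leaves a
  power tail over s >= c / v and then the integral for Gamma e. The divisor e - 1 of the tail
  reduces Gamma e to Gamma (e - 1).\<close>

lemma inverse_gamma_integral:
  fixes c e :: real
  assumes c: "c > 0" and e: "e > 1"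
  shows "has_bochner_integral lborel (\<lambda>s. indicator {0<..} s * (s powr (- e) * exp (- c / s)))
    (c powr (1 - e) * Gamma (e - 1))"
proof (rule has_bochner_integral_nn_integral)
  let ?f = "\<lambda>s v. if 0 < s \<and> c \<le> s * v then ennreal (s powr (- e)) * ennreal (exp (- v)) else 0"
  have "(\<integral>\<^sup>+s. ennreal (indicator {0<..} s * (s powr (- e) * exp (- c / s))) \<partial>lborel) =
      (\<integral>\<^sup>+s. (\<integral>\<^sup>+v. ?f s v \<partial>lborel) \<partial>lborel)"
  proof (rule nn_integral_cong)
    fix s :: real
    show "ennreal (indicator {0<..} s * (s powr (- e) * exp (- c / s))) =
      (\<integral>\<^sup>+v. ?f s v \<partial>lborel)"
    proof (cases "s > 0")
      case True
      have "(\<integral>\<^sup>+v. ?f s v \<partial>lborel) =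
         (\<integral>\<^sup>+v. ennreal (s powr (- e)) * (ennreal (exp (- v)) * indicator {c / s..} v) \<partial>lborel)"
        using True by (intro nn_integral_cong) (auto simp: indicator_def field_simps)
      also have "\<dots> = ennreal (s powr (- e)) * ennreal (exp (- (c / s)))"
        by (subst nn_integral_cmult) (auto simp: nn_integral_exp_tail)
      finally show ?thesis using True by (simp add: ennreal_mult')
    qed simp
  qed
  also have "\<dots> = (\<integral>\<^sup>+v. (\<integral>\<^sup>+s. ?f s v \<partial>lborel) \<partial>lborel)"
    by (rule lborel_pair.Fubini'[symmetric]) measurable
  also have "\<dots> = (\<integral>\<^sup>+v. ennreal (c powr (1 - e) / (e - 1)) * ennreal (indicator {0..} v * v powr (e - 1) / exp v) \<partial>lborel)"
  proof (rule nn_integral_cong)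
    fix v :: real
    show "(\<integral>\<^sup>+s. ?f s v \<partial>lborel) =
       ennreal (c powr (1 - e) / (e - 1)) * ennreal (indicator {0..} v * v powr (e - 1) / exp v)"
    proof (cases "v > 0")
      case True
      have "(\<integral>\<^sup>+s. ?f s v \<partial>lborel) =
         (\<integral>\<^sup>+s. ennreal (exp (- v)) * (ennreal (s powr (- e)) * indicator {c / v..} s) \<partial>lborel)"
      proof (intro nn_integral_cong)
        fix s :: real
        have "0 < s \<and> c \<le> s * v \<longleftrightarrow> c / v \<le> s"
          using True c by (auto simp: field_simps intro: less_le_trans[of 0 "c / v"] zero_less_mult_pos2[of s v])
        then show "?f s v =
            ennreal (exp (- v)) * (ennreal (s powr (- e)) * indicator {c / v..} s)"
          by (auto simp: indicator_def mult.commute)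
      qed
      also have "\<dots> = ennreal (exp (- v)) * ennreal ((c / v) powr (1 - e) / (e - 1))"
        using True c e by (subst nn_integral_cmult) (auto simp: nn_integral_powr_tail)
      also have "\<dots> = ennreal (exp (- v) * ((c / v) powr (1 - e) / (e - 1)))"
        by (rule ennreal_mult'[symmetric]) simp
      also have "exp (- v) * ((c / v) powr (1 - e) / (e - 1)) =
          (c powr (1 - e) / (e - 1)) * (indicator {0..} v * v powr (e - 1) / exp v)"
      proof -
        have "(c / v) powr (1 - e) = c powr (1 - e) * v powr (e - 1)"
          using True c powr_minus_divide[of v "1 - e"] by (simp add: powr_divide)
        then show ?thesis using True by (simp add: exp_minus field_simps)
      qed
      also have "ennreal \<dots> = ennreal (c powr (1 - e) / (e - 1)) * ennreal (indicator {0..} v * v powr (e - 1) / exp v)"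
        using e by (intro ennreal_mult') auto
      finally show ?thesis .
    next
      case False
      then have no: "(0 < s \<and> c \<le> s * v) = False" for s
        using c mult_nonneg_nonpos[of s v] by auto
      show ?thesis unfolding no using False e by (cases "v = 0") auto
    qed
  qed
  also have "\<dots> = ennreal (c powr (1 - e) / (e - 1)) * (\<integral>\<^sup>+v. ennreal (indicator {0..} v * v powr (e - 1) / exp v) \<partial>lborel)"
    by (rule nn_integral_cmult) measurable
  also have "\<dots> = ennreal (c powr (1 - e) / (e - 1)) * ennreal (Gamma e)"
    using e by (subst Gamma_conv_nn_integral_real) auto
  also have "\<dots> = ennreal (c powr (1 - e) / (e - 1) * Gamma e)"
    using e by (intro ennreal_mult'[symmetric]) auto
  also have "Gamma e = (e - 1) * Gamma (e - 1)"
    using Gamma_plus1[of "e - 1"] e nonpos_Ints_nonpos[of "e - 1"] by auto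
  also have "c powr (1 - e) / (e - 1) * ((e - 1) * Gamma (e - 1)) = c powr (1 - e) * Gamma (e - 1)"
    using e by simp
  finally show "(\<integral>\<^sup>+s. ennreal (indicator {0<..} s * (s powr (- e) * exp (- c / s))) \<partial>lborel) =
      ennreal (c powr (1 - e) * Gamma (e - 1))" .
  show "0 \<le> c powr (1 - e) * Gamma (e - 1)"
    using e by (intro mult_nonneg_nonneg less_imp_le[OF Gamma_real_pos]) auto
qed auto

lemma integrable_powr_majorant:
  fixes A e :: real
  assumes "e > 1"
  shows "integrable lborel (\<lambda>s. indicator {0<..} s * (if s < 1 then A else s powr (- e)))"
proof -
  have "integrable lborel (\<lambda>s :: real. indicator {0<..<1} s * A)"
    by (intro integrable_mult_left integrable_real_indicator) auto
  moreover have "integrable lborel (\<lambda>s :: real. indicator {1..} s * s powr (- e))"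
  proof (rule integrableI_nonneg)
    have "(\<integral>\<^sup>+s. ennreal (indicator {1..} s * s powr (- e)) \<partial>lborel) =
        (\<integral>\<^sup>+s. ennreal (s powr (- e)) * indicator {1..} s \<partial>lborel)"
      by (intro nn_integral_cong) (auto simp: indicator_def)
    then show "(\<integral>\<^sup>+s. ennreal (indicator {1..} s * s powr (- e)) \<partial>lborel) < \<infinity>"
      using assms by (simp add: nn_integral_powr_tail)
  qed auto
  ultimately have "integrable lborel (\<lambda>s :: real. indicator {0<..<1} s * A + indicator {1..} s * s powr (- e))"
    by (rule Bochner_Integration.integrable_add)
  also have "(\<lambda>s :: real. indicator {0<..<1} s * A + indicator {1..} s * s powr (- e)) =
      (\<lambda>s. indicator {0<..} s * (if s < 1 then A else s powr (- e)))"
    by (auto simp: fun_eq_iff indicator_def)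
  finally show ?thesis .
qed

text \<open>The gauge \<open>g\<close> measures how deep a point lies in the regime. If no threshold
  on \<open>g\<close> forced \<open>h\<close> to be close to \<open>L\<close>, picking a bad point
  above each integer would produce a sequence contradicting \<open>seq\<close>. The threshold then
  serves every filter, countably generated or not.\<close>

lemma tendsto_of_sequences:
  fixes g :: "'a \<Rightarrow> real" and h :: "'a \<Rightarrow> 'b :: metric_space"
  assumes seq: "\<And>s :: nat \<Rightarrow> 'a. filterlim (\<lambda>i. g (s i)) at_top sequentially \<Longrightarrow> (\<lambda>i. h (s i)) \<longlonglongrightarrow> L"
    and y: "filterlim (\<lambda>k. g (y k)) at_top F"
  shows "((\<lambda>k. h (y k)) \<longlongrightarrow> L) F"
proof (rule tendstoI)
  fix e :: real assume e: "e > 0"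
  have "\<exists>M :: nat. \<forall>a. real M \<le> g a \<longrightarrow> dist (h a) L < e"
  proof (rule ccontr)
    assume "\<not> ?thesis"
    then have "\<forall>M :: nat. \<exists>a. real M \<le> g a \<and> \<not> dist (h a) L < e" by blast
    then obtain s where s: "\<And>M :: nat. real M \<le> g (s M)" "\<And>M. \<not> dist (h (s M)) L < e" by metis
    have "filterlim (\<lambda>i. g (s i)) at_top sequentially"
      by (rule filterlim_at_top_mono[OF filterlim_real_sequentially]) (use s in auto)
    then have "eventually (\<lambda>i. dist (h (s i)) L < e) sequentially"
      using seq e by (auto dest: tendstoD)
    then show False using s by (auto simp: eventually_sequentially)
  qed
  then obtain M :: nat where M: "\<And>a. real M \<le> g a \<Longrightarrow> dist (h a) L < e" by blast
  have "eventually (\<lambda>k. real M \<le> g (y k)) F"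
    using y by (simp add: filterlim_at_top)
  then show "eventually (\<lambda>k. dist (h (y k)) L < e) F"
    by eventually_elim (rule M)
qed

text \<open>The order of magnitude comes from times k of order R^2: there are about R^2 of them,
  each with q of order n R^(-2-2b) and r of order R^(-d), which multiplies to n R^(-d-2b).\<close>

lemma sub_walk_tail_limit:
  fixes N :: "nat \<Rightarrow> nat" and X :: "nat \<Rightarrow> int ^ 'd"
  assumes b: "0 < b" "b < 1"
    and nonneg: "\<And>n k. 0 \<le> sub_coeff b n k" and sums: "\<And>n. sub_coeff b n sums 1"
    and N: "filterlim N at_top sequentially"
    and X: "filterlim (\<lambda>i. lattice_norm (X i)) at_top sequentially"
    and NX: "(\<lambda>i. real (N i) * lattice_norm (X i) powr (- (2 * b))) \<longlonglongrightarrow> 0"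
  shows "(\<lambda>i. (\<Sum>k. sub_coeff b (N i) k * (srw k (X i) + srw (Suc k) (X i))) /
      (real (N i) * lattice_norm (X i) powr (- real CARD('d) - 2 * b))) \<longlonglongrightarrow> C_const CARD('d) (2 * b)"
proof -
  note [simp del] = srw.simps(2)
  let ?d = "real CARD('d)"
  define R where "R i = lattice_norm (X i)" for i
  define q where "q i k = sub_coeff b (N i) k" for i k
  define r where "r i k = srw k (X i) + srw (Suc k) (X i)" for i k
  define a where "a k = (-1) ^ (k + 1) * (b gchoose k)" for k
  \<comment> \<open>The clause k >= 1 matters: division by 0 gives 0, so k = 0 would satisfy the
    inequality.\<close>
  define good where "good i k \<longleftrightarrow> k \<ge> 1 \<and> real (N i) * (4 / real k) powr b \<le> 1 / 2" for i k
  \<comment> \<open>Two demands are met: m - d/2 > b makes the early times negligible, and m >= e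
    makes the majorant of the rescaled summand bounded near s = 0.\<close>
  define m where "m = CARD('d) + 2"
  define e where "e = ?d / 2 + b + 1"
  define D where "D i = real (N i) * R i powr (- ?d - 2 * b)" for i
  have q0: "0 \<le> q i k" for i k by (simp add: q_def nonneg)
  have q_sums: "q i sums 1" for i using sums by (simp add: q_def[abs_def])
  have r0: "0 \<le> r i k" for i k by (simp add: r_def srw_nonneg)
  have e1: "e > 1" using b by (simp add: e_def add_pos_pos)
  have em: "e \<le> real m" using b by (simp add: e_def m_def)
  have ev: "eventually (\<lambda>i. N i \<ge> 1 \<and> R i \<ge> 1) sequentially"
  proof -
    have "eventually (\<lambda>i. N i \<ge> 1) sequentially"
      by (rule eventually_compose_filterlim[OF eventually_ge_at_top N])
    moreover have "eventually (\<lambda>i. R i \<ge> 1) sequentially"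
      unfolding R_def by (rule eventually_compose_filterlim[OF eventually_ge_at_top X])
    ultimately show ?thesis by eventually_elim simp
  qed
  have X': "filterlim R at_top sequentially" using X by (simp add: R_def[abs_def])

  \<comment> \<open>Bounds for two consecutive times of the walk\<close>
  obtain C0 where C0: "C0 > 0"
    "\<And>k x. k \<ge> 1 \<Longrightarrow> srw k (x :: int ^ 'd) \<le> C0 * real k powr (- (?d / 2))"
    "\<And>k x. k \<ge> 1 \<Longrightarrow> srw k (x :: int ^ 'd) * lattice_norm x ^ (2 * m) \<le> C0 * real k powr (real m - ?d / 2)"
    using srw_bounds[of m] by blast
  \<comment> \<open>The power of 2 pays for (k + 1) <= 2 k in the moment bound at time k + 1; the
    summand 1 covers time 0, where \<open>srw\<close> can be 1.\<close>
  define C where "C = C0 * (1 + 2 powr (real m - ?d / 2)) + 1"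
  have Cpos: "C > 0" unfolding C_def using C0(1) by (intro mult_pos_pos add_pos_pos) auto
  have m2: "1 \<le> 2 powr (real m - ?d / 2)" by (rule ge_one_powr_ge_zero) (auto simp: m_def)
  have "C0 * 1 \<le> C0 * 2 powr (real m - ?d / 2)" using C0(1) by (intro mult_left_mono m2) auto
  then have C2: "2 * C0 \<le> C" unfolding C_def distrib_left by linarith
  have r_bd1: "r i k \<le> C * real k powr (- (?d / 2))" if k: "k \<ge> 1" for i k
  proof -
    have "srw (Suc k) (X i) \<le> C0 * real (Suc k) powr (- (?d / 2))" by (rule C0) simp
    also have "\<dots> \<le> C0 * real k powr (- (?d / 2))"
      using C0(1) k by (intro mult_left_mono powr_mono2') auto
    finally have "r i k \<le> C0 * 2 * real k powr (- (?d / 2))"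
      using C0(2)[OF k, of "X i"] by (simp add: r_def)
    also have "\<dots> \<le> C * real k powr (- (?d / 2))"
      using C2 by (intro mult_right_mono) auto
    finally show ?thesis .
  qed
  have r_bd2: "r i k * R i powr (2 * real m) \<le> C * real k powr (real m - ?d / 2)"
    if k: "k \<ge> 1" and R: "R i \<ge> 1" for i k
  proof -
    have Rp: "R i powr (2 * real m) = lattice_norm (X i) ^ (2 * m)"
      using R powr_realpow[of "R i" "2 * m"] by (simp add: R_def)
    have "srw (Suc k) (X i) * lattice_norm (X i) ^ (2 * m) \<le> C0 * real (Suc k) powr (real m - ?d / 2)"
      by (rule C0) simp
    also have "\<dots> \<le> C0 * (2 * real k) powr (real m - ?d / 2)"
      using C0(1) k by (intro mult_left_mono powr_mono2) (auto simp: m_def)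
    also have "\<dots> = C0 * 2 powr (real m - ?d / 2) * real k powr (real m - ?d / 2)"
      by (simp add: powr_mult)
    finally have "r i k * lattice_norm (X i) ^ (2 * m) \<le> (C - 1) * real k powr (real m - ?d / 2)"
      using C0(3)[OF k, of "X i"] by (simp add: r_def C_def algebra_simps)
    also have "\<dots> \<le> C * real k powr (real m - ?d / 2)" by (intro mult_right_mono) auto
    finally show ?thesis unfolding Rp .
  qed
  let ?n = "\<lambda>i. real (N i)"
  have r_bdC: "r i k \<le> C" for i k
  proof (cases "k \<ge> 1")
    case True
    have "r i k \<le> C * real k powr (- (?d / 2))" using True by (rule r_bd1)
    also have "\<dots> \<le> C * 1"
      using Cpos True by (intro mult_left_mono) (auto simp: powr_minus_divide ge_one_powr_ge_zero)
    finally show ?thesis by simp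
  next
    case False
    then have "k = 0" by simp
    have "srw (Suc 0) (X i) \<le> C0" using C0(2)[of "Suc 0" "X i"] by (simp del: srw.simps)
    moreover have "srw 0 (X i) \<le> 1" by simp
    moreover have "C0 + 1 \<le> C" using C0(1) by (simp add: C_def)
    ultimately show ?thesis unfolding \<open>k = 0\<close> r_def by linarith
  qed
  have qr_summable: "summable (\<lambda>k. q i k * r i k)" for i
  proof (rule summable_comparison_test'[of "\<lambda>k. q i k * C" 0])
    show "summable (\<lambda>k. q i k * C)" using q_sums[of i] by (intro summable_mult2) (simp add: sums_iff)
    show "norm (q i k * r i k) \<le> q i k * C" for k
      using q0[of i k] r0[of i k] r_bdC[of i k] by (simp add: abs_mult mult_left_mono)
  qed

  let ?bad = "\<lambda>i k. if good i k then 0 else q i k * r i k"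
  text \<open>
    For \<open>k\<close> of order at most \<open>n\<^bsup>1/b\<^esup> = o(R\<^sup>2)\<close> the expansion of \<open>q\<close> is not available, but there
    \<open>\<Sum>k. q i k = 1\<close> and the polynomial decay of \<open>r\<close> of order \<open>2 m > d + 2 b\<close> suffice.
  \<close>
  have bad: "(\<lambda>i. suminf (?bad i) / D i) \<longlonglongrightarrow> 0"
  proof -
    \<comment> \<open>The exponent left over when k is replaced by its bound of order n^(1/b): n^((m
      - d/2)/b) R^(-2m) divided by n R^(-d-2b) is (n R^(-2b))^\<gamma>.\<close>
    define \<gamma> where "\<gamma> = (real m - ?d / 2) / b - 1"
    have \<gamma>: "\<gamma> > 0"
    proof -
      have "real m - ?d / 2 > 1 * b" using b by (simp add: m_def)
      then show ?thesis using b by (simp only: \<gamma>_def) (simp add: less_divide_eq)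
    qed
    \<comment> \<open>Failure of \<open>good\<close> at k >= 1 means k^b < 2 n 4^b, that is k < 4
      2^(1/b) n^(1/b).\<close>
    define B where "B = 4 * 2 powr (1 / b)"
    have B: "B > 0" by (simp add: B_def)
    have smallk: "real k \<le> B * ?n i powr (1 / b)" if "k \<ge> 1" "\<not> good i k" for i k
    proof -
      have "1 / 2 \<le> ?n i * (4 / real k) powr b" using that by (auto simp: good_def)
      then have "real k powr b \<le> 2 * ?n i * 4 powr b"
        using that by (simp add: powr_divide field_simps)
      then have "(real k powr b) powr (1 / b) \<le> (2 * ?n i * 4 powr b) powr (1 / b)"
        using b by (intro powr_mono2) auto
      then show ?thesis using b that by (simp add: powr_powr powr_mult B_def mult_ac)
    qed
    have le: "suminf (?bad i) / D i \<le>
        C * B powr (real m - ?d / 2) * (?n i * R i powr (- (2 * b))) powr \<gamma>"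
      if i: "N i \<ge> 1 \<and> R i \<ge> 1" for i
    proof -
      let ?c = "C * (B * ?n i powr (1 / b)) powr (real m - ?d / 2) * R i powr (- (2 * real m))"
      have "(if good i k then 0 else q i k * r i k) \<le> q i k * ?c" for k
      proof (cases "k \<ge> 1 \<and> \<not> good i k")
        case True
        have "r i k * R i powr (2 * real m) \<le> C * real k powr (real m - ?d / 2)"
          using True i by (intro r_bd2) auto
        also have "\<dots> \<le> C * (B * ?n i powr (1 / b)) powr (real m - ?d / 2)"
          using Cpos True smallk[of k i] by (intro mult_left_mono powr_mono2) (auto simp: m_def)
        finally have "r i k * R i powr (2 * real m) * R i powr (- (2 * real m)) \<le> ?c"
          by (intro mult_right_mono) auto
        also have "r i k * R i powr (2 * real m) * R i powr (- (2 * real m)) = r i k"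
          using i by (simp add: mult.assoc flip: powr_add)
        finally show ?thesis using True q0 by (simp add: mult_left_mono)
      next
        case False
        \<comment> \<open>Time 0 is not \<open>good\<close> and escapes the decay bound for
          \<open>r\<close>, but it carries no weight once n >= 1.\<close>
        have "q i 0 = 0" using i by (simp add: q_def)
        then show ?thesis using False q0[of i k] Cpos by (cases "k = 0") auto
      qed
      moreover have "summable (?bad i)"
        by (rule summable_comparison_test'[OF qr_summable, of 0]) (use q0 r0 in auto)
      moreover have "(\<lambda>k. q i k * ?c) sums (1 * ?c)" by (intro sums_mult2 q_sums)
      ultimately have "suminf (?bad i) \<le> ?c"
        by (metis (no_types, lifting) mult_1 sums_iff suminf_le)
      then have "suminf (?bad i) / D i \<le> ?c / D i"
        using i by (intro divide_right_mono) (auto simp: D_def)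
      also have "\<dots> = C * B powr (real m - ?d / 2) * (?n i * R i powr (- (2 * b))) powr \<gamma>"
      proof -
        have n: "?n i > 0" and Rp: "R i > 0" using i by auto
        have 1: "(B * ?n i powr (1 / b)) powr (real m - ?d / 2) / ?n i = B powr (real m - ?d / 2) * ?n i powr \<gamma>"
        proof -
          have "1 / b * (real m - ?d / 2) = \<gamma> + 1" by (simp add: \<gamma>_def)
          then have "(B * ?n i powr (1 / b)) powr (real m - ?d / 2) =
              B powr (real m - ?d / 2) * ?n i powr (\<gamma> + 1)"
            by (simp only: powr_mult powr_powr)
          also have "?n i powr (\<gamma> + 1) = ?n i powr \<gamma> * ?n i"
            using n by (simp add: powr_add)
          finally show ?thesis using n by simp
        qed
        have 2: "R i powr (- (2 * real m)) / R i powr (- ?d - 2 * b) = R i powr (- (2 * b) * \<gamma>)"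
        proof -
          have "- (2 * b) * \<gamma> = - (2 * real m) - (- ?d - 2 * b)"
            using b by (simp add: \<gamma>_def field_simps)
          then show ?thesis using Rp by (simp only: powr_diff)
        qed
        have "?c / D i = C * ((B * ?n i powr (1 / b)) powr (real m - ?d / 2) / ?n i) *
            (R i powr (- (2 * real m)) / R i powr (- ?d - 2 * b))"
          by (simp add: D_def)
        also have "\<dots> = C * (B powr (real m - ?d / 2) * ?n i powr \<gamma>) * R i powr (- (2 * b) * \<gamma>)"
          unfolding 1 2 ..
        also have "\<dots> = C * B powr (real m - ?d / 2) * (?n i * R i powr (- (2 * b))) powr \<gamma>"
          by (simp add: powr_mult powr_powr)
        finally show ?thesis .
      qed
      finally show ?thesis .
    qed
    show ?thesis
    proof (rule tendsto_sandwich[OF _ _ tendsto_const])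
      show "eventually (\<lambda>i. 0 \<le> suminf (?bad i) / D i) sequentially"
      proof (intro always_eventually allI divide_nonneg_nonneg suminf_nonneg)
        show "summable (?bad i)" for i
          by (rule summable_comparison_test'[OF qr_summable, of 0]) (use q0 r0 in auto)
      qed (use q0 r0 in \<open>auto simp: D_def\<close>)
      show "eventually (\<lambda>i. suminf (?bad i) / D i \<le>
          C * B powr (real m - ?d / 2) * (?n i * R i powr (- (2 * b))) powr \<gamma>) sequentially"
        using ev by eventually_elim (rule le)
      have "(\<lambda>i. (?n i * R i powr (- (2 * b))) powr \<gamma>) \<longlonglongrightarrow> 0 powr \<gamma>"
        using NX \<gamma> by (intro tendsto_powr') (auto simp: R_def)
      from tendsto_mult[OF tendsto_const this]
      show "(\<lambda>i. C * B powr (real m - ?d / 2) * (?n i * R i powr (- (2 * b))) powr \<gamma>) \<longlonglongrightarrow> 0"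
        using \<gamma> by simp
    qed
  qed

  text \<open>
    The remaining part of the series is the integral of a step function in \<open>s = k / R\<^sup>2\<close>, to which
    dominated convergence applies.
  \<close>
  define G where "G i s = indicator {0..} s * (let k = Suc (nat \<lfloor>(R i)\<^sup>2 * s\<rfloor>) in
      if good i k then q i k * r i k else 0) * (R i)\<^sup>2 / D i" for i and s :: real
  \<comment> \<open>The product of the limits of the three factors in \<open>G_form\<close>: the
    tail constant of q, the local limit with \<rho>^2 = 1 / s, and s^(-e).\<close>
  define L where "L s = indicator {0<..} s * (b / Gamma (1 - b) * (2 * (?d / (2 * pi)) powr (?d / 2)) *
      (s powr (- e) * exp (- (?d / 2) / s)))" for s :: real

  \<comment> \<open>Normalised coefficients at good times\<close>
  have aux_lim: "(\<lambda>k. a k * real k powr (1 + b)) \<longlonglongrightarrow> b / Gamma (1 - b)"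
    unfolding a_def by (rule gbinomial_tail_limit[OF b])
  have q_approx: "\<bar>q i k * real k powr (1 + b) / ?n i - a k * real k powr (1 + b)\<bar>
      \<le> 8 * 4 powr (2 * b) * (?n i * real k powr (- b))"
    if "N i \<ge> 1" "good i k" for i k
  proof -
    have k: "k \<ge> 1" "?n i * (4 / real k) powr b \<le> 1 / 2" using that by (auto simp: good_def)
    have n: "?n i > 0" using that by simp
    have "\<bar>q i k - ?n i * a k\<bar> \<le> 8 / real k * (?n i * (4 / real k) powr b)\<^sup>2"
      unfolding q_def a_def by (rule sub_coeff_approx[OF b that(1) k])
    then have "\<bar>q i k - ?n i * a k\<bar> * (real k powr (1 + b) / ?n i) \<le>
        8 / real k * (?n i * (4 / real k) powr b)\<^sup>2 * (real k powr (1 + b) / ?n i)"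
      by (intro mult_right_mono) auto
    also have "\<bar>q i k - ?n i * a k\<bar> * (real k powr (1 + b) / ?n i) =
        \<bar>(q i k - ?n i * a k) * (real k powr (1 + b) / ?n i)\<bar>"
      using n by (simp add: abs_mult)
    also have "(q i k - ?n i * a k) * (real k powr (1 + b) / ?n i) =
        q i k * real k powr (1 + b) / ?n i - a k * real k powr (1 + b)"
      using n by (simp add: field_simps)
    also have "8 / real k * (?n i * (4 / real k) powr b)\<^sup>2 * (real k powr (1 + b) / ?n i) =
        8 * 4 powr (2 * b) * (?n i * real k powr (- b))"
    proof -
      have 1: "((4 / real k) powr b)\<^sup>2 = 4 powr (2 * b) * real k powr (- (2 * b))"
        using k by (simp add: powr_divide power_divide powr_minus_divide power2_eq_square flip: powr_add)
      have 2: "real k powr (- (2 * b)) * real k powr (1 + b) = real k * real k powr (- b)"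
        using k by (simp add: powr_mult_base flip: powr_add)
      have "8 / real k * (?n i * (4 / real k) powr b)\<^sup>2 * (real k powr (1 + b) / ?n i) =
          8 / real k * ?n i * 4 powr (2 * b) * (real k powr (- (2 * b)) * real k powr (1 + b))"
        unfolding power_mult_distrib 1 using n by (simp add: power2_eq_square)
      also have "\<dots> = 8 * 4 powr (2 * b) * (?n i * real k powr (- b))"
        unfolding 2 using k by simp
      finally show ?thesis .
    qed
    finally show ?thesis .
  qed
  obtain A where A: "A > 0" "\<And>k. \<bar>a k * real k powr (1 + b)\<bar> \<le> A"
    using convergent_imp_Bseq[OF convergentI[OF aux_lim]] unfolding Bseq_def by auto
  define A' where "A' = A + 8 * 4 powr (2 * b)"
  have A': "A' > 0" using A(1) by (simp add: A'_def add_pos_pos)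
  have q_bd: "q i k * real k powr (1 + b) / ?n i \<le> A'" if "N i \<ge> 1" "good i k" for i k
  proof -
    have k: "k \<ge> 1" "?n i * (4 / real k) powr b \<le> 1 / 2" using that by (auto simp: good_def)
    have "?n i * real k powr (- b) \<le> ?n i * (4 / real k) powr b"
      using k b by (intro mult_left_mono) (auto simp: powr_divide powr_minus_divide divide_right_mono ge_one_powr_ge_zero)
    also have "\<dots> \<le> 1" using k by simp
    finally have "8 * 4 powr (2 * b) * (?n i * real k powr (- b)) \<le> 8 * 4 powr (2 * b) * 1"
      by (intro mult_left_mono) auto
    then show ?thesis using q_approx[OF that] A(2)[of k] unfolding A'_def by linarith
  qed

  \<comment> \<open>Integral form of the series and its majorant\<close>
  have G_eq: "(\<Sum>k. if good i k then q i k * r i k else 0) / D i = (\<integral>s. G i s \<partial>lborel)" if "R i \<ge> 1" for i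
  proof -
    let ?f = "\<lambda>k. if good i k then q i k * r i k else 0"
    have fs: "summable ?f" by (rule summable_comparison_test'[OF qr_summable, of 0]) (use q0 r0 in auto)
    then have fs': "summable (\<lambda>k. ?f (Suc k))" by (subst summable_Suc_iff)
    have R2: "(R i)\<^sup>2 > 0" using that by simp
    \<comment> \<open>Time 0 is not \<open>good\<close>, so the sum may start at 1. The shift puts k
      = floor u + 1 in the interval (u, u + 1], which keeps k positive and at least R^2 s.\<close>
    have "(\<Sum>k. ?f k) = (\<Sum>k. ?f (Suc k))"
      using suminf_split_head[OF fs] by (simp add: good_def)
    also have "\<dots> = (\<integral>u. indicator {0..} u * ?f (Suc (nat \<lfloor>u\<rfloor>)) \<partial>(lborel :: real measure))"
      by (rule has_bochner_integral_integral_eq[OF suminf_eq_integral_floor[OF _ fs'], symmetric])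
        (use q0 r0 in auto)
    also have "\<dots> = (R i)\<^sup>2 * (\<integral>s. indicator {0..} ((R i)\<^sup>2 * s) * ?f (Suc (nat \<lfloor>(R i)\<^sup>2 * s\<rfloor>)) \<partial>lborel)"
      using lborel_integral_scale(2)[OF R2, of "\<lambda>u :: real. indicator {0..} u * ?f (Suc (nat \<lfloor>u\<rfloor>))"]
      by (simp only: real_scaleR_def DIM_real power_one_right)
    finally have "(\<Sum>k. ?f k) / D i =
        (\<integral>s. indicator {0..} ((R i)\<^sup>2 * s) * ?f (Suc (nat \<lfloor>(R i)\<^sup>2 * s\<rfloor>)) \<partial>lborel) * ((R i)\<^sup>2 / D i)"
      by (simp only: times_divide_eq_right times_divide_eq_left mult.commute)
    also have "\<dots> = (\<integral>s. indicator {0..} ((R i)\<^sup>2 * s) * ?f (Suc (nat \<lfloor>(R i)\<^sup>2 * s\<rfloor>)) * ((R i)\<^sup>2 / D i) \<partial>lborel)"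
      by (rule integral_mult_left_zero[symmetric])
    also have "\<dots> = (\<integral>s. G i s \<partial>lborel)"
      using that by (intro Bochner_Integration.integral_cong) (auto simp: G_def Let_def indicator_def zero_le_mult_iff)
    finally show ?thesis .
  qed

  \<comment> \<open>Each of the three factors is bounded and converges for fixed s > 0. The powers
    of R match because 2 e = 2 + d + 2 b: the 2 is the change of variable, the rest is the
    normalisation \<open>D\<close>.\<close>
  have G_form: "G i s = q i k * real k powr (1 + b) / ?n i * (real k powr (?d / 2) * r i k) * ((R i)\<^sup>2 / real k) powr e"
    if "R i \<ge> 1" "s > 0" "k = Suc (nat \<lfloor>(R i)\<^sup>2 * s\<rfloor>)" "good i k" for i s k
  proof -
    have k: "real k > 0" using that(3) by simp
    have Rp: "R i > 0" using that by simp
    have 1: "((R i)\<^sup>2 / real k) powr e = R i powr (2 * e) / real k powr e"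
      using Rp by (simp add: powr_divide powr_powr powr_realpow[symmetric] flip: powr_numeral)
    have 2: "real k powr (1 + b) * real k powr (?d / 2) = real k powr e"
      by (simp add: e_def add_ac flip: powr_add)
    have 3: "(R i)\<^sup>2 / R i powr (- ?d - 2 * b) = R i powr (2 * e)"
    proof -
      have "2 * e = 2 - (- ?d - 2 * b)" by (simp add: e_def)
      then have "R i powr (2 * e) = R i powr 2 / R i powr (- ?d - 2 * b)" by (simp only: powr_diff)
      then show ?thesis using Rp by simp
    qed
    have "G i s = q i k * r i k / ?n i * ((R i)\<^sup>2 / R i powr (- ?d - 2 * b))"
      using that by (simp add: G_def D_def)
    also have "\<dots> = q i k * r i k / ?n i * (real k powr (1 + b) * real k powr (?d / 2) * (R i powr (2 * e) / real k powr e))"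
      unfolding 2 3 using k by simp
    also have "\<dots> = q i k * real k powr (1 + b) / ?n i * (real k powr (?d / 2) * r i k) * ((R i)\<^sup>2 / real k) powr e"
      unfolding 1 by (simp add: mult_ac)
    finally show ?thesis .
  qed

  \<comment> \<open>For s < 1 the decay bound makes the integrand at most of order x^(m - e) with x
    = k / R^2 <= 2, and m >= e bounds it by a constant. For s >= 1 the uniform bound on
    \<open>srw\<close> leaves s^(-e), integrable since e > 1.\<close>
  define w where "w s = A' * C * (indicator {0<..} s * (if s < 1 then 2 powr (real m - e) else s powr (- e)))" for s :: real
  have w_int: "integrable lborel w"
    unfolding w_def[abs_def] by (intro integrable_mult_right integrable_powr_majorant e1)
  \<comment> \<open>The indicators in \<open>G\<close> and \<open>w\<close> differ at s = 0; this
    null point is left out, here and in \<open>G_lim\<close>.\<close>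
  have G_dom: "norm (G i s) \<le> w s" if i: "N i \<ge> 1 \<and> R i \<ge> 1" and s: "s \<noteq> 0" for i s
  proof (cases "s > 0 \<and> good i (Suc (nat \<lfloor>(R i)\<^sup>2 * s\<rfloor>))")
    case True
    define k where "k = Suc (nat \<lfloor>(R i)\<^sup>2 * s\<rfloor>)"
    have sp: "s > 0" and g: "good i k" using True by (auto simp: k_def)
    have k1: "k \<ge> 1" by (simp add: k_def)
    have R2: "(R i)\<^sup>2 \<ge> 1" using i by simp
    have fl: "real k = of_int \<lfloor>(R i)\<^sup>2 * s\<rfloor> + 1" using sp R2 by (simp add: k_def)
    have klow: "(R i)\<^sup>2 * s \<le> real k" unfolding fl by linarith
    have kup: "real k \<le> (R i)\<^sup>2 * (s + 1)"
      unfolding fl distrib_left using R2 of_int_floor_le[of "(R i)\<^sup>2 * s"] by linarith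
    define x where "x = real k / (R i)\<^sup>2"
    have R2p: "(R i)\<^sup>2 > 0" using R2 by linarith
    have x: "s \<le> x" "x \<le> s + 1"
      unfolding x_def pos_le_divide_eq[OF R2p] pos_divide_le_eq[OF R2p]
      using klow kup by (simp_all only: mult.commute)
    have xp: "x > 0" using x sp by linarith
    have inv: "((R i)\<^sup>2 / real k) powr e = x powr (- e)"
      using k1 R2 by (simp add: x_def powr_divide powr_minus_divide)
    have rk1: "real k powr (?d / 2) * r i k \<le> C"
    proof -
      have "real k powr (?d / 2) * r i k \<le> real k powr (?d / 2) * (C * real k powr (- (?d / 2)))"
        by (intro mult_left_mono r_bd1 k1) auto
      also have "\<dots> = C" using k1 by (simp add: powr_minus_divide)
      finally show ?thesis .
    qed
    have rk2: "real k powr (?d / 2) * r i k \<le> C * x powr real m"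
    proof -
      have "r i k * R i powr (2 * real m) * (real k powr (?d / 2) * R i powr (- (2 * real m))) \<le>
          C * real k powr (real m - ?d / 2) * (real k powr (?d / 2) * R i powr (- (2 * real m)))"
        using i by (intro mult_right_mono r_bd2 k1) auto
      also have "r i k * R i powr (2 * real m) * (real k powr (?d / 2) * R i powr (- (2 * real m))) = real k powr (?d / 2) * r i k"
        using i by (simp add: powr_minus_divide)
      also have "C * real k powr (real m - ?d / 2) * (real k powr (?d / 2) * R i powr (- (2 * real m))) = C * x powr real m"
      proof -
        have "real k powr (real m - ?d / 2) * real k powr (?d / 2) = real k powr real m"
          by (simp flip: powr_add)
        moreover have "((R i)\<^sup>2) powr real m = R i powr (2 * real m)"
          using i by (simp add: powr_powr flip: powr_numeral)
        ultimately show ?thesis by (simp add: x_def powr_divide powr_minus_divide mult.assoc[symmetric])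
      qed
      finally show ?thesis .
    qed
    have "norm (G i s) = G i s"
      using i q0 r0 by (simp add: G_form[OF _ sp k_def g])
    also have "\<dots> \<le> A' * (real k powr (?d / 2) * r i k) * x powr (- e)"
      unfolding G_form[OF conjunct2[OF i] sp k_def g] inv
      using i g r0 by (intro mult_right_mono q_bd) auto
    also have "\<dots> \<le> A' * (C * (if s < 1 then 2 powr (real m - e) else s powr (- e)))"
    proof (cases "s < 1")
      case s1: True
      have "(real k powr (?d / 2) * r i k) * x powr (- e) \<le> C * x powr real m * x powr (- e)"
        by (intro mult_right_mono rk2) auto
      also have "\<dots> = C * x powr (real m - e)" by (simp add: mult.assoc flip: powr_add)
      also have "\<dots> \<le> C * 2 powr (real m - e)"
        using Cpos x xp s1 em by (intro mult_left_mono powr_mono2) auto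
      finally show ?thesis using A' s1 by (simp add: mult.assoc)
    next
      case s1: False
      have "(real k powr (?d / 2) * r i k) * x powr (- e) \<le> C * x powr (- e)"
        by (intro mult_right_mono rk1) auto
      also have "\<dots> \<le> C * s powr (- e)"
        using Cpos x sp e1 by (intro mult_left_mono powr_mono2') auto
      finally show ?thesis using A' s1 by (simp add: mult.assoc)
    qed
    also have "\<dots> = w s" using sp by (simp add: w_def)
    finally show ?thesis .
  next
    case False
    have "G i s = 0"
    proof (cases "s > 0")
      case True
      then show ?thesis using False by (simp add: G_def Let_def)
    next
      case sneg: False
      then show ?thesis using s by (simp add: G_def)
    qed
    moreover have "0 \<le> w s" using A' Cpos by (auto simp: w_def)
    ultimately show ?thesis by simp
  qed

  \<comment> \<open>Pointwise limit of the integrand\<close>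
  have G_lim: "(\<lambda>i. G i s) \<longlonglongrightarrow> L s" if s: "s \<noteq> 0" for s
  proof (cases "s > 0")
    case False
    then have "G i s = 0" for i using s by (simp add: G_def)
    then show ?thesis using False s by (simp add: L_def)
  next
    case sp: True
    define K where "K i = Suc (nat \<lfloor>(R i)\<^sup>2 * s\<rfloor>)" for i
    have K1: "K i \<ge> 1" for i by (simp add: K_def)
    have fl: "real (K i) = of_int \<lfloor>(R i)\<^sup>2 * s\<rfloor> + 1" for i using sp by (simp add: K_def)
    let ?k = "\<lambda>i. real (K i)"
    have klow: "(R i)\<^sup>2 * s \<le> ?k i" for i unfolding fl by linarith
    have kup: "?k i \<le> (R i)\<^sup>2 * s + 1" for i
      unfolding fl using of_int_floor_le[of "(R i)\<^sup>2 * s"] by linarith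
    have R2: "filterlim (\<lambda>i. (R i)\<^sup>2) at_top sequentially"
      by (rule filterlim_pow_at_top[OF _ X']) simp
    have iR2: "(\<lambda>i. 1 / (R i)\<^sup>2) \<longlonglongrightarrow> 0"
      by (intro tendsto_divide_0[OF tendsto_const] filterlim_at_top_imp_at_infinity R2)
    have ratio: "(\<lambda>i. ?k i / (R i)\<^sup>2) \<longlonglongrightarrow> s"
    proof (rule tendsto_sandwich)
      show "eventually (\<lambda>i. s \<le> ?k i / (R i)\<^sup>2) sequentially"
        using ev by eventually_elim (use klow in \<open>auto simp: le_divide_eq mult.commute\<close>)
      show "eventually (\<lambda>i. ?k i / (R i)\<^sup>2 \<le> s + 1 / (R i)\<^sup>2) sequentially"
        using ev
      proof eventually_elim
        case (elim i)
        have "?k i / (R i)\<^sup>2 \<le> ((R i)\<^sup>2 * s + 1) / (R i)\<^sup>2"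
          by (intro divide_right_mono kup) auto
        then show ?case using elim by (simp add: add_divide_distrib)
      qed
      show "(\<lambda>i. s + 1 / (R i)\<^sup>2) \<longlonglongrightarrow> s" using tendsto_add[OF tendsto_const iR2] by simp
    qed simp
    have inv_ratio: "(\<lambda>i. (R i)\<^sup>2 / ?k i) \<longlonglongrightarrow> 1 / s"
      using tendsto_divide[OF tendsto_const ratio, of 1] sp by simp
    have K_real: "filterlim (\<lambda>i. ?k i) at_top sequentially"
    proof (rule filterlim_at_top_mono)
      show "filterlim (\<lambda>i. s * (R i)\<^sup>2) at_top sequentially"
        by (rule filterlim_tendsto_pos_mult_at_top[OF tendsto_const sp R2])
      show "eventually (\<lambda>i. s * (R i)\<^sup>2 \<le> ?k i) sequentially"
        using klow by (auto simp: mult.commute)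
    qed
    then have K_top: "filterlim K at_top sequentially"
      using filterlim_sequentially_iff_filterlim_real by blast
    \<comment> \<open>For fixed s, k / R^2 tends to s, so n k^(-b) is n R^(-2b) times a convergent
      factor. It follows that k is eventually \<open>good\<close> and that the error in
      \<open>q_approx\<close> vanishes.\<close>
    have nk: "(\<lambda>i. ?n i * ?k i powr (- b)) \<longlonglongrightarrow> 0"
    proof -
      have "(\<lambda>i. ?n i * R i powr (- (2 * b)) * ((R i)\<^sup>2 / ?k i) powr b) \<longlonglongrightarrow> 0 * (1 / s) powr b"
        using NX sp by (intro tendsto_mult tendsto_powr inv_ratio tendsto_const) (auto simp: R_def)
      then have "(\<lambda>i. ?n i * R i powr (- (2 * b)) * ((R i)\<^sup>2 / ?k i) powr b) \<longlonglongrightarrow> 0" by simp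
      moreover have "eventually (\<lambda>i. ?n i * R i powr (- (2 * b)) * ((R i)\<^sup>2 / ?k i) powr b =
          ?n i * ?k i powr (- b)) sequentially"
        using ev
      proof eventually_elim
        case (elim i)
        have "((R i)\<^sup>2) powr b = R i powr (2 * b)" using elim by (simp add: powr_powr flip: powr_numeral)
        then show ?case using elim by (simp add: powr_divide powr_minus_divide)
      qed
      ultimately show ?thesis by (rule Lim_transform_eventually)
    qed
    have good_ev: "eventually (\<lambda>i. good i (K i)) sequentially"
    proof -
      have "(\<lambda>i. 4 powr b * (?n i * ?k i powr (- b))) \<longlonglongrightarrow> 0"
        using tendsto_mult[OF tendsto_const nk] by simp
      then have "eventually (\<lambda>i. 4 powr b * (?n i * ?k i powr (- b)) < 1 / 2) sequentially"
        by (rule order_tendstoD) simp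
      then show ?thesis
        by eventually_elim (use K1 in \<open>auto simp: good_def powr_divide powr_minus_divide mult_ac\<close>)
    qed
    have q_lim: "(\<lambda>i. q i (K i) * ?k i powr (1 + b) / ?n i) \<longlonglongrightarrow> b / Gamma (1 - b)"
    proof -
      have "(\<lambda>i. q i (K i) * ?k i powr (1 + b) / ?n i - a (K i) * ?k i powr (1 + b)) \<longlonglongrightarrow> 0"
      proof (rule Lim_null_comparison)
        show "eventually (\<lambda>i. norm (q i (K i) * ?k i powr (1 + b) / ?n i - a (K i) * ?k i powr (1 + b))
            \<le> 8 * 4 powr (2 * b) * (?n i * ?k i powr (- b))) sequentially"
          using ev good_ev by eventually_elim (use q_approx in auto)
        show "(\<lambda>i. 8 * 4 powr (2 * b) * (?n i * ?k i powr (- b))) \<longlonglongrightarrow> 0"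
          using tendsto_mult[OF tendsto_const nk] by simp
      qed
      from tendsto_add[OF this filterlim_compose[OF aux_lim K_top]] show ?thesis by simp
    qed
    have r_lim: "(\<lambda>i. ?k i powr (?d / 2) * r i (K i)) \<longlonglongrightarrow>
        2 * (?d / (2 * pi)) powr (?d / 2) * exp (- ?d * (sqrt (1 / s))\<^sup>2 / 2)"
      unfolding r_def
    proof (rule srw_local_limit[OF K_top])
      have "(\<lambda>i. sqrt ((R i)\<^sup>2 / ?k i)) \<longlonglongrightarrow> sqrt (1 / s)"
        by (intro tendsto_real_sqrt inv_ratio)
      moreover have "sqrt ((R i)\<^sup>2 / ?k i) = lattice_norm (X i) / sqrt (?k i)" for i
        by (simp add: R_def real_sqrt_divide lattice_norm_def)
      ultimately show "(\<lambda>i. lattice_norm (X i) / sqrt (?k i)) \<longlonglongrightarrow> sqrt (1 / s)" by simp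
    qed
    have "(\<lambda>i. q i (K i) * ?k i powr (1 + b) / ?n i * (?k i powr (?d / 2) * r i (K i)) * ((R i)\<^sup>2 / ?k i) powr e)
       \<longlonglongrightarrow> b / Gamma (1 - b) * (2 * (?d / (2 * pi)) powr (?d / 2) * exp (- ?d * (sqrt (1 / s))\<^sup>2 / 2)) * (1 / s) powr e"
      using sp by (intro tendsto_mult q_lim r_lim tendsto_powr inv_ratio tendsto_const) auto
    also have "b / Gamma (1 - b) * (2 * (?d / (2 * pi)) powr (?d / 2) * exp (- ?d * (sqrt (1 / s))\<^sup>2 / 2)) * (1 / s) powr e = L s"
      using sp by (simp add: L_def powr_divide powr_minus_divide mult_ac)
    finally show ?thesis
    proof (rule Lim_transform_eventually)
      show "eventually (\<lambda>i. q i (K i) * ?k i powr (1 + b) / ?n i * (?k i powr (?d / 2) * r i (K i)) *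
          ((R i)\<^sup>2 / ?k i) powr e = G i s) sequentially"
        using ev good_ev by eventually_elim (rule G_form[symmetric], use sp K_def in auto)
    qed
  qed

  \<comment> \<open>Passage to the limit and value of the constant\<close>
  have AE0: "AE s in lborel. s \<noteq> (0 :: real)" by (rule AE_lborel_singleton)
  have [measurable]: "G i \<in> borel_measurable borel" for i
    unfolding G_def Let_def by measurable
  have [measurable]: "L \<in> borel_measurable borel" unfolding L_def by measurable
  have "(\<lambda>i. \<integral>s. G i s \<partial>lborel) \<longlonglongrightarrow> (\<integral>s. L s \<partial>lborel)"
  proof -
    obtain M where M: "\<And>i. i \<ge> M \<Longrightarrow> N i \<ge> 1 \<and> R i \<ge> 1" using ev by (auto simp: eventually_sequentially)
    have "(\<lambda>i. \<integral>s. G (i + M) s \<partial>lborel) \<longlonglongrightarrow> (\<integral>s. L s \<partial>lborel)"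
    proof (rule integral_dominated_convergence[where w = w])
      show "AE s in lborel. (\<lambda>i. G (i + M) s) \<longlonglongrightarrow> L s"
        using AE0 by eventually_elim (rule LIMSEQ_ignore_initial_segment[OF G_lim])
      show "AE s in lborel. norm (G (i + M) s) \<le> w s" for i
        using AE0 by eventually_elim (rule G_dom, use M[of "i + M"] in auto)
    qed (use w_int in auto)
    then show ?thesis by (rule LIMSEQ_offset)
  qed
  moreover have "(\<integral>s. L s \<partial>lborel) = C_const CARD('d) (2 * b)"
  proof -
    let ?c = "b / Gamma (1 - b) * (2 * (?d / (2 * pi)) powr (?d / 2))"
    have "(\<integral>s. L s \<partial>lborel) = (\<integral>s. ?c * (indicator {0<..} s * (s powr (- e) * exp (- (?d / 2) / s))) \<partial>lborel)"
      by (intro Bochner_Integration.integral_cong) (auto simp: L_def)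
    also have "\<dots> = ?c * (\<integral>s. indicator {0<..} s * (s powr (- e) * exp (- (?d / 2) / s)) \<partial>lborel)"
      by (rule integral_mult_right_zero)
    also have "(\<integral>s. indicator {0<..} s * (s powr (- e) * exp (- (?d / 2) / s)) \<partial>lborel) =
        (?d / 2) powr (1 - e) * Gamma (e - 1)"
      by (rule has_bochner_integral_integral_eq[OF inverse_gamma_integral[OF _ e1]]) simp
    also have "?c * ((?d / 2) powr (1 - e) * Gamma (e - 1)) = C_const CARD('d) (2 * b)"
    proof -
      have d: "?d > 0" by simp
      \<comment> \<open>Reflection produces the factors Gamma (\<alpha>/2) and sin (pi \<alpha>/2)
        of \<open>C_const\<close>. Its leading \<alpha> = 2 b is the b of the tail constant times
        the 2 contributed by two consecutive times.\<close>
      have reflection: "1 / Gamma (1 - b) = Gamma b * sin (pi * b) / pi"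
      proof -
        have pos: "Gamma b > 0" "Gamma (1 - b) > 0" using b by (auto intro!: Gamma_real_pos)
        have "Gamma b * (1 / Gamma b * (1 / Gamma (1 - b))) = Gamma b * (sin (pi * b) / pi)"
          using rGamma_reflection_real[of b] by (simp add: rGamma_inverse_Gamma inverse_eq_divide)
        then show ?thesis using pos by simp
      qed
      have "1 - e = - (?d / 2) - b" by (simp add: e_def)
      then have 1: "(?d / 2) powr (1 - e) = (2 / ?d) powr (?d / 2) * (2 / ?d) powr b"
        by (simp add: powr_diff powr_minus_divide powr_divide)
      have 2: "(?d / (2 * pi)) powr (?d / 2) * (2 / ?d) powr (?d / 2) = pi powr (- ?d / 2)"
        by (simp add: powr_divide powr_mult powr_minus_divide)
      have 3: "(2 / ?d) powr b = 2 powr b * ?d powr (- b)"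
        by (simp add: powr_divide powr_minus_divide)
      have 4: "e - 1 = (?d + 2 * b) / 2" by (simp add: e_def)
      have "?c * ((?d / 2) powr (1 - e) * Gamma (e - 1)) =
          2 * b * (1 / Gamma (1 - b)) * ((?d / (2 * pi)) powr (?d / 2) * (2 / ?d) powr (?d / 2)) * (2 / ?d) powr b * Gamma (e - 1)"
        unfolding 1 by simp
      also have "\<dots> = 2 * b * (Gamma b * sin (pi * b) / pi) * pi powr (- ?d / 2) * (2 powr b * ?d powr (- b)) * Gamma ((?d + 2 * b) / 2)"
        unfolding reflection 2 3 4 ..
      also have "\<dots> = C_const CARD('d) (2 * b)"
      proof -
        have "pi powr (- ?d / 2 - 1) = pi powr (- ?d / 2) / pi" by (simp add: powr_diff)
        then show ?thesis by (simp add: C_const_def mult_ac)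
      qed
      finally show ?thesis .
    qed
    finally show ?thesis .
  qed
  ultimately have Glim: "(\<lambda>i. \<integral>s. G i s \<partial>lborel) \<longlonglongrightarrow> C_const CARD('d) (2 * b)" by simp
  have "(\<lambda>i. suminf (?bad i) / D i + (\<integral>s. G i s \<partial>lborel)) \<longlonglongrightarrow> 0 + C_const CARD('d) (2 * b)"
    by (intro tendsto_add bad Glim)
  moreover have "eventually (\<lambda>i. suminf (?bad i) / D i + (\<integral>s. G i s \<partial>lborel) =
      (\<Sum>k. q i k * r i k) / D i) sequentially"
    using ev
  proof eventually_elim
    case (elim i)
    have s1: "summable (?bad i)"
      by (rule summable_comparison_test'[OF qr_summable, of 0]) (use q0 r0 in auto)
    have s2: "summable (\<lambda>k. if good i k then q i k * r i k else 0)"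
      by (rule summable_comparison_test'[OF qr_summable, of 0]) (use q0 r0 in auto)
    have "(\<Sum>k. q i k * r i k) = (\<Sum>k. (if good i k then 0 else q i k * r i k) + (if good i k then q i k * r i k else 0))"
      by (intro suminf_cong) auto
    also have "\<dots> = suminf (?bad i) + (\<Sum>k. if good i k then q i k * r i k else 0)"
      by (rule suminf_add[OF s1 s2, symmetric])
    finally show ?case using G_eq[of i] elim by (simp add: add_divide_distrib)
  qed
  ultimately have "(\<lambda>i. (\<Sum>k. q i k * r i k) / D i) \<longlonglongrightarrow> 0 + C_const CARD('d) (2 * b)"
    by (rule Lim_transform_eventually)
  then show ?thesis by (simp add: q_def r_def D_def R_def)
qed

section \<open>From random walks to convolution kernels\<close>

abbreviation unit_steps :: "(int ^ 'd) set" where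
  "unit_steps \<equiv> {axis j s | j s. s = 1 \<or> s = -1}"

lemma sum_unit_steps:
  fixes f :: "int ^ 'd \<Rightarrow> real"
  shows "sum f unit_steps = (\<Sum>j\<in>UNIV. f (axis j 1) + f (- axis j 1))"
    and "finite (unit_steps :: (int ^ 'd) set)"
    and "card (unit_steps :: (int ^ 'd) set) = 2 * CARD('d)"
proof -
  let ?A = "(\<lambda>j. axis j 1) ` UNIV :: (int ^ 'd) set" and ?B = "(\<lambda>j. - axis j 1) ` UNIV :: (int ^ 'd) set"
  have neg: "axis j (-1) = - (axis j 1 :: int ^ 'd)" for j
    by (simp add: vec_eq_iff axis_def)
  have eq: "unit_steps = ?A \<union> ?B"
    unfolding neg[symmetric] by blast
  have disj: "?A \<inter> ?B = {}"
    by (auto simp: axis_eq_axis simp flip: neg)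
  have inj: "inj (\<lambda>j. axis j 1 :: int ^ 'd)" "inj (\<lambda>j. - axis j 1 :: int ^ 'd)"
    by (auto simp: inj_on_def axis_eq_axis)
  have gen: "sum g unit_steps = (\<Sum>j\<in>UNIV. g (axis j 1) + g (- axis j 1))" for g :: "int ^ 'd \<Rightarrow> 'x::comm_monoid_add"
    unfolding eq by (subst sum.union_disjoint) (use disj inj in \<open>auto simp: sum.reindex sum.distrib\<close>)
  show "sum f unit_steps = (\<Sum>j\<in>UNIV. f (axis j 1) + f (- axis j 1))" by (rule gen)
  show "finite (unit_steps :: (int ^ 'd) set)" unfolding eq by simp
  show "card (unit_steps :: (int ^ 'd) set) = 2 * CARD('d)"
    using gen[of "\<lambda>_. 1 :: nat"] by simp
qed

text \<open>Independence is given for the increments; S_k is recovered as the sum of those before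
  time k, a function of a block of indices that excludes k. Since S_0 = 0 holds only almost surely,
  the events are compared up to null sets.\<close>

lemma random_walk_indep_increment:
  fixes S :: "nat \<Rightarrow> 'w \<Rightarrow> 'a :: {countable, ab_group_add}"
  assumes rw: "random_walk M S"
  shows "measure M {\<omega> \<in> space M. S k \<omega> = y \<and> S (Suc k) \<omega> - S k \<omega> = e} =
    measure M {\<omega> \<in> space M. S k \<omega> = y} * measure M {\<omega> \<in> space M. S 1 \<omega> - S 0 \<omega> = e}"
proof -
  interpret prob_space M using rw by (simp add: random_walk_def)
  let ?C = "count_space (UNIV :: 'a set)"
  define D where "D i \<omega> = S (Suc i) \<omega> - S i \<omega>" for i \<omega>
  have S [measurable]: "S n \<in> measurable M ?C" for n using rw by (simp add: random_walk_def)
  have S0: "AE \<omega> in M. S 0 \<omega> = 0" using rw by (simp add: random_walk_def)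
  have D [measurable]: "D i \<in> measurable M ?C" for i
    unfolding D_def by measurable
  have ind: "indep_vars (\<lambda>_. ?C) D UNIV"
    using rw by (simp add: random_walk_def D_def[abs_def])
  define T where "T \<omega> = (\<Sum>i<k. D i \<omega>)" for \<omega>
  have sum_meas: "(\<lambda>g. \<Sum>i\<in>A. g i) \<in> measurable (Pi\<^sub>M {..<k} (\<lambda>_. ?C)) ?C" if "A \<subseteq> {..<k}" for A
    using finite_subset[OF that finite_lessThan] that
  proof (induction A rule: finite_induct)
    case (insert a A)
    have [measurable]: "(\<lambda>g. g a) \<in> measurable (Pi\<^sub>M {..<k} (\<lambda>_. ?C)) ?C"
      using insert by (intro measurable_component_singleton) auto
    have [measurable]: "(\<lambda>g. \<Sum>i\<in>A. g i) \<in> measurable (Pi\<^sub>M {..<k} (\<lambda>_. ?C)) ?C"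
      using insert by auto
    have "(\<lambda>g. g a + (\<Sum>i\<in>A. g i)) \<in> measurable (Pi\<^sub>M {..<k} (\<lambda>_. ?C)) ?C"
    \<comment> \<open>The values form a countable set, so measurability of the sum is checked with
      one summand frozen at each of its values.\<close>
    proof (rule measurable_compose_countable[where f = "\<lambda>y g. y + (\<Sum>i\<in>A. g i)" and g = "\<lambda>g. g a"])
      show "(\<lambda>g. y + (\<Sum>i\<in>A. g i)) \<in> measurable (Pi\<^sub>M {..<k} (\<lambda>_. ?C)) ?C" for y
        by (rule measurable_compose[of "\<lambda>g. \<Sum>i\<in>A. g i" _ ?C]) auto
    qed measurable
    then show ?case using insert.hyps by simp
  qed simp
  have iv: "indep_var ?C T ?C (D k)"
  proof -
    have "indep_var ?C ((\<lambda>g. \<Sum>i<k. g i) \<circ> (\<lambda>\<omega>. restrict (\<lambda>i. D i \<omega>) {..<k}))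
        ?C ((\<lambda>g. g k) \<circ> (\<lambda>\<omega>. restrict (\<lambda>i. D i \<omega>) {k}))"
      by (rule indep_var_compose[OF indep_var_restrict[OF ind] sum_meas]) auto
    moreover have "(\<lambda>g. \<Sum>i<k. g i) \<circ> (\<lambda>\<omega>. restrict (\<lambda>i. D i \<omega>) {..<k}) = T"
      by (auto simp: fun_eq_iff T_def)
    moreover have "(\<lambda>g. g k) \<circ> (\<lambda>\<omega>. restrict (\<lambda>i. D i \<omega>) {k}) = D k"
      by (auto simp: fun_eq_iff)
    ultimately show ?thesis by simp
  qed
  have [measurable]: "T \<in> measurable M ?C" using indep_var_rv1[OF iv] .
  have ST: "AE \<omega> in M. S k \<omega> = T \<omega>"
    using S0
  proof eventually_elim
    case (elim \<omega>)
    then show ?case using sum_lessThan_telescope[of "\<lambda>i. S i \<omega>" k] by (simp add: T_def D_def)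
  qed
  have "measure M {\<omega> \<in> space M. S k \<omega> = y \<and> D k \<omega> = e} = measure M {\<omega> \<in> space M. T \<omega> = y \<and> D k \<omega> = e}"
    by (rule measure_eq_AE) (use ST in auto)
  also have "\<dots> = measure M {\<omega> \<in> space M. T \<omega> = y} * measure M {\<omega> \<in> space M. D k \<omega> = e}"
    using indep_varD[OF iv, of "{y}" "{e}"] by (simp add: vimage_def Int_def conj_commute)
  also have "measure M {\<omega> \<in> space M. T \<omega> = y} = measure M {\<omega> \<in> space M. S k \<omega> = y}"
    by (rule measure_eq_AE) (use ST in auto)
  also have "measure M {\<omega> \<in> space M. D k \<omega> = e} = measure (distr M ?C (D k)) {e}"
    by (subst measure_distr) (auto simp: vimage_def Int_def conj_commute)
  also have "distr M ?C (D k) = distr M ?C (D 0)"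
    using rw by (simp add: random_walk_def D_def[abs_def])
  also have "measure (distr M ?C (D 0)) {e} = measure M {\<omega> \<in> space M. D 0 \<omega> = e}"
    by (subst measure_distr) (auto simp: vimage_def Int_def conj_commute)
  finally show ?thesis by (simp add: D_def)
qed

text \<open>The event S_(k+1) = x is split by the last increment, which almost surely is a unit
  step; the pieces reproduce the recursion of \<open>srw\<close>.\<close>

lemma simple_random_walk_srw:
  fixes S :: "nat \<Rightarrow> 'w \<Rightarrow> int ^ 'd"
  assumes "simple_random_walk M S"
  shows "measure M {\<omega> \<in> space M. S k \<omega> = x} = srw k x"
proof -
  have rw: "random_walk M S" using assms by (simp add: simple_random_walk_def)
  interpret prob_space M using rw by (simp add: random_walk_def)
  let ?C = "count_space (UNIV :: (int ^ 'd) set)"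
  have S [measurable]: "S n \<in> measurable M ?C" for n using rw by (simp add: random_walk_def)
  have step: "measure M {\<omega> \<in> space M. S 1 \<omega> - S 0 \<omega> \<in> A} = measure_pmf.prob (pmf_of_set unit_steps) A" for A
  proof -
    have "measure M {\<omega> \<in> space M. S 1 \<omega> - S 0 \<omega> \<in> A} = measure (distr M ?C (\<lambda>\<omega>. S 1 \<omega> - S 0 \<omega>)) A"
      by (subst measure_distr) (auto simp: vimage_def Int_def conj_commute)
    then show ?thesis using assms by (simp add: simple_random_walk_def)
  qed
  have ne: "(unit_steps :: (int ^ 'd) set) \<noteq> {}" by auto
  have step_e: "measure M {\<omega> \<in> space M. S 1 \<omega> - S 0 \<omega> = e} = 1 / (2 * real CARD('d))" if "e \<in> unit_steps" for e
    using step[of "{e}"] that sum_unit_steps(2,3)[where 'd = 'd] ne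
    by (simp add: measure_pmf_of_set measure_pmf_single)
  show ?thesis
  proof (induction k arbitrary: x)
    case 0
    have S0: "AE \<omega> in M. S 0 \<omega> = 0" using rw by (simp add: random_walk_def)
    have "measure M {\<omega> \<in> space M. S 0 \<omega> = x} = measure M (if x = 0 then space M else {})"
      by (rule measure_eq_AE) (use S0 in auto)
    then show ?case by (simp add: prob_space)
  next
    case (Suc k)
    define D where "D \<omega> = S (Suc k) \<omega> - S k \<omega>" for \<omega>
    have [measurable]: "D \<in> measurable M ?C" unfolding D_def by measurable
    define E where "E = (unit_steps :: (int ^ 'd) set)"
    have E: "finite E" unfolding E_def by (rule sum_unit_steps)
    let ?A = "\<lambda>e. {\<omega> \<in> space M. S k \<omega> = x - e \<and> D \<omega> = e}"
    have "measure M {\<omega> \<in> space M. D \<omega> \<in> E} = measure (distr M ?C D) E"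
      by (subst measure_distr) (auto simp: vimage_def Int_def conj_commute)
    also have "distr M ?C D = distr M ?C (\<lambda>\<omega>. S 1 \<omega> - S 0 \<omega>)"
      using rw by (simp add: random_walk_def D_def[abs_def])
    also have "measure \<dots> E = 1"
      using assms sum_unit_steps(2)[where 'd = 'd] ne unfolding E_def
      by (simp add: simple_random_walk_def measure_pmf_of_set)
    finally have "AE \<omega> in M. \<omega> \<in> {\<omega> \<in> space M. D \<omega> \<in> E}"
      by (intro prob_eq_1[THEN iffD1]) auto
    then have AE: "AE \<omega> in M. D \<omega> \<in> E" by (rule AE_mp) auto
    have "measure M {\<omega> \<in> space M. S (Suc k) \<omega> = x} = measure M (\<Union>e\<in>E. ?A e)"
    proof (rule measure_eq_AE)
      show "AE \<omega> in M. (\<omega> \<in> {\<omega> \<in> space M. S (Suc k) \<omega> = x}) = (\<omega> \<in> (\<Union>e\<in>E. ?A e))"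
        using AE
      proof eventually_elim
        case (elim \<omega>)
        have "S k \<omega> = x - D \<omega> \<longleftrightarrow> S (Suc k) \<omega> = x" by (auto simp: D_def algebra_simps)
        then show ?case using elim by auto
      qed
    qed (use E in auto)
    also have "\<dots> = (\<Sum>e\<in>E. measure M (?A e))"
      using E
      by (intro finite_measure_finite_Union) (auto simp: disjoint_family_on_def)
    also have "\<dots> = (\<Sum>e\<in>E. srw k (x - e) / (2 * real CARD('d)))"
      using random_walk_indep_increment[OF rw] Suc step_e by (intro sum.cong) (auto simp: D_def E_def)
    also have "\<dots> = srw (Suc k) x"
      unfolding E_def by (subst sum_unit_steps(1)) (simp add: add_divide_distrib sum_divide_distrib add.commute)
    finally show ?case .
  qed
qed

lemma sums_expectation_nat:
  fixes T :: "'w \<Rightarrow> nat" and f :: "nat \<Rightarrow> real"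
  assumes "prob_space M" and T: "T \<in> measurable M (count_space UNIV)" and f: "\<And>k. \<bar>f k\<bar> \<le> 1"
  shows "(\<lambda>k. measure M {\<omega> \<in> space M. T \<omega> = k} * f k) sums prob_space.expectation M (\<lambda>\<omega>. f (T \<omega>))"
proof -
  interpret prob_space M by fact
  note [measurable] = T
  let ?A = "\<lambda>k. {\<omega> \<in> space M. T \<omega> = k}"
  have "(\<lambda>k. measure M (?A k)) sums measure M (\<Union>k. ?A k)"
    by (rule finite_measure_UNION) (auto simp: disjoint_family_on_def)
  then have sq: "summable (\<lambda>k. measure M (?A k))" by (simp add: sums_iff)
  have i: "integrable M (\<lambda>\<omega>. indicator (?A k) \<omega> * f k)" for k
    by (intro integrable_mult_left) (auto simp: integrable_indicator_iff emeasure_eq_measure)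
  have Ii: "(\<integral>\<omega>. indicator (?A k) \<omega> * c \<partial>M) = measure M (?A k) * c" for k and c :: real
    by (simp add: Int_def conj_ac)
  have eq: "(\<lambda>k. indicator (?A k) \<omega> * f k) sums f (T \<omega>)" if "\<omega> \<in> space M" for \<omega>
  proof -
    have "(\<lambda>k. indicator (?A k) \<omega> * f k) = (\<lambda>k. if k = T \<omega> then f k else 0)"
      using that by (auto simp: indicator_def fun_eq_iff)
    then show ?thesis using sums_single[of "T \<omega>" f] by simp
  qed
  have "(\<lambda>k. \<integral>\<omega>. indicator (?A k) \<omega> * f k \<partial>M) sums (\<integral>\<omega>. (\<Sum>k. indicator (?A k) \<omega> * f k) \<partial>M)"
  proof (rule sums_integral[OF i])
    show "AE \<omega> in M. summable (\<lambda>k. norm (indicator (?A k) \<omega> * f k))"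
    proof (rule AE_I2)
      fix \<omega> assume \<omega>: "\<omega> \<in> space M"
      show "summable (\<lambda>k. norm (indicator (?A k) \<omega> * f k))"
        by (rule summable_finite[of "{T \<omega>}"]) (use \<omega> in \<open>auto simp: indicator_def\<close>)
    qed
    have "norm (indicator (?A k) \<omega> * f k) = indicator (?A k) \<omega> * \<bar>f k\<bar>" for k \<omega>
      by (auto simp: indicator_def)
    then have "(\<lambda>k. \<integral>\<omega>. norm (indicator (?A k) \<omega> * f k) \<partial>M) = (\<lambda>k. measure M (?A k) * \<bar>f k\<bar>)"
      using Ii by simp
    then show "summable (\<lambda>k. \<integral>\<omega>. norm (indicator (?A k) \<omega> * f k) \<partial>M)"
      using f by (simp only:) (rule summable_comparison_test'[OF sq, of 0], auto simp: abs_mult mult_left_le)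
  qed
  also have "(\<integral>\<omega>. (\<Sum>k. indicator (?A k) \<omega> * f k) \<partial>M) = (\<integral>\<omega>. f (T \<omega>) \<partial>M)"
    using eq by (intro Bochner_Integration.integral_cong) (auto simp: sums_iff)
  finally show ?thesis by (simp only: Ii)
qed

text \<open>At u = - ln z the Laplace transform of \<tau>_n is its generating function on (0, 1),
  and uniqueness of power series identifies the coefficients. In return \<open>sub_coeff\<close>
  acquires nonnegativity and total mass 1, which its alternating sum does not reveal.\<close>

lemma discrete_subordinator_sub_coeff:
  fixes \<tau> :: "nat \<Rightarrow> 'w \<Rightarrow> nat"
  assumes "discrete_subordinator \<alpha> M \<tau>"
  shows "measure M {\<omega> \<in> space M. \<tau> n \<omega> = k} = sub_coeff (\<alpha> / 2) n k"
    and "sub_coeff (\<alpha> / 2) n sums 1"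
proof -
  have rw: "random_walk M \<tau>" using assms by (simp add: discrete_subordinator_def)
  interpret prob_space M using rw by (simp add: random_walk_def)
  have T: "\<tau> n \<in> measurable M (count_space UNIV)" using rw by (simp add: random_walk_def)
  let ?q = "\<lambda>k. measure M {\<omega> \<in> space M. \<tau> n \<omega> = k}"
  have s1: "?q sums 1"
    using sums_expectation_nat[OF prob_space_axioms T, of "\<lambda>_. 1"] by (simp add: prob_space)
  have sums: "(\<lambda>k. ?q k * z ^ k) sums (1 - (1 - z) powr (\<alpha> / 2)) ^ n" if z: "0 < z" "z < 1" for z
  proof -
    have zk: "z ^ k = exp (- (- ln z) * real k)" for k
      using z by (simp add: exp_of_nat2_mult)
    have "(\<lambda>k. ?q k * z ^ k) sums expectation (\<lambda>\<omega>. z ^ \<tau> n \<omega>)"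
      using z by (intro sums_expectation_nat prob_space_axioms T) (auto simp: power_le_one)
    also have "expectation (\<lambda>\<omega>. z ^ \<tau> n \<omega>) = (1 - (1 - exp (- (- ln z))) powr (\<alpha> / 2)) ^ n"
    proof -
      have "\<forall>u\<ge>0. expectation (\<lambda>\<omega>. exp (- u * real (\<tau> n \<omega>))) = (1 - (1 - exp (- u)) powr (\<alpha> / 2)) ^ n"
        using assms unfolding discrete_subordinator_def by blast
      moreover have "- ln z \<ge> 0" using z by simp
      ultimately show ?thesis unfolding zk by blast
    qed
    finally show ?thesis using z by simp
  qed
  have "?q = sub_coeff (\<alpha> / 2) n"
  proof (rule powser_eq_on_right_nbhd)
    show "summable (\<lambda>k. ?q k * z ^ k)" if "\<bar>z\<bar> < 1" for z
      by (rule summable_comparison_test'[of ?q 0])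
         (use s1 that in \<open>auto simp: sums_iff abs_mult power_abs intro!: mult_left_le power_le_one\<close>)
    show "summable (\<lambda>k. sub_coeff (\<alpha> / 2) n k * z ^ k)" if "\<bar>z\<bar> < 1" for z
      using sub_coeff_sums[OF that] by (simp add: sums_iff)
    show "(\<Sum>k. ?q k * z ^ k) = (\<Sum>k. sub_coeff (\<alpha> / 2) n k * z ^ k)" if "0 < z" "z < 1" for z
      using sums[OF that] sub_coeff_sums[of z "\<alpha> / 2" n] that by (simp add: sums_iff)
  qed
  then show "?q k = sub_coeff (\<alpha> / 2) n k" "sub_coeff (\<alpha> / 2) n sums 1"
    using s1 by (auto simp: fun_eq_iff)
qed

text \<open>Independence of the processes is formulated for the path \<sigma>-algebras; this places
  the events at a single time in them.\<close>

lemma vimage_algebra_component: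
  fixes X :: "nat \<Rightarrow> 'w \<Rightarrow> 'a"
  shows "{\<omega> \<in> space M. X k \<omega> = y} \<in>
    sets (vimage_algebra (space M) (\<lambda>\<omega> n. X n \<omega>) (\<Pi>\<^sub>M n\<in>UNIV. count_space UNIV))"
proof -
  have "(\<lambda>g. g k) \<in> measurable (\<Pi>\<^sub>M n\<in>(UNIV :: nat set). count_space (UNIV :: 'a set)) (count_space UNIV)"
    by (rule measurable_component_singleton) simp
  then have "(\<lambda>g. g k) -` {y} \<inter> space (\<Pi>\<^sub>M n\<in>(UNIV :: nat set). count_space (UNIV :: 'a set)) \<in> sets (\<Pi>\<^sub>M n\<in>UNIV. count_space UNIV)"
    by (rule measurable_sets) simp
  then have "(\<lambda>\<omega> n. X n \<omega>) -` ((\<lambda>g. g k) -` {y} \<inter> space (\<Pi>\<^sub>M n\<in>(UNIV :: nat set). count_space (UNIV :: 'a set))) \<inter> space M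
      \<in> sets (vimage_algebra (space M) (\<lambda>\<omega> n. X n \<omega>) (\<Pi>\<^sub>M n\<in>UNIV. count_space UNIV))"
    by (rule in_vimage_algebra)
  also have "(\<lambda>\<omega> n. X n \<omega>) -` ((\<lambda>g. g k) -` {y} \<inter> space (\<Pi>\<^sub>M n\<in>(UNIV :: nat set). count_space (UNIV :: 'a set))) \<inter> space M
      = {\<omega> \<in> space M. X k \<omega> = y}"
    by (auto simp: space_PiM)
  finally show ?thesis .
qed

text \<open>Disjoint decomposition by the value k of \<tau>_n: on each piece the subordinate walk is
  S_k, and independence factorises the probability.\<close>

lemma transition_subordinate_sums:
  fixes S :: "nat \<Rightarrow> 'w \<Rightarrow> int ^ 'd" and \<tau> :: "nat \<Rightarrow> 'w \<Rightarrow> nat"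
  assumes S: "simple_random_walk M S" and \<tau>: "discrete_subordinator \<alpha> M \<tau>"
    and ind: "indep_processes M S \<tau>"
  shows "(\<lambda>k. sub_coeff (\<alpha> / 2) n k * srw k x) sums transition_fun M (subordinate S \<tau>) x n"
proof -
  have rwS: "random_walk M S" using S by (simp add: simple_random_walk_def)
  have rwT: "random_walk M \<tau>" using \<tau> by (simp add: discrete_subordinator_def)
  interpret prob_space M using rwS by (simp add: random_walk_def)
  have [measurable]: "S k \<in> measurable M (count_space UNIV)" "\<tau> k \<in> measurable M (count_space UNIV)" for k
    using rwS rwT by (auto simp: random_walk_def)
  let ?A = "\<lambda>k. {\<omega> \<in> space M. S k \<omega> = x} \<inter> {\<omega> \<in> space M. \<tau> n \<omega> = k}"
  have "(\<lambda>k. measure M (?A k)) sums measure M (\<Union>k. ?A k)"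
    by (rule finite_measure_UNION) (auto simp: disjoint_family_on_def)
  also have "(\<Union>k. ?A k) = {\<omega> \<in> space M. subordinate S \<tau> n \<omega> = x}"
    by (auto simp: subordinate_def)
  also have "(\<lambda>k. measure M (?A k)) = (\<lambda>k. sub_coeff (\<alpha> / 2) n k * srw k x)"
  proof
    fix k
    have "measure M (?A k) = measure M {\<omega> \<in> space M. S k \<omega> = x} * measure M {\<omega> \<in> space M. \<tau> n \<omega> = k}"
      using ind unfolding indep_processes_def
      by (rule indep_setD) (rule vimage_algebra_component)+
    then show "measure M (?A k) = sub_coeff (\<alpha> / 2) n k * srw k x"
      using simple_random_walk_srw[OF S] discrete_subordinator_sub_coeff(1)[OF \<tau>] by simp
  qed
  finally show ?thesis by (simp add: transition_fun_def)
qed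

section \<open>The two asymptotic regimes\<close>

text \<open>By the recursion, averaging over the 2 d neighbours replaces \<open>srw k\<close> by
  \<open>srw (Suc k)\<close> in every term; the middle terms 2 p(x), added over d directions and
  divided by 2 d, return p(x).\<close>

lemma sum_neighbours_eq:
  fixes x :: "int ^ 'd" and p :: "int ^ 'd \<Rightarrow> real"
  assumes p: "\<And>x. (\<lambda>k. c k * srw k x) sums p x"
  shows "1 / (2 * real CARD('d)) * (\<Sum>j\<in>UNIV. p (x + axis j 1) + 2 * p x + p (x - axis j 1)) =
    (\<Sum>k. c k * (srw k x + srw (Suc k) x))"
proof -
  have "(\<lambda>k. c k * srw k x + (\<Sum>j\<in>UNIV. c k * srw k (x + axis j 1) + c k * srw k (x - axis j 1)) / (2 * real CARD('d)))
      sums (p x + (\<Sum>j\<in>UNIV. p (x + axis j 1) + p (x - axis j 1)) / (2 * real CARD('d)))"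
    by (intro sums_add sums_divide sums_sum p)
  also have "(\<lambda>k. c k * srw k x + (\<Sum>j\<in>UNIV. c k * srw k (x + axis j 1) + c k * srw k (x - axis j 1)) / (2 * real CARD('d)))
      = (\<lambda>k. c k * (srw k x + srw (Suc k) x))"
    by (simp add: fun_eq_iff sum_distrib_left distrib_left)
  also have "p x + (\<Sum>j\<in>UNIV. p (x + axis j 1) + p (x - axis j 1)) / (2 * real CARD('d)) =
      1 / (2 * real CARD('d)) * (\<Sum>j\<in>UNIV. p (x + axis j 1) + 2 * p x + p (x - axis j 1))"
    by (simp add: sum.distrib field_simps)
  finally show ?thesis by (simp add: sums_iff)
qed

lemma C_const_pos: "0 < \<alpha> \<Longrightarrow> \<alpha> < 2 \<Longrightarrow> d > 0 \<Longrightarrow> C_const d \<alpha> > 0"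
  unfolding C_const_def by (intro mult_pos_pos Gamma_real_pos sin_gt_zero) auto

lemma D_const_pos: "0 < \<alpha> \<Longrightarrow> d > 0 \<Longrightarrow> D_const d \<alpha> > 0"
  unfolding D_const_def by (intro mult_pos_pos divide_pos_pos Gamma_real_pos add_pos_nonneg) auto

text \<open>A minimum merges several divergence conditions into the single gauge that
  \<open>tendsto_of_sequences\<close> takes.\<close>

lemma filterlim_at_top_min:
  fixes f g :: "'k \<Rightarrow> real"
  shows "filterlim (\<lambda>k. min (f k) (g k)) at_top F \<longleftrightarrow> filterlim f at_top F \<and> filterlim g at_top F"
  by (auto simp: filterlim_at_top eventually_conj_iff)

theorem theorem2:
  fixes \<alpha> :: real
    and M :: "'w measure"
    and S :: "nat \<Rightarrow> 'w \<Rightarrow> int ^ 'd"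
    and \<tau> :: "nat \<Rightarrow> 'w \<Rightarrow> nat"
    and p\<alpha> :: "int ^ 'd \<Rightarrow> nat \<Rightarrow> real"
    and F :: "'k filter"
    and n :: "'k \<Rightarrow> nat"
    and x :: "'k \<Rightarrow> int ^ 'd"
  defines "p\<alpha> \<equiv> transition_fun M (subordinate S \<tau>)"
  assumes "0 < \<alpha>" "\<alpha> < 2"
    and "simple_random_walk M S"
    and "discrete_subordinator \<alpha> M \<tau>"
    and "indep_processes M S \<tau>"
    and "filterlim n at_top F"
    and "filterlim (\<lambda>k. lattice_norm (x k)) at_top F"
  shows
    "(((\<lambda>k. real (n k) * lattice_norm (x k) powr (- \<alpha>)) \<longlongrightarrow> 0) F \<longrightarrow>
        (\<lambda>k. 1 / (2 * real CARD('d)) *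
             (\<Sum>j\<in>UNIV. p\<alpha> (x k + axis j 1) (n k) + 2 * p\<alpha> (x k) (n k) + p\<alpha> (x k - axis j 1) (n k)))
        \<sim>[F]
        (\<lambda>k. C_const CARD('d) \<alpha> * real (n k) * lattice_norm (x k) powr (- real CARD('d) - \<alpha>)))
     \<and>
     (filterlim (\<lambda>k. real (n k) * lattice_norm (x k) powr (- \<alpha>)) at_top F \<longrightarrow>
        (\<lambda>k. p\<alpha> (x k) (n k)) \<sim>[F] (\<lambda>k. p\<alpha> 0 (n k)) \<and>
        (\<lambda>k. p\<alpha> 0 (n k)) \<sim>[F] (\<lambda>k. D_const CARD('d) \<alpha> * real (n k) powr (- (real CARD('d) / \<alpha>))))"
proof -
  define b where "b = \<alpha> / 2"
  have b: "0 < b" "b < 1" and \<alpha>: "\<alpha> = 2 * b" using assms(2,3) by (auto simp: b_def)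
  let ?d = "real CARD('d)"
  have p_sums: "(\<lambda>k. sub_coeff b m k * srw k z) sums p\<alpha> z m" for z m
    unfolding p\<alpha>_def b_def by (rule transition_subordinate_sums[OF assms(4-6)])
  have p_eq: "p\<alpha> z m = sub_walk b m z" for z m
    using p_sums[of m z] by (simp add: sub_walk_def sums_iff)
  have q0: "0 \<le> sub_coeff b m k" for m k
    using discrete_subordinator_sub_coeff(1)[OF assms(5), of m k, symmetric] by (simp add: b_def)
  have q1: "sub_coeff b m sums 1" for m
    unfolding b_def by (rule discrete_subordinator_sub_coeff(2)[OF assms(5)])
  have n_real: "filterlim (\<lambda>k. real (n k)) at_top F"
    by (rule filterlim_compose[OF filterlim_real_sequentially assms(7)])
  have n_pos: "eventually (\<lambda>k. n k > 0) F"
    by (rule eventually_compose_filterlim[OF eventually_gt_at_top assms(7)])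
  have x_pos: "eventually (\<lambda>k. lattice_norm (x k) > 0) F"
    by (rule eventually_compose_filterlim[OF eventually_gt_at_top assms(8)])
  define u where "u y = real (fst y) * lattice_norm (snd y) powr (- \<alpha>)" for y :: "nat \<times> (int ^ 'd)"
  show ?thesis
  proof (intro conjI impI)
    assume lim0: "((\<lambda>k. real (n k) * lattice_norm (x k) powr (- \<alpha>)) \<longlongrightarrow> 0) F"
    \<comment> \<open>The condition that \<open>u\<close> tends to 0 is recorded as divergence of
      its inverse. Along \<open>F\<close> this needs u > 0 eventually, which follows from n and |x|
      being eventually positive.\<close>
    define g where "g y = min (real (fst y)) (min (lattice_norm (snd y)) (inverse (u y)))" for y
    define h where "h y = (\<Sum>k. sub_coeff b (fst y) k * (srw k (snd y) + srw (Suc k) (snd y))) /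
       (real (fst y) * lattice_norm (snd y) powr (- ?d - 2 * b))" for y :: "nat \<times> (int ^ 'd)"
    have "((\<lambda>k. h (n k, x k)) \<longlongrightarrow> C_const CARD('d) \<alpha>) F"
    proof (rule tendsto_of_sequences[of g h])
      fix s :: "nat \<Rightarrow> nat \<times> (int ^ 'd)"
      assume "filterlim (\<lambda>i. g (s i)) at_top sequentially"
      then have s: "filterlim (\<lambda>i. real (fst (s i))) at_top sequentially"
        "filterlim (\<lambda>i. lattice_norm (snd (s i))) at_top sequentially"
        "filterlim (\<lambda>i. inverse (u (s i))) at_top sequentially"
        by (simp_all add: g_def filterlim_at_top_min)
      have "(\<lambda>i. u (s i)) \<longlonglongrightarrow> 0"
        using tendsto_inverse_0_at_top[OF s(3)] by simp
      then show "(\<lambda>i. h (s i)) \<longlonglongrightarrow> C_const CARD('d) \<alpha>"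
        unfolding h_def \<alpha> using s(1,2)
        by (intro sub_walk_tail_limit b q0 q1)
           (simp_all add: u_def \<alpha> filterlim_sequentially_iff_filterlim_real)
    next
      have "filterlim (\<lambda>k. inverse (u (n k, x k))) at_top F"
        unfolding u_def fst_conv snd_conv using n_pos x_pos
        by (intro filterlim_inverse_at_top[OF lim0]) (auto elim: eventually_elim2)
      then show "filterlim (\<lambda>k. g (n k, x k)) at_top F"
        using n_real assms(8) by (simp add: g_def filterlim_at_top_min)
    qed
    then have "((\<lambda>k. h (n k, x k) / C_const CARD('d) \<alpha>) \<longlongrightarrow> C_const CARD('d) \<alpha> / C_const CARD('d) \<alpha>) F"
      using C_const_pos[OF assms(2,3), of "CARD('d)"] by (intro tendsto_divide tendsto_const) auto
    then have "((\<lambda>k. h (n k, x k) / C_const CARD('d) \<alpha>) \<longlongrightarrow> 1) F"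
      using C_const_pos[OF assms(2,3), of "CARD('d)"] by simp
    then show "(\<lambda>k. 1 / (2 * real CARD('d)) *
             (\<Sum>j\<in>UNIV. p\<alpha> (x k + axis j 1) (n k) + 2 * p\<alpha> (x k) (n k) + p\<alpha> (x k - axis j 1) (n k)))
        \<sim>[F]
        (\<lambda>k. C_const CARD('d) \<alpha> * real (n k) * lattice_norm (x k) powr (- real CARD('d) - \<alpha>))"
      unfolding sum_neighbours_eq[OF p_sums]
      by (intro asymp_equivI') (simp add: h_def \<alpha> mult_ac del: srw.simps)
  next
    assume lim: "filterlim (\<lambda>k. real (n k) * lattice_norm (x k) powr (- \<alpha>)) at_top F"
    define g where "g y = min (real (fst y)) (u y)" for y
    define h where "h y = real (fst y) powr (?d / (2 * b)) * sub_walk b (fst y) (snd y)" for y :: "nat \<times> (int ^ 'd)"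
    have hx: "((\<lambda>k. h (n k, x k)) \<longlongrightarrow> D_const CARD('d) (2 * b)) F"
    proof (rule tendsto_of_sequences[of g h])
      fix s :: "nat \<Rightarrow> nat \<times> (int ^ 'd)"
      assume "filterlim (\<lambda>i. g (s i)) at_top sequentially"
      then have s: "filterlim (\<lambda>i. real (fst (s i))) at_top sequentially"
        "filterlim (\<lambda>i. u (s i)) at_top sequentially"
        by (simp_all add: g_def filterlim_at_top_min)
      \<comment> \<open>Raising u = n |x|^(-\<alpha>) to the power -1/\<alpha> gives |x|
        n^(-1/\<alpha>), the quantity that \<open>sub_walk_local_limit\<close> wants to
        vanish.\<close>
      have "(\<lambda>i. u (s i) powr (- 1 / (2 * b))) \<longlonglongrightarrow> 0"
        using b by (intro tendsto_neg_powr s) auto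
      moreover have "u y powr (- 1 / (2 * b)) = lattice_norm (snd y) * real (fst y) powr (- 1 / (2 * b))" for y
      proof -
        have "lattice_norm (snd y) \<ge> 0" by (simp add: lattice_norm_def)
        then show ?thesis using b by (simp add: u_def \<alpha> powr_mult powr_powr)
      qed
      ultimately show "(\<lambda>i. h (s i)) \<longlonglongrightarrow> D_const CARD('d) (2 * b)"
        unfolding h_def using s(1)
        by (intro sub_walk_local_limit b q0 q1)
           (simp_all add: filterlim_sequentially_iff_filterlim_real)
    next
      show "filterlim (\<lambda>k. g (n k, x k)) at_top F"
        using n_real lim by (simp add: g_def u_def filterlim_at_top_min)
    qed
    \<comment> \<open>At the origin the same limit theorem applies with gauge n itself, since the
      lattice norm is 0.\<close>
    have h0: "((\<lambda>k. h (n k, 0)) \<longlongrightarrow> D_const CARD('d) (2 * b)) F"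
    proof (rule tendsto_of_sequences[of "\<lambda>m. real m" "\<lambda>m. h (m, 0)"])
      fix s :: "nat \<Rightarrow> nat"
      assume "filterlim (\<lambda>i. real (s i)) at_top sequentially"
      then show "(\<lambda>i. h (s i, 0)) \<longlonglongrightarrow> D_const CARD('d) (2 * b)"
        unfolding h_def fst_conv snd_conv
        by (intro sub_walk_local_limit b q0 q1)
           (simp_all add: filterlim_sequentially_iff_filterlim_real lattice_norm_def flip: zero_vec_def)
    qed (rule n_real)
    have D: "D_const CARD('d) (2 * b) > 0" using b by (intro D_const_pos) auto
    have equiv: "(\<lambda>k. p\<alpha> (z k) (n k)) \<sim>[F] (\<lambda>k. D_const CARD('d) \<alpha> * real (n k) powr (- (?d / \<alpha>)))"
      if "((\<lambda>k. h (n k, z k)) \<longlongrightarrow> D_const CARD('d) (2 * b)) F" for z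
    proof (rule asymp_equivI')
      have "((\<lambda>k. h (n k, z k) / D_const CARD('d) (2 * b)) \<longlongrightarrow> D_const CARD('d) (2 * b) / D_const CARD('d) (2 * b)) F"
        using D that by (intro tendsto_divide tendsto_const) auto
      then show "((\<lambda>k. p\<alpha> (z k) (n k) / (D_const CARD('d) \<alpha> * real (n k) powr (- (?d / \<alpha>)))) \<longlongrightarrow> 1) F"
        using D by (simp add: h_def p_eq \<alpha> powr_minus_divide mult_ac)
    qed
    show "(\<lambda>k. p\<alpha> 0 (n k)) \<sim>[F] (\<lambda>k. D_const CARD('d) \<alpha> * real (n k) powr (- (?d / \<alpha>)))"
      by (rule equiv[OF h0])
    then show "(\<lambda>k. p\<alpha> (x k) (n k)) \<sim>[F] (\<lambda>k. p\<alpha> 0 (n k))"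
      by (rule asymp_equiv_trans[OF equiv[OF hx] asymp_equiv_symI])
  qed
qed

end
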